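(* Let $\tau>0$ and let $V_0,V_1:\mathbb{R}^n\to\mathbb{R}$ be even $C^2$ functions such that the Hessian $\nabla^2V_1(0)$ is positive definite or negative definite. For $\lambda\in\mathbb{R}$ consider $$(\mathrm{P}_\lambda)\qquad\dot x(t)=\sum_{j=1}^2\nabla V_0(x(t-j\tau))+\lambda\sum_{j=1}^2\nabla V_1(x(t-j\tau)),\quad x(t+3\tau)=-x(t)\quad\forall t\in\mathbb{R},$$ and let $\nu_\tau(0^\lambda)$ denote the dimension of the solution space of the linear delay problem $$\dot x(t)=\nabla^2V_0(0)\sum_{j=1}^2x(t-j\tau)+\lambda\nabla^2V_1(0)\sum_{j=1}^2x(t-j\tau),\quad x(t+3\tau)=-x(t)\quad\forall t\in\mathbb{R}.$$ Then: (I) $\Sigma_\tau:=\{\lambda\in\mathbb{R}\mid\nu_\tau(0^\lambda)>0\}$ is a discrete set in $\mathbb{R}$. (II) For each $\mu\in\Sigma_\tau$, at least one of the following alternatives holds: (i) $(\mathrm{P}_\mu)$ admits a sequence of distinct nonzero solutions $x^k$, $k=1,2,\dots$, which converges to zero in $C^1_{\rm loc}(\mathbb{R},\mathbb{R}^n)$ as $k\to\infty$. (ii) There exist left and right neighborhoods $\Lambda^-$ and $\Lambda^+$ of $\mu$ in $\mathbb{R}$ and nonnegative integers $n^+,n^-$ satisfying $n^++n^-\ge\nu_\tau(0^\mu)$ such that for $\lambda\in\Lambda^-\setminus\{\mu\}$ (resp. $\lambda\in\Lambda^+\setminus\{\mu\}$), $(\mathrm{P}_\lambda)$ has at least $n^-$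 (resp. $n^+$) distinct pairs of nontrivial solutions $\{x^i_\lambda,-x^i_\lambda\}$, $i=1,\dots,n^-$ (resp. $n^+$), which converge to zero in $C^1_{\rm loc}(\mathbb{R},\mathbb{R}^n)$ as $\lambda\to\mu$.
   Context: Solutions are differentiable maps $x:\mathbb{R}\to\mathbb{R}^n$. *)

theory Defs
  imports "HOL-Analysis.Analysis" "HOL-Library.Function_Algebras"
begin

text \<open>
  The pointwise vector space structure on functions; it makes \<^const>\<open>dim\<close> available for
  spaces of solutions.
\<close>

instantiation "fun" :: (type, scaleR) scaleR
begin

definition scaleR_fun :: "real \<Rightarrow> ('a \<Rightarrow> 'b) \<Rightarrow> 'a \<Rightarrow> 'b"
  where "scaleR_fun c f = (\<lambda>x. c *\<^sub>R f x)"

instance ..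

end

instance "fun" :: (type, real_vector) real_vector
  by standard (simp_all add: scaleR_fun_def fun_eq_iff scaleR_add_left scaleR_add_right)

definition gradient :: "('a::real_inner \<Rightarrow> real) \<Rightarrow> 'a \<Rightarrow> 'a"
  where "gradient f x = (THE D. GDERIV f x :> D)"

definition hessian :: "(real^'n \<Rightarrow> real) \<Rightarrow> real^'n \<Rightarrow> real^'n^'n"
  where "hessian f x = jacobian (gradient f) (at x)"

definition C2 :: "(real^'n \<Rightarrow> real) \<Rightarrow> bool"
  where "C2 f \<longleftrightarrow>
    (\<forall>x. f differentiable at x) \<and>
    (\<forall>x. gradient f differentiable at x) \<and>
    continuous_on UNIV (hessian f)"

definition even_function :: "('a::uminus \<Rightarrow> 'b) \<Rightarrow> bool"
  where "even_function f \<longleftrightarrow> (\<forall>x. f (- x) = f x)"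

text \<open>
  Symmetry is not part of the following two notions; they are applied only to Hessians of
  \<open>C\<^sup>2\<close> functions, which are symmetric.
\<close>

definition pos_definite :: "real^'n^'n \<Rightarrow> bool"
  where "pos_definite A \<longleftrightarrow> (\<forall>v. v \<noteq> 0 \<longrightarrow> v \<bullet> (A *v v) > 0)"

definition neg_definite :: "real^'n^'n \<Rightarrow> bool"
  where "neg_definite A \<longleftrightarrow> (\<forall>v. v \<noteq> 0 \<longrightarrow> v \<bullet> (A *v v) < 0)"

definition delay_solutions ::
  "(real^'n \<Rightarrow> real) \<Rightarrow> (real^'n \<Rightarrow> real) \<Rightarrow> real \<Rightarrow> real \<Rightarrow> (real \<Rightarrow> real^'n) set"
  where "delay_solutions V0 V1 \<tau> lam =
    {x. (\<forall>t. (x has_vector_derivative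
               ((\<Sum>j=1..2. gradient V0 (x (t - real j * \<tau>)))
                + lam *\<^sub>R (\<Sum>j=1..2. gradient V1 (x (t - real j * \<tau>))))) (at t)) \<and>
        (\<forall>t. x (t + 3 * \<tau>) = - x t)}"

definition linear_delay_solutions ::
  "(real^'n \<Rightarrow> real) \<Rightarrow> (real^'n \<Rightarrow> real) \<Rightarrow> real \<Rightarrow> real \<Rightarrow> (real \<Rightarrow> real^'n) set"
  where "linear_delay_solutions V0 V1 \<tau> lam =
    {x. (\<forall>t. (x has_vector_derivative
               (hessian V0 0 *v (\<Sum>j=1..2. x (t - real j * \<tau>))
                + lam *\<^sub>R (hessian V1 0 *v (\<Sum>j=1..2. x (t - real j * \<tau>))))) (at t)) \<and>
        (\<forall>t. x (t + 3 * \<tau>) = - x t)}"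

text \<open>
  The solution space is always finite-dimensional: its elements are trigonometric polynomials
  of bounded degree. So the convention that \<^const>\<open>dim\<close> is \<open>0\<close> on
  infinite-dimensional spaces plays no role here.
\<close>

definition nullity ::
  "(real^'n \<Rightarrow> real) \<Rightarrow> (real^'n \<Rightarrow> real) \<Rightarrow> real \<Rightarrow> real \<Rightarrow> nat"
  where "nullity V0 V1 \<tau> lam = dim (linear_delay_solutions V0 V1 \<tau> lam)"

definition degenerate_params ::
  "(real^'n \<Rightarrow> real) \<Rightarrow> (real^'n \<Rightarrow> real) \<Rightarrow> real \<Rightarrow> real set"
  where "degenerate_params V0 V1 \<tau> = {lam. nullity V0 V1 \<tau> lam > 0}"

text \<open>
  Convergence in \<open>C\<^sup>1\<^sub>l\<^sub>o\<^sub>c\<close>, meant for differentiable functions \<open>X i\<close> and \<open>x\<close>.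
\<close>

definition C1_loc_limit ::
  "('i \<Rightarrow> real \<Rightarrow> 'a::real_normed_vector) \<Rightarrow> (real \<Rightarrow> 'a) \<Rightarrow> 'i filter \<Rightarrow> bool"
  where "C1_loc_limit X x F \<longleftrightarrow>
    (\<forall>K. compact K \<longrightarrow>
       uniform_limit K X x F \<and>
       uniform_limit K (\<lambda>i t. vector_derivative (X i) (at t))
         (\<lambda>t. vector_derivative x (at t)) F)"

definition left_nbhd :: "real \<Rightarrow> real set \<Rightarrow> bool"
  where "left_nbhd \<mu> L \<longleftrightarrow> L \<subseteq> {..\<mu>} \<and> (\<exists>e>0. {\<mu> - e<..\<mu>} \<subseteq> L)"

definition right_nbhd :: "real \<Rightarrow> real set \<Rightarrow> bool"
  where "right_nbhd \<mu> L \<longleftrightarrow> L \<subseteq> {\<mu>..} \<and> (\<exists>e>0. {\<mu>..<\<mu> + e} \<subseteq> L)"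

text \<open>
  For every parameter in \<open>L\<close> other than \<open>\<mu>\<close> there are \<open>n\<close> distinct pairs \<open>{x, - x}\<close> of
  nontrivial solutions, indexed by \<open>i = 1, \<dots>, n\<close> and tending to zero as the parameter
  tends to \<open>\<mu>\<close> within \<open>L\<close>.
\<close>

definition bifurcating_pairs ::
  "(real^'n \<Rightarrow> real) \<Rightarrow> (real^'n \<Rightarrow> real) \<Rightarrow> real \<Rightarrow> real \<Rightarrow> real set \<Rightarrow> nat \<Rightarrow> bool"
  where "bifurcating_pairs V0 V1 \<tau> \<mu> L n \<longleftrightarrow>
    (\<exists>x :: nat \<Rightarrow> real \<Rightarrow> real \<Rightarrow> real^'n.
       (\<forall>lam\<in>L - {\<mu>}.
          (\<forall>i\<in>{1..n}. x i lam \<in> delay_solutions V0 V1 \<tau> lam \<and> x i lam \<noteq> 0) \<and>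
          inj_on (\<lambda>i. {x i lam, - x i lam}) {1..n}) \<and>
       (\<forall>i\<in>{1..n}. C1_loc_limit (x i) 0 (at \<mu> within L)))"

end

theory Submission
  imports Defs "HOL-Complex_Analysis.Great_Picard"
begin

text \<open>
  After rescaling, the antiperiodic solutions of the delay problem are the functions \<open>x = Cop u\<close> with
  \<open>u = G lam (Cop u)\<close>, where \<open>G lam\<close> is \<open>\<tau>\<close> times the gradient of \<open>V0 + lam V1\<close> and \<open>Cop\<close> integrates the delay
  equation. Antiperiodicity turns the delayed sum \<open>u (t - 1) + u (t - 2)\<close> into \<open>u (t - 1) - u (t + 1)\<close>, so that
  \<open>Cop u\<close> is minus the integral of \<open>u\<close> over the symmetric window \<open>{t - 1..t + 1}\<close>. Hence \<open>Cop\<close> is compact and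
  symmetric, it commutes with constant matrices, and the equation is variational: its left hand side,
  composed with \<open>Cop\<close>, is the derivative of \<open>action lam\<close>. The definite Hessian of \<open>V1\<close> makes the crossing form
  \<open>ip (D1 w) (C w)\<close> definite on the kernel of the linearization at every parameter \<open>\<mu>\<close>.

  A Lyapunov-Schmidt reduction (\<open>reduced_estimates\<close>) leaves a function on the finite-dimensional kernel.
  At the origin it has a strict minimum on one side of \<open>\<mu>\<close> and a strict maximum on the other
  (\<open>reduced_sign\<close>). Applied to the linear equation, the same computation shows that degenerate parameters
  are isolated, which is the first claim. If for parameters arbitrarily close to \<open>\<mu>\<close> on both sides the
  origin were the only critical point in a fixed ball, then by a mountain-pass estimate that is uniform in
  the parameter (\<open>sublevel_component_nonneg\<close>) the function at \<open>\<mu>\<close> would be both nonnegative and nonpositive,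
  hence zero, near the origin, so that \<open>\<mu>\<close> itself would have small nontrivial solutions. So nontrivial
  solutions accumulate at zero for the parameter \<open>\<mu>\<close>, or they exist for all nearby parameters on one side
  (\<open>bifurcation_alternative\<close>).

  In the second case one solution is enough to obtain any number of pairs. The problem is autonomous, a
  nontrivial antiperiodic function is not constant, and its translates by small different times are
  different up to sign (\<open>rescaled_distinct_pairs\<close>). So on that side there are as many pairs as the nullity
  requires.
\<close>

section \<open>A uniform mountain-pass estimate\<close>

lemma connected_takes_value:
  fixes f :: "'a::topological_space \<Rightarrow> real"
  assumes "connected S" "continuous_on S f" "a \<in> S" "b \<in> S" "f a \<le> r" "r \<le> f b"
  obtains y where "y \<in> S" "f y = r"
proof -
  have "connected (f ` S)" using assms by (intro connected_continuous_image)
  then have "r \<in> f ` S" using connectedD_interval[of "f ` S" "f a" "f b" r] assms by auto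
  then show thesis using that by auto
qed

lemma derivative_along_line:
  fixes \<phi> :: "'a::real_normed_vector \<Rightarrow> real"
  assumes "(\<phi> has_derivative D) (at (z + t *\<^sub>R h))"
  shows "((\<lambda>t. \<phi> (z + t *\<^sub>R h)) has_real_derivative D h) (at t)"
proof -
  have l: "linear D" using assms by (rule has_derivative_linear)
  have "((\<lambda>t. \<phi> (z + t *\<^sub>R h)) has_derivative (\<lambda>s. D (s *\<^sub>R h))) (at t)"
    by (rule has_derivative_compose[where g = \<phi> and f = "\<lambda>t. z + t *\<^sub>R h", OF _ assms])
       (auto intro!: derivative_eq_intros)
  then show ?thesis
    by (rule has_derivative_imp_has_field_derivative) (simp add: linear_cmul[OF l] mult.commute)
qed

text \<open>
  Let \<open>U c\<close> be the component of the origin in the sublevel set \<open>\<phi> < c\<close>. For small \<open>c\<close> it stays next to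
  the strict minimum at \<open>0\<close>, so \<open>\<phi>\<close> is nonnegative on it, and the point is that \<open>c\<close> can be raised up to
  a level \<open>\<gamma>\<close> that depends only on the slope \<open>\<eta>\<close> in the annulus and on \<open>\<epsilon>\<close>, not on \<open>\<phi>\<close>. Two obstructions
  have to be excluded. The component cannot cross the annulus at a low level, since minimizing \<open>\<phi>\<close> plus
  a cone of slope \<open>\<eta> / 2\<close> there (Ekeland's device) would give a point of too small slope. And it cannot
  merge with another component, since the merging point would be critical: at a noncritical point a
  fixed direction decreases \<open>\<phi>\<close> in a whole ball, so that the sublevel set is connected on that side.
\<close>

lemma sublevel_component_nonneg:
  fixes \<phi> :: "'a::euclidean_space \<Rightarrow> real" and D :: "'a \<Rightarrow> 'a \<Rightarrow> real"
  assumes pos: "\<epsilon> > 0" "\<eta> > 0" "\<gamma> > 0" and small: "16 * \<gamma> \<le> \<eta> * \<epsilon>"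
    and der: "\<And>z. norm z < \<epsilon> \<Longrightarrow> (\<phi> has_derivative D z) (at z)"
    and cont: "\<And>h. continuous_on (ball 0 \<epsilon>) (\<lambda>z. D z h)"
    and crit: "\<And>z. norm z < \<epsilon> \<Longrightarrow> z \<noteq> 0 \<Longrightarrow> \<exists>h. D z h < 0"
    and slope: "\<And>z. \<epsilon> / 2 \<le> norm z \<Longrightarrow> norm z < \<epsilon> \<Longrightarrow> \<exists>h. norm h \<le> 1 \<and> D z h \<le> - \<eta>"
    and zero: "\<phi> 0 = 0"
    and locmin: "d > 0" "\<And>z. z \<noteq> 0 \<Longrightarrow> norm z < d \<Longrightarrow> \<phi> z > 0"
    and T: "connected T" "0 \<in> T" "T \<subseteq> ball 0 \<epsilon>" "\<And>z. z \<in> T \<Longrightarrow> \<phi> z < \<gamma>"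
    and zT: "z \<in> T"
  shows "\<phi> z \<ge> 0"
proof -
  define Sub where "Sub c = {z \<in> ball 0 \<epsilon>. \<phi> z < c}" for c
  define U where "U c = connected_component_set (Sub c) 0" for c
  have cphi: "continuous_on (ball 0 \<epsilon>) \<phi>"
    using der by (auto intro!: continuous_at_imp_continuous_on has_derivative_continuous)
  have opS: "open (Sub c)" for c
  proof -
    have "Sub c = ball 0 \<epsilon> \<inter> \<phi> -` {..<c}" by (auto simp: Sub_def)
    then show ?thesis using continuous_open_preimage[OF cphi open_ball open_lessThan] by simp
  qed
  have opU: "open (U c)" for c unfolding U_def by (rule open_connected_component[OF opS])
  have conU: "connected (U c)" for c unfolding U_def by (rule connected_connected_component)
  have US: "U c \<subseteq> Sub c" for c unfolding U_def by (rule connected_component_subset)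
  have Ub: "U c \<subseteq> ball 0 \<epsilon>" and Ul: "x \<in> U c \<Longrightarrow> \<phi> x < c" for c x
    using US[of c] by (auto simp: Sub_def)
  have in0: "0 \<in> U c" if "c > 0" for c
    unfolding U_def using that zero pos by (auto simp: Sub_def connected_component_refl)
  have max: "Q \<subseteq> U c" if "connected Q" "Q \<subseteq> Sub c" "x \<in> Q" "x \<in> U c" for Q c x
    using connected_component_maximal[OF that(3,1,2)] that(4)
    unfolding U_def by (metis connected_component_eq)
  have normIVT: "\<exists>y\<in>U c. norm y = r" if "c > 0" "x \<in> U c" "0 \<le> r" "r \<le> norm x" for c x r
    by (rule connected_takes_value[OF conU[of c], of norm 0 x r])
       (use that in0 in \<open>auto intro!: continuous_intros\<close>)
  have closure_in: "x \<in> U c" if x: "x \<in> closure (U c)" "x \<in> Sub c" for x c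
  proof -
    obtain r where r: "r > 0" "ball x r \<subseteq> Sub c" using opS x(2) openE by blast
    obtain y where "y \<in> U c" "dist y x < r" using x(1) r(1) closure_approachable by blast
    then show ?thesis using max[of "ball x r" c y] r by (auto simp: dist_commute)
  qed
  \<comment> \<open>the levels up to which the claim is already known; the supremum belongs to this set, and every level below \<open>\<gamma>\<close> can be raised\<close>
  define G where "G = {c. 0 < c \<and> c \<le> \<gamma> \<and> (\<forall>z\<in>U c. \<phi> z \<ge> 0)}"
  have ne: "G \<noteq> {}"
  proof -
    define d' where "d' = min d \<epsilon> / 2"
    have d': "0 < d'" "d' < d" "d' < \<epsilon>" using pos locmin by (auto simp: d'_def)
    have "sphere (0::'a) d' \<noteq> {}" using d' by (simp add: sphere_eq_empty)
    then obtain x where x: "x \<in> sphere 0 d'" "\<And>y. y \<in> sphere 0 d' \<Longrightarrow> \<phi> x \<le> \<phi> y"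
      using continuous_attains_inf[OF compact_sphere, of 0 d' \<phi>] continuous_on_subset[OF cphi, of "sphere 0 d'"] d'
      by fastforce
    have px: "\<phi> x > 0" using x(1) d' locmin(2)[of x] by auto
    have "min \<gamma> (\<phi> x) \<in> G"
    proof -
      have "\<phi> y \<ge> 0" if y: "y \<in> U (min \<gamma> (\<phi> x))" for y
      proof -
        have "norm y < d'"
        proof (rule ccontr)
          assume "\<not> norm y < d'"
          then obtain y' where y': "y' \<in> U (min \<gamma> (\<phi> x))" "norm y' = d'"
            using normIVT[OF _ y, of d'] d' px pos by auto
          then show False using Ul[OF y'(1)] x(2)[of y'] by simp
        qed
        then show ?thesis using locmin(2)[of y] d' zero by (cases "y = 0") auto
      qed
      then show ?thesis using px pos by (auto simp: G_def)
    qed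
    then show ?thesis by auto
  qed
  have bdd: "bdd_above G" by (auto simp: G_def intro!: bdd_aboveI[of _ \<gamma>])
  have SupG: "Sup G \<in> G"
  proof -
    obtain c0 where c0: "c0 \<in> G" using ne by auto
    have le: "Sup G \<le> \<gamma>" using ne by (auto intro!: cSup_least simp: G_def)
    have p: "Sup G > 0" using cSup_upper[OF c0 bdd] c0 by (auto simp: G_def)
    have "\<phi> x \<ge> 0" if x: "x \<in> U (Sup G)" for x
    proof -
      \<comment> \<open>on a path in \<open>U (Sup G)\<close> the maximum of \<open>\<phi>\<close> is below \<open>Sup G\<close>, so the path lives at a smaller level of \<open>G\<close>\<close>
      have "path_connected (U (Sup G))"
        using connected_open_path_connected[OF opU conU] .
      then obtain g where g: "path g" "path_image g \<subseteq> U (Sup G)" "pathstart g = 0" "pathfinish g = x"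
        using in0[OF p] x unfolding path_connected_def by blast
      have cg: "continuous_on (path_image g) \<phi>"
        using continuous_on_subset[OF cphi] g(2) Ub by blast
      obtain m where m: "m \<in> path_image g" "\<And>y. y \<in> path_image g \<Longrightarrow> \<phi> y \<le> \<phi> m"
        using continuous_attains_sup[OF compact_path_image[OF g(1)] path_image_nonempty cg] by auto
      have "\<phi> m < Sup G" using m g Ul by blast
      then obtain c where c: "c \<in> G" "\<phi> m < c" using less_cSup_iff[OF ne bdd] by auto
      have "path_image g \<subseteq> Sub c"
        using g(2) Ub m(2) c(2) unfolding Sub_def by fastforce
      moreover have "0 \<in> path_image g" "x \<in> path_image g"
        using g pathstart_in_path_image[of g] pathfinish_in_path_image[of g] by auto
      ultimately have "x \<in> U c"
        using max[OF connected_path_image[OF g(1)], of c 0] in0[of c] c by (auto simp: G_def)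
      then show ?thesis using c by (auto simp: G_def)
    qed
    then show ?thesis using p le by (auto simp: G_def)
  qed
  have step: "\<exists>c'\<in>G. c < c'" if cG: "c \<in> G" and cl: "c < \<gamma>" for c
  proof -
    have c: "c > 0" "\<And>x. x \<in> U c \<Longrightarrow> \<phi> x \<ge> 0" using cG by (auto simp: G_def)
    have clpos: "\<phi> x \<ge> 0" and clle: "\<phi> x \<le> c" if x: "x \<in> closure (U c)" "norm x < \<epsilon>" for x
    proof -
      have cx: "continuous (at x) \<phi>" using der[OF x(2)] has_derivative_continuous by blast
      obtain s where s: "\<And>n. s n \<in> U c" "s \<longlonglongrightarrow> x" using x(1) closure_sequential by blast
      have lim: "(\<lambda>n. \<phi> (s n)) \<longlonglongrightarrow> \<phi> x" using continuous_within_tendsto_compose'[OF cx _ s(2)] by simp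
      show "\<phi> x \<ge> 0" by (rule LIMSEQ_le_const[OF lim]) (use s c in auto)
      show "\<phi> x \<le> c" by (rule LIMSEQ_le_const2[OF lim]) (use s Ul less_imp_le in blast)
    qed
    have inside: "norm p < 3 * \<epsilon> / 4" if pU: "p \<in> U c" for p
    proof (rule ccontr)
      assume "\<not> ?thesis"
      then obtain p where p: "p \<in> U c" "norm p = 3 * \<epsilon> / 4"
        using normIVT[OF c(1) pU, of "3 * \<epsilon> / 4"] pos by auto
      \<comment> \<open>the cone of slope \<open>\<eta> / 2\<close> outweighs the drop from level \<open>\<gamma>\<close> to \<open>0\<close> at distance \<open>2 * \<gamma> / \<eta>\<close>, so the minimizer is an inner point\<close>
      define r where "r = 2 * \<gamma> / \<eta>"
      have r: "r > 0" "r \<le> \<epsilon> / 8" using pos small by (auto simp: r_def field_simps)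
      let ?K = "closure (U c) \<inter> cball p r"
      have near: "\<epsilon> / 2 \<le> norm x \<and> norm x < \<epsilon>" if "x \<in> cball p r" for x
      proof -
        have "\<bar>norm x - norm p\<bar> \<le> norm (x - p)" by (rule norm_triangle_ineq3)
        also have "\<dots> \<le> r" using that by (simp add: dist_norm norm_minus_commute)
        finally show ?thesis using p(2) r pos by auto
      qed
      have "continuous_on ?K \<phi>" by (rule continuous_on_subset[OF cphi]) (use near in auto)
      then have cK: "continuous_on ?K (\<lambda>x. \<phi> x + \<eta> / 2 * norm (x - p))" by (intro continuous_intros)
      have pK: "p \<in> ?K" using p(1) r closure_subset by auto
      obtain q where q: "q \<in> ?K"
          "\<And>y. y \<in> ?K \<Longrightarrow> \<phi> q + \<eta> / 2 * norm (q - p) \<le> \<phi> y + \<eta> / 2 * norm (y - p)"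
        using continuous_attains_inf[OF _ _ cK] pK by (metis closed_closure closed_Int_compact compact_cball empty_iff)
      have ineq: "\<phi> q + \<eta> / 2 * norm (q - p) < c" using q(2)[OF pK] Ul[OF p(1)] by simp
      have q0: "\<phi> q \<ge> 0" using clpos[of q] q(1) near by blast
      have nq: "norm (q - p) < r"
      proof -
        have "\<eta> / 2 * norm (q - p) < \<gamma>" using ineq q0 cl by linarith
        then show ?thesis using pos by (simp add: r_def field_simps)
      qed
      have "\<phi> q < c" using ineq pos by (smt (verit) mult_nonneg_nonneg norm_ge_zero divide_pos_pos)
      then have qU: "q \<in> U c" using closure_in[of q c] q(1) near[of q] by (auto simp: Sub_def)
      obtain h where h: "norm h \<le> 1" "D q h \<le> - \<eta>" using slope near q(1) by blast
      define f where "f t = \<phi> (q + t *\<^sub>R h) + \<eta> / 2 * t" for t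
      have "(f has_real_derivative D q h + \<eta> / 2) (at 0)"
        unfolding f_def by (auto intro!: derivative_eq_intros derivative_along_line der) (use near q in auto)
      then obtain d1 where d1: "d1 > 0" "\<And>t. t > 0 \<Longrightarrow> t < d1 \<Longrightarrow> f t < f 0"
        using has_real_derivative_neg_dec_right[of f "D q h + \<eta> / 2" 0 UNIV] h pos by (auto simp: dist_norm)
      have "open (U c \<inter> ball p r)" using opU by auto
      moreover have "q \<in> U c \<inter> ball p r" using qU nq by (simp add: dist_norm norm_minus_commute)
      ultimately obtain e where e: "e > 0" "ball q e \<subseteq> U c \<inter> ball p r" using openE by blast
      define t where "t = min d1 e / 2"
      have t: "t > 0" "t < d1" "t < e" using d1 e by (auto simp: t_def)
      have th: "norm (t *\<^sub>R h) \<le> t" using h t mult_left_mono[of "norm h" 1 t] by simp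
      have "norm (q - (q + t *\<^sub>R h)) < e"
        using th t(3) by (metis add_diff_cancel_left' norm_minus_commute order.strict_trans1)
      then have "q + t *\<^sub>R h \<in> ball q e" by (simp only: mem_ball dist_norm)
      then have "q + t *\<^sub>R h \<in> ?K" using e(2) closure_subset[of "U c"] by auto
      from q(2)[OF this] have "\<phi> q \<le> \<phi> (q + t *\<^sub>R h) + \<eta> / 2 * (norm (q + t *\<^sub>R h - p) - norm (q - p))"
        by (simp add: algebra_simps)
      also have "\<dots> \<le> \<phi> (q + t *\<^sub>R h) + \<eta> / 2 * t"
      proof -
        have "norm (q + t *\<^sub>R h - p) - norm (q - p) \<le> t"
          using norm_triangle_ineq[of "q - p" "t *\<^sub>R h"] th by (simp add: algebra_simps)
        then show ?thesis using pos by (auto intro!: mult_left_mono)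
      qed
      finally show False using d1(2)[OF t(1,2)] by (simp add: f_def)
    qed
    define K where "K = closure (U c)"
    have Kn: "norm x \<le> 3 * \<epsilon> / 4" if "x \<in> K" for x
    proof -
      have "U c \<subseteq> cball 0 (3 * \<epsilon> / 4)" using inside by force
      then have "K \<subseteq> cball 0 (3 * \<epsilon> / 4)" unfolding K_def by (rule closure_minimal) simp
      then show ?thesis using that by auto
    qed
    have Kn': "norm x < \<epsilon>" if "x \<in> K" for x using Kn[OF that] pos by auto
    have K0: "0 \<in> K" unfolding K_def using in0[OF c(1)] closure_subset by auto
    have "bounded K" unfolding bounded_iff using Kn by blast
    then have cK: "compact K" unfolding compact_eq_bounded_closed by (simp add: K_def)
    define L where "L = {x \<in> cball 0 (7 * \<epsilon> / 8). \<phi> x \<le> c}"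
    have cL: "closed L"
    proof -
      have "continuous_on (cball 0 (7 * \<epsilon> / 8)) \<phi>"
        by (rule continuous_on_subset[OF cphi]) (use pos in auto)
      moreover have "L = cball 0 (7 * \<epsilon> / 8) \<inter> \<phi> -` {..c}" by (auto simp: L_def)
      ultimately show ?thesis using continuous_closed_preimage by (metis closed_cball closed_atMost)
    qed
    \<comment> \<open>\<open>K\<close> is relatively open in the closed sublevel set \<open>L\<close>: no other component of \<open>L\<close> touches it\<close>
    have nbhd: "\<exists>r>0. \<forall>x. dist p x < r \<longrightarrow> x \<in> L \<longrightarrow> x \<in> K" if pK: "p \<in> K" for p
    proof (cases "\<phi> p < c")
      case True
      then have "p \<in> U c" using closure_in[of p c] pK Kn'[OF pK] by (auto simp: Sub_def K_def)
      then obtain r where "r > 0" "ball p r \<subseteq> U c" using opU openE by blast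
      then show ?thesis unfolding K_def using closure_subset[of "U c"] by (auto simp: subset_iff)
    next
      case False
      then have pc: "\<phi> p = c" using clle[of p] pK Kn'[OF pK] unfolding K_def by force
      then obtain h where h: "D p h < 0" using crit[OF Kn'[OF pK]] c(1) zero by force
      have h0: "h \<noteq> 0" using h linear_0[OF has_derivative_linear[OF der[OF Kn'[OF pK]]]] by auto
      have "open {x \<in> ball 0 \<epsilon>. D x h < 0}"
      proof -
        have "{x \<in> ball 0 \<epsilon>. D x h < 0} = ball 0 \<epsilon> \<inter> (\<lambda>x. D x h) -` {..<0}" by auto
        then show ?thesis using continuous_open_preimage[OF cont[of h] open_ball open_lessThan] by simp
      qed
      moreover have "p \<in> {x \<in> ball 0 \<epsilon>. D x h < 0}" using h Kn'[OF pK] by auto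
      ultimately obtain r where r: "r > 0" "ball p r \<subseteq> {x \<in> ball 0 \<epsilon>. D x h < 0}" using openE by blast
      define s where "s = r / (2 * norm h)"
      have s: "s > 0" "s * norm h = r / 2" using r h0 by (auto simp: s_def field_simps)
      have inr: "x + t *\<^sub>R h \<in> ball p r" if "dist p x < r / 2" "0 \<le> t" "t \<le> s" for x t
      proof -
        have "norm (t *\<^sub>R h) \<le> r / 2" using that s mult_right_mono[of t s "norm h"] by auto
        moreover have "dist p (x + t *\<^sub>R h) \<le> dist p x + norm (t *\<^sub>R h)"
          by (metis add_diff_cancel_left' dist_commute dist_norm dist_triangle)
        ultimately show ?thesis using that by auto
      qed
      have dec: "\<phi> (x + t *\<^sub>R h) < \<phi> x" if "dist p x < r / 2" "0 < t" "t \<le> s" for x t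
      proof -
        have "\<phi> (x + t *\<^sub>R h) < \<phi> (x + 0 *\<^sub>R h)"
        proof (rule DERIV_neg_imp_decreasing[OF that(2), of "\<lambda>t. \<phi> (x + t *\<^sub>R h)"])
          fix u assume u: "0 \<le> u" "u \<le> t"
          then have "x + u *\<^sub>R h \<in> ball p r" using inr[of x u] that by auto
          then have "norm (x + u *\<^sub>R h) < \<epsilon>" "D (x + u *\<^sub>R h) h < 0" using r(2) by auto
          then show "\<exists>y. DERIV (\<lambda>t. \<phi> (x + t *\<^sub>R h)) u :> y \<and> y < 0"
            using derivative_along_line[OF der] by blast
        qed
        then show ?thesis by simp
      qed
      have inSub: "x + t *\<^sub>R h \<in> Sub c" if "dist p x < r / 2" "\<phi> x \<le> c" "0 < t" "t \<le> s" for x t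
        using dec[OF that(1,3,4)] inr[OF that(1) less_imp_le[OF that(3)] that(4)] r(2) that(2) by (auto simp: Sub_def)
      have "p + s *\<^sub>R h \<in> Sub c" using inSub[of p s] s pc r by auto
      then obtain r0 where r0: "r0 > 0" "ball (p + s *\<^sub>R h) r0 \<subseteq> Sub c" using opS openE by blast
      define r1 where "r1 = min r0 (r / 2)"
      have r1: "r1 > 0" "r1 \<le> r / 2" "ball (p + s *\<^sub>R h) r1 \<subseteq> Sub c"
        using r0 r by (auto simp: r1_def)
      obtain u where u: "u \<in> U c" "dist u p < r1" using pK r1(1) closure_approachable unfolding K_def by blast
      have seg: "connected ((\<lambda>t. x + t *\<^sub>R h) ` I)" if "is_interval I" for x and I :: "real set"
        by (intro connected_continuous_image is_interval_connected that continuous_intros)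
      have us: "u + s *\<^sub>R h \<in> U c"
      proof -
        have "(\<lambda>t. u + t *\<^sub>R h) ` {0..s} \<subseteq> Sub c"
        proof clarify
          fix t assume "t \<in> {0..s}"
          then show "u + t *\<^sub>R h \<in> Sub c" using inSub[of u t] u US[of c] Ul[OF u(1)] r1
            by (cases "t = 0") (auto simp: dist_commute)
        qed
        then have "(\<lambda>t. u + t *\<^sub>R h) ` {0..s} \<subseteq> U c"
          using max[OF seg[of "{0..s}" u], of c u] u s by (force simp: image_iff is_interval_cc)
        then show ?thesis by (rule subsetD) (use s in auto)
      qed
      have ballU: "ball (p + s *\<^sub>R h) r1 \<subseteq> U c"
        by (rule max[OF connected_ball r1(3) _ us]) (use u in \<open>simp add: dist_norm norm_minus_commute\<close>)
      have "x \<in> K" if x: "dist p x < r1" "x \<in> L" for x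
      proof -
        have "x + s *\<^sub>R h \<in> U c" using ballU x by (auto simp: dist_norm)
        moreover have "(\<lambda>t. x + t *\<^sub>R h) ` {0<..s} \<subseteq> Sub c"
          using inSub[of x] x r1 by (auto simp: L_def)
        moreover have "x + s *\<^sub>R h \<in> (\<lambda>t. x + t *\<^sub>R h) ` {0<..s}" using s by auto
        ultimately have sub: "(\<lambda>t. x + t *\<^sub>R h) ` {0<..s} \<subseteq> U c"
          using max[OF seg[of "{0<..s}" x], of c "x + s *\<^sub>R h"] by (simp add: is_interval_oc)
        have "(\<lambda>n. x + (s / real (Suc n)) *\<^sub>R h) \<longlonglongrightarrow> x + 0 *\<^sub>R h"
        proof (intro tendsto_intros)
          show "(\<lambda>n. s / real (Suc n)) \<longlonglongrightarrow> 0"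
            using tendsto_mult_left[OF LIMSEQ_inverse_real_of_nat, of s] by (simp add: divide_inverse)
        qed
        moreover have "x + (s / real (Suc n)) *\<^sub>R h \<in> U c" for n
        proof -
          have "s / real (Suc n) \<in> {0<..s}" using s by (auto simp: field_simps)
          then show ?thesis using sub by blast
        qed
        ultimately show ?thesis unfolding K_def closure_sequential
          by (intro exI[of _ "\<lambda>n. x + (s / real (Suc n)) *\<^sub>R h"]) simp
      qed
      then show ?thesis using r1 by blast
    qed
    have "closed (L - K)"
      unfolding closed_sequential_limits
    proof (intro allI impI)
      fix s l assume "(\<forall>n. s n \<in> L - K) \<and> s \<longlonglongrightarrow> l"
      then have s: "\<And>n. s n \<in> L" "\<And>n. s n \<notin> K" "s \<longlonglongrightarrow> l" by auto
      have "l \<in> L" using cL s closed_sequential_limits by blast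
      moreover have "l \<notin> K"
      proof
        assume "l \<in> K"
        then obtain r where r: "r > 0" "\<And>x. dist l x < r \<Longrightarrow> x \<in> L \<Longrightarrow> x \<in> K" using nbhd by blast
        obtain n where "dist (s n) l < r" using s(3) r(1) LIMSEQ_iff_nz metric_LIMSEQ_D by blast
        then show False using r(2)[of "s n"] s by (auto simp: dist_commute)
      qed
      ultimately show "l \<in> L - K" by auto
    qed
    then obtain d0 where d0: "d0 > 0" "\<And>x y. x \<in> K \<Longrightarrow> y \<in> L - K \<Longrightarrow> d0 \<le> dist x y"
      using separate_compact_closed[OF cK, of "L - K"] by blast
    define d1 where "d1 = min d0 (\<epsilon> / 8) / 2"
    have d1: "0 < d1" "d1 < d0" "d1 < \<epsilon> / 8" using d0 pos by (auto simp: d1_def)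
    have close: "\<exists>k\<in>K. dist x k = infdist x K" for x
      using infdist_attains_inf[OF compact_imp_closed[OF cK], of x] K0 by (metis empty_iff)
    have close_norm: "norm x < 7 * \<epsilon> / 8 \<and> (\<phi> x \<le> c \<longrightarrow> x \<in> K)" if x: "infdist x K \<le> d1" for x
    proof -
      obtain k where k: "k \<in> K" "dist x k \<le> d1" using close[of x] x by auto
      have "norm x \<le> norm k + dist x k" by (metis dist_norm norm_triangle_sub)
      then have n: "norm x < 7 * \<epsilon> / 8" using Kn[OF k(1)] k(2) d1 by auto
      moreover have "x \<in> K" if "\<phi> x \<le> c"
      proof (rule ccontr)
        assume "x \<notin> K"
        then have "x \<in> L - K" using n that by (auto simp: L_def)
        from d0(2)[OF k(1) this] show False using k(2) d1 by (simp add: dist_commute)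
      qed
      ultimately show ?thesis by blast
    qed
    \<comment> \<open>on the shell \<open>Bd\<close> around \<open>K\<close> the value \<open>c\<close> is exceeded by a positive amount, which is the room for a higher level\<close>
    define Bd where "Bd = {x. infdist x K = d1}"
    have Bdb: "norm x < 7 * \<epsilon> / 8" "\<phi> x > c" if "x \<in> Bd" for x
    proof -
      have "x \<notin> K" using that d1 by (auto simp: Bd_def)
      then show "norm x < 7 * \<epsilon> / 8" "\<phi> x > c" using close_norm[of x] that by (auto simp: Bd_def not_le[symmetric])
    qed
    have cBd: "compact Bd" unfolding compact_eq_bounded_closed
    proof
      show "bounded Bd" using Bdb(1) by (auto simp: bounded_iff intro!: exI[of _ "7 * \<epsilon> / 8"] less_imp_le)
      show "closed Bd" unfolding Bd_def by (intro closed_Collect_eq continuous_intros)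
    qed
    obtain m where m: "m > c" "\<And>x. x \<in> Bd \<Longrightarrow> \<phi> x \<ge> m"
    proof (cases "Bd = {}")
      case True
      then show thesis using that[of "c + 1"] by auto
    next
      case False
      have "continuous_on Bd \<phi>" by (rule continuous_on_subset[OF cphi]) (use Bdb pos in force)
      then obtain x where "x \<in> Bd" "\<And>y. y \<in> Bd \<Longrightarrow> \<phi> x \<le> \<phi> y"
        using continuous_attains_inf[OF cBd False] by blast
      then show thesis using that[of "\<phi> x"] Bdb by auto
    qed
    define c' where "c' = min m \<gamma>"
    have c': "c < c'" "c' \<le> \<gamma>" "c' \<le> m" using m cl by (auto simp: c'_def)
    have "\<phi> x \<ge> 0" if x: "x \<in> U c'" for x
    proof -
      have "infdist x K < d1"
      proof (rule ccontr)
        assume far: "\<not> infdist x K < d1"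
        obtain y where y: "y \<in> U c'" "infdist y K = d1"
          by (rule connected_takes_value[OF conU[of c'], of "\<lambda>x. infdist x K" 0 x d1])
             (use far in0[of c'] x K0 d1 c c' in \<open>auto intro!: continuous_intros\<close>)
        then show False using m(2)[of y] Ul[of y c'] c' by (auto simp: Bd_def)
      qed
      then show ?thesis using close_norm[of x] clpos[of x] Kn'[of x] c unfolding K_def by force
    qed
    then show ?thesis using c' c by (intro bexI[of _ c']) (auto simp: G_def)
  qed
  have "\<gamma> \<in> G"
  proof -
    have "Sup G = \<gamma>"
    proof (rule ccontr)
      assume "Sup G \<noteq> \<gamma>"
      then have "Sup G < \<gamma>" using SupG by (auto simp: G_def)
      then obtain c' where "c' \<in> G" "Sup G < c'" using step[OF SupG] by auto
      then show False using cSup_upper[OF _ bdd, of c'] by auto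
    qed
    then show ?thesis using SupG by simp
  qed
  moreover have "z \<in> U \<gamma>"
  proof -
    have "T \<subseteq> Sub \<gamma>" using T by (auto simp: Sub_def)
    then show ?thesis using max[OF T(1) _ T(2) in0[OF pos(3)]] zT by blast
  qed
  ultimately show ?thesis by (auto simp: G_def)
qed

section \<open>Compact perturbations of the identity\<close>

definition compact_operator :: "('a::real_normed_vector \<Rightarrow> 'b::real_normed_vector) \<Rightarrow> bool" where
  "compact_operator T \<longleftrightarrow> bounded_linear T \<and>
     (\<forall>x. bounded (range x) \<longrightarrow> (\<exists>(r::nat \<Rightarrow> nat) l. strict_mono r \<and> (\<lambda>n. T (x (r n))) \<longlonglongrightarrow> l))"

lemma compact_operatorD:
  assumes "compact_operator T"
  shows "bounded_linear T"
    and "bounded (range x) \<Longrightarrow> (\<And>(r::nat \<Rightarrow> nat) l. strict_mono r \<Longrightarrow> (\<lambda>n. T (x (r n))) \<longlonglongrightarrow> l \<Longrightarrow> thesis) \<Longrightarrow> thesis"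
  using assms unfolding compact_operator_def by blast+

lemma compact_operator_diff:
  assumes S: "compact_operator S" and T: "compact_operator T"
  shows "compact_operator (\<lambda>x. S x - T x)"
  unfolding compact_operator_def
proof (intro conjI allI impI)
  show "bounded_linear (\<lambda>x. S x - T x)"
    using assms by (auto intro: bounded_linear_sub dest: compact_operatorD(1))
next
  fix x :: "nat \<Rightarrow> 'a" assume b: "bounded (range x)"
  obtain r l where r: "strict_mono r" "(\<lambda>n. S (x (r n))) \<longlonglongrightarrow> l" using compact_operatorD(2)[OF S b] by blast
  have "bounded (range (x \<circ> r))" using b by (rule bounded_subset) auto
  then obtain r' l' where r': "strict_mono r'" "(\<lambda>n. T ((x \<circ> r) (r' n))) \<longlonglongrightarrow> l'"
    using compact_operatorD(2)[OF T] by blast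
  have "(\<lambda>n. S (x (r (r' n))) - T (x (r (r' n)))) \<longlonglongrightarrow> l - l'"
    using tendsto_diff[OF LIMSEQ_subseq_LIMSEQ[OF r(2) r'(1)] r'(2)] by (simp add: o_def)
  then show "\<exists>r l. strict_mono r \<and> (\<lambda>n. S (x (r n)) - T (x (r n))) \<longlonglongrightarrow> l"
    using strict_mono_o[OF r(1) r'(1)] by (intro exI[of _ "r \<circ> r'"] exI[of _ "l - l'"]) (auto simp: o_def)
qed

lemma compact_operator_finite_rank:
  fixes L :: "'a::real_normed_vector \<Rightarrow> 'z::euclidean_space" and E :: "'z \<Rightarrow> 'b::real_normed_vector"
  assumes L: "bounded_linear L" and E: "bounded_linear E"
  shows "compact_operator (\<lambda>x. E (L x))"
  unfolding compact_operator_def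
proof (intro conjI allI impI)
  show "bounded_linear (\<lambda>x. E (L x))" using bounded_linear_compose[OF E L] .
next
  fix x :: "nat \<Rightarrow> 'a" assume b: "bounded (range x)"
  have "bounded (range (\<lambda>n. L (x n)))" using bounded_linear_image[OF b L] by (simp add: image_image)
  then obtain l r where "strict_mono r" "((\<lambda>n. L (x n)) \<circ> r) \<longlonglongrightarrow> l"
    using bounded_imp_convergent_subsequence by blast
  then show "\<exists>r l. strict_mono r \<and> (\<lambda>n. E (L (x (r n)))) \<longlonglongrightarrow> l"
    using bounded_linear.tendsto[OF E, of "\<lambda>n. L (x (r n))" l] by (auto simp: o_def)
qed

lemma injective_identity_minus_compact_bounded_below:
  fixes T :: "'a::real_normed_vector \<Rightarrow> 'a"
  assumes T: "compact_operator T" and inj: "\<And>x. x = T x \<Longrightarrow> x = 0"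
  obtains c where "c > 0" "\<And>x. c * norm x \<le> norm (x - T x)"
proof -
  interpret T: bounded_linear T using T by (rule compact_operatorD)
  have "\<exists>c>0. \<forall>x. c * norm x \<le> norm (x - T x)"
  proof (rule ccontr)
    assume neg: "\<not> ?thesis"
    have "\<exists>x. norm x = 1 \<and> norm (x - T x) < inverse (Suc n)" for n :: nat
    proof -
      have "inverse (real (Suc n)) > 0" by simp
      then obtain x where x: "norm (x - T x) < inverse (Suc n) * norm x" using neg by (meson not_le)
      then have nx: "norm x > 0" by (cases "x = 0") (auto simp: T.zero)
      let ?y = "(1 / norm x) *\<^sub>R x"
      have "?y - T ?y = (1 / norm x) *\<^sub>R (x - T x)" by (simp only: T.scaleR scaleR_diff_right)
      then have "norm (?y - T ?y) = norm (x - T x) / norm x" using nx by (simp only: norm_scaleR) simp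
      then have "norm (?y - T ?y) < inverse (Suc n)" using x nx by (simp only: pos_divide_less_eq)
      moreover have "norm ?y = 1" using nx by simp
      ultimately show ?thesis by blast
    qed
    then obtain x where x: "\<And>n::nat. norm (x n) = 1" "\<And>n. norm (x n - T (x n)) < inverse (Suc n)" by metis
    have "bounded (range x)" using x(1) by (auto simp: bounded_iff intro!: exI[of _ 1])
    then obtain r l where r: "strict_mono r" "(\<lambda>n. T (x (r n))) \<longlonglongrightarrow> l" using compact_operatorD(2)[OF T] by blast
    have "(\<lambda>n. x n - T (x n)) \<longlonglongrightarrow> 0"
      by (rule Lim_null_comparison[OF _ LIMSEQ_inverse_real_of_nat])
         (use x(2) in \<open>auto intro!: always_eventually less_imp_le\<close>)
    from tendsto_add[OF LIMSEQ_subseq_LIMSEQ[OF this r(1)] r(2)]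
    have lim: "(\<lambda>n. x (r n)) \<longlonglongrightarrow> l" by (simp add: o_def)
    have "(\<lambda>n. T (x (r n))) \<longlonglongrightarrow> T l" by (rule T.tendsto[OF lim])
    then have "l = T l" using r(2) LIMSEQ_unique by blast
    then have "l = 0" using inj by blast
    moreover have "norm l = 1" using tendsto_norm[OF lim] x(1) LIMSEQ_unique[OF _ tendsto_const[of 1]] by simp
    ultimately show False by simp
  qed
  then show thesis using that by blast
qed

text \<open>
  Riesz's lemma with the constant \<open>1/2\<close>: an almost best approximation of \<open>a\<close> in \<open>W\<close>, subtracted from \<open>a\<close> and
  normalized, is almost orthogonal to \<open>W\<close>.
\<close>

lemma riesz_element:
  fixes V W :: "'a::real_normed_vector set"
  assumes V: "subspace V" and W: "subspace W" "closed W" "W \<subseteq> V" and a: "a \<in> V" "a \<notin> W"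
  obtains y where "y \<in> V" "norm y = 1" "\<And>w. w \<in> W \<Longrightarrow> 1/2 \<le> norm (y - w)"
proof -
  have W0: "W \<noteq> {}" "0 \<in> W" using W subspace_0 by auto
  have d: "infdist a W > 0" using in_closed_iff_infdist_zero[OF W(2) W0(1), of a] a infdist_nonneg[of a W] by force
  have "\<exists>w0\<in>W. dist a w0 < 2 * infdist a W"
  proof (rule ccontr)
    assume "\<not> ?thesis"
    then have "2 * infdist a W \<le> infdist a W" unfolding infdist_notempty[OF W0(1)]
      by (intro cINF_greatest[OF W0(1)]) (auto simp: not_less infdist_notempty[OF W0(1)])
    then show False using d by simp
  qed
  then obtain w0 where w0: "w0 \<in> W" "dist a w0 < 2 * infdist a W" by blast
  define n where "n = norm (a - w0)"
  have n: "n > 0" "n < 2 * infdist a W" using w0 a by (auto simp: n_def dist_norm)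
  define y where "y = (1 / n) *\<^sub>R (a - w0)"
  show thesis
  proof
    show "y \<in> V" unfolding y_def using V a W w0 by (auto intro!: subspace_scale subspace_diff)
    show "norm y = 1" using n by (simp add: y_def n_def)
    fix w assume w: "w \<in> W"
    have "infdist a W \<le> dist a (w0 + n *\<^sub>R w)"
      using w w0 W by (intro infdist_le subspace_add subspace_scale)
    also have "\<dots> = norm (n *\<^sub>R (y - w))" using n by (simp add: dist_norm y_def algebra_simps)
    also have "\<dots> = n * norm (y - w)" using n by simp
    finally have "n / 2 < n * norm (y - w)" using n by linarith
    then show "1/2 \<le> norm (y - w)" using n by (simp add: field_simps)
  qed
qed

text \<open>
  The Fredholm alternative. If \<open>F = I - T\<close> were injective but not onto, the subspaces \<open>V n = range (F ^^ n)\<close> would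
  decrease strictly, and they are closed because \<open>F\<close> is bounded below. Riesz's lemma then yields unit
  vectors \<open>y n\<close> in \<open>V n\<close> far from \<open>V (n + 1)\<close>; their images under \<open>T\<close> keep mutual distance \<open>1/2\<close>, against
  compactness.
\<close>

theorem injective_identity_minus_compact_surj:
  fixes T :: "'a::banach \<Rightarrow> 'a"
  assumes T: "compact_operator T" and inj: "\<And>x. x = T x \<Longrightarrow> x = 0"
  obtains R where "bounded_linear R" "\<And>x. R (x - T x) = x" "\<And>y. R y - T (R y) = y"
proof -
  interpret T: bounded_linear T using T by (rule compact_operatorD)
  define F where "F x = x - T x" for x
  interpret F: bounded_linear F unfolding F_def by (intro bounded_linear_sub bounded_linear_ident T.bounded_linear_axioms)
  obtain c where c: "c > 0" "\<And>x. c * norm x \<le> norm (F x)"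
    using injective_identity_minus_compact_bounded_below[OF T inj] unfolding F_def by blast
  have injF: "x = y" if "F x = F y" for x y
    using c(2)[of "x - y"] c(1) that by (simp add: F.diff mult_le_0_iff)
  have closed_image: "closed (F ` S)" if "closed S" "subspace S" for S
  proof -
    have "complete (F ` S)"
      by (rule complete_isometric_image[OF c(1) that(2) F.bounded_linear_axioms _ _]) 
         (use c that complete_eq_closed in \<open>auto simp: mult.commute\<close>)
    then show ?thesis by (rule complete_imp_closed)
  qed
  define V where "V n = (F ^^ n) ` UNIV" for n
  have VS: "V (Suc n) = F ` V n" for n by (simp add: V_def image_comp)
  have V0: "V 0 = UNIV" by (simp add: V_def)
  have subV: "subspace (V n)" for n
    by (induction n) (use linear_subspace_image[OF F.linear_axioms] in \<open>simp_all add: V0 VS\<close>)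
  have clV: "closed (V n)" for n by (induction n) (use subV in \<open>simp_all add: V0 VS closed_image\<close>)
  have decS: "V (Suc n) \<subseteq> V n" for n
  proof (induction n)
    case (Suc n)
    then have "F ` V (Suc n) \<subseteq> F ` V n" by (rule image_mono)
    then show ?case by (simp only: VS)
  qed (simp add: V0)
  have dec: "V m \<subseteq> V n" if "n \<le> m" for m n using lift_Suc_antimono_le[of V, OF decS that] by simp
  have "surj F"
  proof (rule ccontr)
    assume "\<not> surj F"
    then obtain x0 where x0: "x0 \<notin> range F" by auto
    have powinj: "x = y" if "(F ^^ n) x = (F ^^ n) y" for n x y using that by (induction n) (auto dest: injF)
    have "(F ^^ n) x0 \<notin> V (Suc n)" for n
    proof
      assume "(F ^^ n) x0 \<in> V (Suc n)"
      then obtain y where "(F ^^ n) x0 = (F ^^ n) (F y)" unfolding V_def by (auto simp: funpow_swap1)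
      then show False using powinj x0 by blast
    qed
    moreover have "(F ^^ n) x0 \<in> V n" for n by (simp add: V_def)
    ultimately have "\<exists>y. y \<in> V n \<and> norm y = 1 \<and> (\<forall>w\<in>V (Suc n). 1/2 \<le> norm (y - w))" for n
      using riesz_element[OF subV subV clV decS, of "(F ^^ n) x0" n] by metis
    then obtain y where y: "\<And>n. y n \<in> V n" "\<And>n. norm (y n) = 1" "\<And>n w. w \<in> V (Suc n) \<Longrightarrow> 1/2 \<le> norm (y n - w)"
      by metis
    have far: "1/2 \<le> norm (T (y n) - T (y m))" if "n < m" for n m
    proof -
      have ym: "y m \<in> V (Suc n)" using y(1)[of m] dec[of "Suc n" m] that by auto
      then have "F (y m) \<in> V (Suc n)" using decS[of "Suc n"] by (auto simp: VS[of "Suc n"])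
      moreover have "F (y n) \<in> V (Suc n)" using y(1) by (auto simp: VS)
      ultimately have "F (y n) + (y m - F (y m)) \<in> V (Suc n)"
        using subV ym by (intro subspace_add subspace_diff)
      from y(3)[OF this] show ?thesis by (simp add: F_def algebra_simps)
    qed
    have "bounded (range y)" using y(2) by (auto simp: bounded_iff intro!: exI[of _ 1])
    then obtain r l where r: "strict_mono r" "(\<lambda>n. T (y (r n))) \<longlonglongrightarrow> l" using compact_operatorD(2)[OF T] by blast
    from r(2) have "Cauchy (\<lambda>n. T (y (r n)))" by (rule LIMSEQ_imp_Cauchy)
    then obtain N where "\<And>m n. m \<ge> N \<Longrightarrow> n \<ge> N \<Longrightarrow> norm (T (y (r m)) - T (y (r n))) < 1/2"
      by (metis CauchyD half_gt_zero zero_less_one)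
    from this[of N "Suc N"] far[of "r N" "r (Suc N)"] r(1) show False by (auto simp: strict_mono_def)
  qed
  define R where "R = inv F"
  have RF: "R (F x) = x" for x unfolding R_def using injF by (intro inv_f_f injI)
  have FR: "F (R y) = y" for y unfolding R_def using \<open>surj F\<close> by (rule surj_f_inv_f)
  have "bounded_linear R"
  proof (rule bounded_linear_intro[where K = "1 / c"])
    show "R (x + y) = R x + R y" for x y by (rule injF) (simp add: F.add FR)
    show "R (a *\<^sub>R x) = a *\<^sub>R R x" for a x by (rule injF) (simp add: F.scaleR FR)
    show "norm (R x) \<le> norm x * (1 / c)" for x using c(2)[of "R x"] c(1) by (simp add: FR field_simps)
  qed
  then show thesis using that RF FR unfolding F_def by blast
qed

section \<open>The kernel of a symmetric compact perturbation of the identity\<close>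

text \<open>
  The space is complete for its norm, which need not come from the inner product \<open>ip\<close>: in the application
  the norm is the supremum norm and \<open>ip\<close> the integral over a period. The functional \<open>ev\<close> identifies the
  kernel of \<open>I - A\<close> with a subspace of a Euclidean space, which makes the kernel finite dimensional
  without fixing its dimension in a type.
\<close>

locale symmetric_compact =
  fixes ip :: "'a::banach \<Rightarrow> 'a \<Rightarrow> real" and A :: "'a \<Rightarrow> 'a" and ev :: "'a \<Rightarrow> 'z::euclidean_space"
  assumes ip: "bounded_bilinear ip"
    and ip_sym: "ip u v = ip v u"
    and ip_pos: "u \<noteq> 0 \<Longrightarrow> ip u u > 0"
    and A_compact: "compact_operator A"
    and A_sym: "ip (A u) v = ip u (A v)"
    and ev: "bounded_linear ev"
    and ev_inj: "A u = u \<Longrightarrow> ev u = 0 \<Longrightarrow> u = 0"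
begin

sublocale ip: bounded_bilinear ip by (rule ip)
sublocale A: bounded_linear A by (rule compact_operatorD(1)[OF A_compact])
sublocale ev: bounded_linear ev by (rule ev)

definition "Ker = {u. A u = u}"

lemma subspace_Ker: "subspace Ker"
  unfolding Ker_def by (auto intro!: subspaceI simp: A.zero A.add A.scaleR)

lemma ip_eq_0_iff: "ip u u = 0 \<longleftrightarrow> u = 0"
  using ip_pos[of u] ip.zero_left[of 0] by (cases "u = 0") auto

text \<open>
  A linear left inverse of \<open>ev\<close> on the kernel. It is defined on the whole Euclidean space, so that
  functions on the kernel become functions of a Euclidean variable.
\<close>

definition E :: "'z \<Rightarrow> 'a" where
  "E = (SOME g. range g \<subseteq> Ker \<and> linear g \<and> (\<forall>v\<in>Ker. g (ev v) = v))"

lemma E_props: "range E \<subseteq> Ker \<and> linear E \<and> (\<forall>v\<in>Ker. E (ev v) = v)"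
proof -
  have "inj_on ev Ker"
  proof (rule inj_onI)
    fix u v assume "u \<in> Ker" "v \<in> Ker" "ev u = ev v"
    then have "u - v \<in> Ker" "ev (u - v) = 0" using subspace_diff[OF subspace_Ker] by (auto simp: ev.diff)
    then show "u = v" using ev_inj[of "u - v"] by (auto simp: Ker_def)
  qed
  then have "\<exists>g. range g \<subseteq> Ker \<and> linear g \<and> (\<forall>v\<in>Ker. g (ev v) = v)"
    using real_vector.linear_exists_left_inverse_on[OF ev.linear subspace_Ker] by blast
  then show ?thesis unfolding E_def by (rule someI_ex)
qed

lemma E_Ker [simp]: "E z \<in> Ker" and E_ev: "w \<in> Ker \<Longrightarrow> E (ev w) = w" and linear_E: "linear E"
  using E_props by auto

sublocale E: bounded_linear E using linear_E by (simp add: linear_conv_bounded_linear)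

lemma A_E [simp]: "A (E z) = E z" using E_Ker[of z] unfolding Ker_def by simp

text \<open>
  The projection onto the null space of \<open>E\<close>; it measures the directions of the Euclidean space that do
  not correspond to kernel elements.
\<close>

definition q :: "'z \<Rightarrow> 'z" where "q z = z - ev (E z)"

lemma bounded_linear_q: "bounded_linear q"
  unfolding q_def by (intro bounded_linear_sub bounded_linear_ident bounded_linear_compose[OF ev E.bounded_linear_axioms])

sublocale q: bounded_linear q by (rule bounded_linear_q)

lemma E_q [simp]: "E (q z) = 0" by (simp add: q_def E.diff E_ev)
lemma q_q [simp]: "q (q z) = q z" unfolding q_def[of "q z"] by (simp add: ev.zero)
lemma q_ev [simp]: "w \<in> Ker \<Longrightarrow> q (ev w) = 0" by (simp add: q_def E_ev)
lemma E_q_zero: "E z = 0 \<Longrightarrow> q z = 0 \<Longrightarrow> z = 0" by (simp add: q_def ev.zero)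

text \<open>
  The Gram operator of \<open>E\<close> may be singular on the null space of \<open>E\<close>. Adding the square of \<open>q\<close> makes it
  positive definite, and testing the resulting equation with \<open>q\<close> shows that the added term vanishes at
  the solution.
\<close>

lemma orthogonal_projection_exists:
  obtains L where "bounded_linear L" "\<And>u k. k \<in> Ker \<Longrightarrow> ip (E (L u)) k = ip u k"
proof -
  define Es where "Es u = (\<Sum>b\<in>Basis. ip u (E b) *\<^sub>R b)" for u
  have Es_bl: "bounded_linear Es" unfolding Es_def
    by (intro bounded_linear_sum bounded_linear_scaleR_const ip.bounded_linear_left)
  have Es: "Es u \<bullet> z = ip u (E z)" for u z
  proof -
    have "ip u (E z) = ip u (E (\<Sum>b\<in>Basis. (z \<bullet> b) *\<^sub>R b))" by (simp add: euclidean_representation)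
    also have "\<dots> = (\<Sum>b\<in>Basis. (z \<bullet> b) * ip u (E b))"
      by (simp add: E.sum E.scaleR ip.sum_right ip.scaleR_right)
    also have "\<dots> = Es u \<bullet> z" by (simp add: Es_def inner_sum_left inner_sum_right mult.commute inner_commute)
    finally show ?thesis by simp
  qed
  define G where "G z = Es (E z) + adjoint q (q z)" for z
  have G: "G z \<bullet> h = ip (E z) (E h) + q z \<bullet> q h" for z h
  proof -
    have "adjoint q (q z) \<bullet> h = q z \<bullet> q h"
      using adjoint_works[OF q.linear, of h "q z"] by (simp only: inner_commute)
    then show ?thesis by (simp only: G_def inner_add_left Es)
  qed
  have "linear G"
    unfolding G_def
    by (intro linear_compose_add linear_compose[OF E.linear bounded_linear.linear[OF Es_bl], unfolded o_def]
        linear_compose[OF q.linear adjoint_linear[OF q.linear], unfolded o_def])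
  moreover have "inj G" unfolding linear_injective_0[OF \<open>linear G\<close>]
  proof (intro allI impI)
    fix z assume "G z = 0"
    then have "ip (E z) (E z) + q z \<bullet> q z = 0" using G[of z z] by simp
    moreover have "ip (E z) (E z) \<ge> 0" using ip_pos[of "E z"] ip_eq_0_iff[of "E z"] by (cases "E z = 0") auto
    moreover have "q z \<bullet> q z \<ge> 0" by simp
    ultimately have "ip (E z) (E z) = 0" "q z \<bullet> q z = 0" by linarith+
    then show "z = 0" using E_q_zero by (simp add: ip_eq_0_iff)
  qed
  ultimately have lG: "linear G" and "surj G" using linear_injective_imp_surjective by blast+
  then obtain g where g: "linear g" "G \<circ> g = id" using real_vector.linear_surjective_right_inverse by blast
  have Gg: "G (g z) = z" for z using fun_cong[OF g(2), of z] by simp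
  define L where "L u = g (Es u)" for u
  have "bounded_linear L" unfolding L_def
    using bounded_linear_compose[OF _ Es_bl] g(1) linear_conv_bounded_linear by blast
  moreover have "ip (E (L u)) k = ip u k" if k: "k \<in> Ker" for u k
  proof -
    have *: "ip (E (L u)) (E h) + q (L u) \<bullet> q h = ip u (E h)" for h
      using G[of "L u" h] Es[of u h] by (simp add: L_def Gg)
    from *[of "q (L u)"] have "q (L u) = 0" by (simp add: ip.zero_right)
    with *[of "ev k"] show ?thesis using k by (simp add: E_ev)
  qed
  ultimately show thesis using that by blast
qed

definition P :: "'a \<Rightarrow> 'a" where "P u = (THE w. w \<in> Ker \<and> (\<forall>k\<in>Ker. ip w k = ip u k))"

lemma P_unique: assumes "w \<in> Ker" "\<And>k. k \<in> Ker \<Longrightarrow> ip w k = ip u k" shows "P u = w"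
  unfolding P_def
proof (rule the_equality)
  show "w \<in> Ker \<and> (\<forall>k\<in>Ker. ip w k = ip u k)" using assms by blast
  fix w' assume w': "w' \<in> Ker \<and> (\<forall>k\<in>Ker. ip w' k = ip u k)"
  then have "w' - w \<in> Ker" using assms subspace_diff[OF subspace_Ker] by blast
  then have "ip (w' - w) (w' - w) = 0" using w' assms(2) by (simp add: ip.diff_left)
  then show "w' = w" by (simp add: ip_eq_0_iff)
qed

lemma P_factor: obtains L :: "'a \<Rightarrow> 'z" where "bounded_linear L" "P = (\<lambda>u. E (L u))"
proof -
  obtain L where L: "bounded_linear L" "\<And>u k. k \<in> Ker \<Longrightarrow> ip (E (L u)) k = ip u k"
    using orthogonal_projection_exists by blast
  have "P u = E (L u)" for u by (rule P_unique) (use L in auto)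
  then show thesis using that[OF L(1)] by blast
qed

lemma ip_P: "k \<in> Ker \<Longrightarrow> ip (P u) k = ip u k"
proof -
  assume k: "k \<in> Ker"
  obtain L where L: "bounded_linear L" "\<And>u k. k \<in> Ker \<Longrightarrow> ip (E (L u)) k = ip u k"
    using orthogonal_projection_exists by blast
  have "P u = E (L u)" by (rule P_unique) (use L in auto)
  then show ?thesis using L k by simp
qed

lemma P_Ker [simp]: "P u \<in> Ker" and compact_P: "compact_operator P"
proof -
  obtain L where L: "bounded_linear L" "P = (\<lambda>u. E (L u))" using P_factor by blast
  show "P u \<in> Ker" using L by simp
  show "compact_operator P" unfolding L(2) by (rule compact_operator_finite_rank[OF L(1) E.bounded_linear_axioms])
qed

sublocale P: bounded_linear P by (rule compact_operatorD(1)[OF compact_P])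

lemma P_id [simp]: "w \<in> Ker \<Longrightarrow> P w = w" by (rule P_unique) auto

lemma P_A [simp]: "P (A u) = P u"
proof (rule P_unique)
  fix k assume k: "k \<in> Ker"
  then have "A k = k" by (simp add: Ker_def)
  then have "ip (A u) k = ip u k" using A_sym[of u k] by simp
  then show "ip (P u) k = ip (A u) k" using ip_P[OF k, of u] by simp
qed simp

lemma P_sym: "ip (P u) v = ip u (P v)"
proof -
  have "ip (P u) v = ip v (P u)" by (rule ip_sym)
  also have "\<dots> = ip (P v) (P u)" by (rule ip_P[symmetric]) simp
  also have "\<dots> = ip (P u) (P v)" by (rule ip_sym)
  also have "\<dots> = ip u (P v)" by (rule ip_P) simp
  finally show ?thesis .
qed

text \<open>
  Symmetry of \<open>A\<close> gives \<open>P A = P\<close>, hence \<open>I - A + P\<close> is injective: \<open>P\<close> applied to a null vector shows that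
  its kernel part vanishes. Since \<open>A - P\<close> is compact, the Fredholm alternative provides the inverse.
\<close>

lemma bordered_inverse_exists:
  obtains R where "bounded_linear R" "\<And>x. R (x - A x + P x) = x" "\<And>y. R y - A (R y) + P (R y) = y"
proof -
  have "compact_operator (\<lambda>x. A x - P x)" by (rule compact_operator_diff[OF A_compact compact_P])
  moreover have inj: "x = 0" if "x = A x - P x" for x
  proof -
    have "P x = P (A x - P x)" using that by simp
    then have Px: "P x = 0" by (simp add: P.diff)
    then have x: "x \<in> Ker" using that by (simp add: Ker_def)
    then show ?thesis using Px by simp
  qed
  ultimately obtain R where R: "bounded_linear R" "\<And>x. R (x - (A x - P x)) = x" "\<And>y. R y - (A (R y) - P (R y)) = y"
    by (rule injective_identity_minus_compact_surj) auto
  have eq: "x - A x + P x = x - (A x - P x)" for x by simp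
  show thesis by (rule that[OF R(1)]) (simp_all only: eq R(2,3))
qed

definition R :: "'a \<Rightarrow> 'a" where
  "R = (SOME R. bounded_linear R \<and> (\<forall>x. R (x - A x + P x) = x) \<and> (\<forall>y. R y - A (R y) + P (R y) = y))"

lemma R_props: "bounded_linear R \<and> (\<forall>x. R (x - A x + P x) = x) \<and> (\<forall>y. R y - A (R y) + P (R y) = y)"
proof -
  have "\<exists>R. bounded_linear R \<and> (\<forall>x. R (x - A x + P x) = x) \<and> (\<forall>y. R y - A (R y) + P (R y) = y)"
    by (rule bordered_inverse_exists) blast
  then show ?thesis unfolding R_def by (rule someI_ex)
qed

sublocale R: bounded_linear R using R_props by blast

lemma R_left: "R (x - A x + P x) = x" and R_right: "R y - A (R y) + P (R y) = y" using R_props by auto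
lemma R_Ker: "w \<in> Ker \<Longrightarrow> R w = w" using R_left[of w] by (simp add: Ker_def)

text \<open>
  Prescribing the kernel part \<open>w\<close> of \<open>u\<close> makes the equation \<open>u - A u = v\<close> uniquely solvable up to a kernel
  component on the right hand side, which is \<open>- P v\<close>.
\<close>

lemma bordered_equation:
  assumes w: "w \<in> Ker" and u: "u = w + R (v - P v)"
  shows "P u = w" "u - A u - v = - P v"
proof -
  have "u = R (w + v - P v)" using u R_Ker[OF w] by (simp add: R.add R.diff algebra_simps)
  then have *: "u - A u + P u = w + v - P v" using R_right by metis
  then have "P (u - A u + P u) = P (w + v - P v)" by simp
  then show Pu: "P u = w" using w by (simp add: P.add P.diff)
  show "u - A u - v = - P v" using * Pu by (simp add: algebra_simps)
qed

lemma bordered_equation_converse: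
  assumes "u - A u = v" shows "P v = 0" "u = P u + R (v - P v)"
proof -
  show Pv: "P v = 0" using assms by (auto simp: P.diff)
  have "u = R (v + P u)" using R_left[of u] assms by simp
  then show "u = P u + R (v - P v)" using Pv by (simp add: R.add R_Ker add.commute)
qed

end

section \<open>Lyapunov-Schmidt reduction at a definite crossing\<close>

text \<open>
  Here \<open>D1\<close> is the derivative of the linear part with respect to the parameter, and \<open>C\<close> is the symmetric
  operator relating the equation to its potential: the derivative of the potential at \<open>u\<close> in direction \<open>h\<close>
  is \<open>ip (N u) (C h)\<close>, where \<open>N u = 0\<close> is the equation. So \<open>ip (D1 w) (C w)\<close> is, up to sign, the
  derivative of the second variation with respect to the parameter, the crossing form.
\<close>

locale crossing = symmetric_compact ip A ev
  for ip :: "'a::banach \<Rightarrow> 'a \<Rightarrow> real" and A :: "'a \<Rightarrow> 'a" and ev :: "'a \<Rightarrow> 'z::euclidean_space" +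
  fixes C D1 :: "'a \<Rightarrow> 'a" and \<sigma> :: real
  assumes C: "bounded_linear C"
    and C_sym: "ip (C u) v = ip u (C v)"
    and C_comm: "C (A u) = A (C u)"
    and C_inj: "A u = u \<Longrightarrow> C u = 0 \<Longrightarrow> u = 0"
    and D1: "bounded_linear D1"
    and definite: "A w = w \<Longrightarrow> w \<noteq> 0 \<Longrightarrow> \<sigma> * ip (D1 w) (C w) > 0"
begin

sublocale C: bounded_linear C by (rule C)
sublocale D1: bounded_linear D1 by (rule D1)

lemma C_Ker [simp]: "w \<in> Ker \<Longrightarrow> C w \<in> Ker"
  unfolding Ker_def using C_comm[of w] by simp

text \<open>
  Positivity becomes a uniform bound by compactness of the Euclidean unit sphere; the square of \<open>q\<close>
  extends the crossing form positively to the directions outside the kernel.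
\<close>

lemma crossing_bound:
  obtains c where "c > 0" "\<And>w. w \<in> Ker \<Longrightarrow> c * (norm w)\<^sup>2 \<le> \<sigma> * ip (D1 w) (C w)"
proof -
  define g where "g z = \<sigma> * ip (D1 (E z)) (C (E z)) + q z \<bullet> q z" for z
  have cont: "continuous_on (sphere 0 1) g"
    unfolding g_def
    by (intro continuous_intros ip.continuous_on D1.continuous_on C.continuous_on E.continuous_on q.continuous_on)
  have pos: "g z > 0" if "z \<noteq> 0" for z
  proof (cases "E z = 0")
    case True
    then have "q z \<noteq> 0" using that E_q_zero by blast
    then show ?thesis using True by (simp add: g_def D1.zero ip.zero_left)
  next
    case False
    then have "\<sigma> * ip (D1 (E z)) (C (E z)) > 0" using definite[of "E z"] by simp
    then show ?thesis by (simp add: g_def add_pos_nonneg)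
  qed
  have "sphere (0::'z) 1 \<noteq> {}" by (simp add: sphere_eq_empty)
  then obtain z0 where z0: "z0 \<in> sphere 0 1" "\<And>z. z \<in> sphere 0 1 \<Longrightarrow> g z0 \<le> g z"
    using continuous_attains_inf[OF compact_sphere _ cont] by blast
  have "z0 \<noteq> 0" using z0(1) by auto
  then have m: "g z0 > 0" by (rule pos)
  have g2: "g z0 * (norm z)\<^sup>2 \<le> g z" for z
  proof (cases "z = 0")
    case True
    then show ?thesis by (simp add: g_def E.zero D1.zero ip.zero_left q.zero)
  next
    case False
    let ?y = "(1 / norm z) *\<^sub>R z"
    have "g ?y = g z / (norm z)\<^sup>2"
      by (simp add: g_def E.scaleR q.scaleR D1.scaleR C.scaleR ip.scaleR_left ip.scaleR_right
          power2_eq_square add_divide_distrib del: inner_commute)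
    then have "g ?y * (norm z)\<^sup>2 = g z" using False by simp
    moreover have "g z0 \<le> g ?y" using z0(2)[of ?y] False by simp
    ultimately show ?thesis using mult_right_mono[of "g z0" "g ?y" "(norm z)\<^sup>2"] by simp
  qed
  obtain m' where m': "m' > 0" "\<And>z. norm (E z) \<le> norm z * m'" using E.pos_bounded by blast
  show thesis
  proof (rule that[of "g z0 / m'\<^sup>2"])
    show "g z0 / m'\<^sup>2 > 0" using m m' by simp
    fix w assume w: "w \<in> Ker"
    have "norm w \<le> norm (ev w) * m'" using m'(2)[of "ev w"] w by (simp add: E_ev)
    then have "(norm w)\<^sup>2 \<le> (norm (ev w) * m')\<^sup>2" by (rule power_mono) simp
    then have "g z0 / m'\<^sup>2 * (norm w)\<^sup>2 \<le> g z0 / m'\<^sup>2 * (norm (ev w) * m')\<^sup>2"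
      using m by (intro mult_left_mono) auto
    also have "\<dots> = g z0 * (norm (ev w))\<^sup>2" using m' by (simp add: power_mult_distrib)
    also have "\<dots> \<le> g (ev w)" by (rule g2)
    also have "\<dots> = \<sigma> * ip (D1 w) (C w)" using w by (simp add: g_def E_ev)
    finally show "g z0 / m'\<^sup>2 * (norm w)\<^sup>2 \<le> \<sigma> * ip (D1 w) (C w)" .
  qed
qed

lemma correction_bound:
  obtains \<kappa> where "\<kappa> > 0" "\<And>v. norm (R (v - P v)) \<le> \<kappa> * norm v"
proof -
  have "bounded_linear (\<lambda>v. R (v - P v))"
    by (intro bounded_linear_compose[OF R.bounded_linear_axioms] bounded_linear_sub bounded_linear_ident P.bounded_linear_axioms)
  then obtain k where "k > 0" "\<And>v. norm (R (v - P v)) \<le> norm v * k" using bounded_linear.pos_bounded by blast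
  then show thesis using that[of k] by (simp add: mult.commute)
qed

end

text \<open>
  The equation is \<open>u = A u + r lam u\<close>, where \<open>r lam\<close> has a small Lipschitz constant near the origin and the
  linear part \<open>(lam - \<mu>) D1\<close>. The neighbourhood in the second condition may depend on \<open>lam\<close>.
\<close>

locale perturbation = crossing ip A ev C D1 \<sigma>
  for ip :: "'a::banach \<Rightarrow> 'a \<Rightarrow> real" and A :: "'a \<Rightarrow> 'a" and ev :: "'a \<Rightarrow> 'z::euclidean_space"
    and C D1 :: "'a \<Rightarrow> 'a" and \<sigma> :: real +
  fixes r :: "real \<Rightarrow> 'a \<Rightarrow> 'a" and \<mu> :: real
  assumes r_lipschitz: "\<epsilon> > 0 \<Longrightarrow> \<exists>\<delta>>0. \<forall>lam u v. \<bar>lam - \<mu>\<bar> < \<delta> \<longrightarrow> norm u < \<delta> \<longrightarrow> norm v < \<delta> \<longrightarrow>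
        norm (r lam u - r lam v) \<le> \<epsilon> * norm (u - v)"
    and r_linear_part: "\<epsilon> > 0 \<Longrightarrow> \<exists>\<delta>>0. \<forall>u. norm u < \<delta> \<longrightarrow>
        norm (r lam u - (lam - \<mu>) *\<^sub>R D1 u) \<le> \<epsilon> * norm u"
begin

definition N :: "real \<Rightarrow> 'a \<Rightarrow> 'a" where "N lam u = u - A u - r lam u"

lemma r_zero [simp]: "r lam 0 = 0"
proof -
  obtain \<delta> where "\<delta> > 0" "\<forall>u. norm u < \<delta> \<longrightarrow> norm (r lam u - (lam - \<mu>) *\<^sub>R D1 u) \<le> 1 * norm u"
    using r_linear_part[of 1 lam] by auto
  then show ?thesis by (auto simp: D1.zero dest: spec[of _ 0])
qed

lemma N_zero [simp]: "N lam 0 = 0" by (simp add: N_def A.zero)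

text \<open>
  The part of the equation complementary to the kernel, as a fixed point equation for \<open>u\<close> with given
  kernel part \<open>w\<close>.
\<close>

definition reduced :: "real \<Rightarrow> 'a \<Rightarrow> 'a \<Rightarrow> bool" where
  "reduced lam w u \<longleftrightarrow> w \<in> Ker \<and> u = w + R (r lam u - P (r lam u))"

lemma reduced_P: "reduced lam w u \<Longrightarrow> P u = w" and reduced_N: "reduced lam w u \<Longrightarrow> N lam u = - P (r lam u)"
  using bordered_equation[of w u "r lam u"] by (auto simp: reduced_def N_def)

lemma solution_reduced:
  assumes "N lam u = 0" shows "reduced lam (P u) u" "P (r lam u) = 0"
  using bordered_equation_converse[of u "r lam u"] assms by (auto simp: reduced_def N_def)

text \<open>
  To leading order \<open>u\<close> is \<open>w\<close> and \<open>r lam u\<close> is \<open>(lam - \<mu>) D1 w\<close>, so that the expression is \<open>(lam - \<mu>)\<^sup>2\<close> times the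
  crossing form. The error \<open>u - w\<close> costs a factor \<open>\<bar>lam - \<mu>\<bar>\<close>, and the nonlinear part of \<open>r\<close> is made small
  relative to \<open>\<bar>lam - \<mu>\<bar>\<close> by restricting to a ball that depends on \<open>lam\<close>.
\<close>

lemma reduced_sign:
  obtains \<delta> where "\<delta> > 0" "\<And>lam. lam \<noteq> \<mu> \<Longrightarrow> \<bar>lam - \<mu>\<bar> < \<delta> \<Longrightarrow>
    \<exists>d>0. \<forall>u w. norm u < d \<longrightarrow> reduced lam w u \<longrightarrow> w \<noteq> 0 \<longrightarrow> (lam - \<mu>) * (\<sigma> * ip (r lam u) (C w)) > 0"
proof -
  obtain c where c: "c > 0" "\<And>w. w \<in> Ker \<Longrightarrow> c * (norm w)\<^sup>2 \<le> \<sigma> * ip (D1 w) (C w)"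
    using crossing_bound by blast
  obtain \<kappa> where \<kappa>: "\<kappa> > 0" "\<And>v. norm (R (v - P v)) \<le> \<kappa> * norm v" using correction_bound by blast
  obtain m where m: "m > 0" "\<And>u. norm (D1 u) \<le> norm u * m" using D1.pos_bounded by blast
  obtain b0 where b0: "b0 > 0" "\<And>u v. norm (ip u v) \<le> norm u * norm v * b0" using ip.pos_bounded by blast
  obtain m2 where m2: "m2 > 0" "\<And>u. norm (C u) \<le> norm u * m2" using C.pos_bounded by blast
  define b where "b = b0 * m2 * (\<bar>\<sigma>\<bar> + 1)"
  have b: "b > 0" using b0 m2 by (simp add: b_def)
  have ipb: "\<bar>\<sigma> * ip u (C v)\<bar> \<le> b * norm u * norm v" for u v
  proof -
    have "\<bar>ip u (C v)\<bar> \<le> norm u * norm (C v) * b0" using b0(2)[of u "C v"] by simp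
    also have "\<dots> \<le> norm u * (norm v * m2) * b0" using m2 b0 by (intro mult_right_mono mult_left_mono) auto
    finally have "\<bar>\<sigma>\<bar> * \<bar>ip u (C v)\<bar> \<le> (\<bar>\<sigma>\<bar> + 1) * (norm u * (norm v * m2) * b0)"
      by (intro mult_mono) auto
    then show ?thesis by (simp add: b_def abs_mult mult_ac)
  qed
  define e where "e = c / (8 * b)"
  have e: "e > 0" "2 * b * e = c / 4" using c b by (auto simp: e_def)
  \<comment> \<open>the first bound keeps \<open>u\<close> below \<open>2 w\<close> in norm, the second makes the contribution of \<open>u - w\<close> at most a quarter of the crossing form\<close>
  define \<delta> where "\<delta> = min (1 / (2 * \<kappa> * (m + e))) (c / (8 * b * m * \<kappa> * (m + e)))"
  have \<delta>: "\<delta> > 0" using c \<kappa> m b e by (simp add: \<delta>_def)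
  show thesis
  proof (rule that[OF \<delta>])
    fix lam assume lam: "lam \<noteq> \<mu>" "\<bar>lam - \<mu>\<bar> < \<delta>"
    define t where "t = \<bar>lam - \<mu>\<bar>"
    have t: "t > 0" "t < \<delta>" using lam by (auto simp: t_def)
    have p: "2 * \<kappa> * (m + e) > 0" "8 * b * m * \<kappa> * (m + e) > 0" using \<kappa>(1) m(1) e(1) b by simp_all
    have "t < 1 / (2 * \<kappa> * (m + e))" "t < c / (8 * b * m * \<kappa> * (m + e))" using t(2) by (simp_all add: \<delta>_def)
    then have lt: "t * (2 * \<kappa> * (m + e)) < 1" "t * (8 * b * m * \<kappa> * (m + e)) < c"
      using pos_less_divide_eq[OF p(1)] pos_less_divide_eq[OF p(2)] by blast+
    have t1: "\<kappa> * t * (m + e) \<le> 1/2" using lt(1) by (simp add: mult_ac)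
    have t2: "b * m * (2 * (\<kappa> * t * (m + e))) \<le> c / 4" using lt(2) by (simp add: mult_ac)
    obtain d where d: "d > 0" "\<And>u. norm u < d \<Longrightarrow> norm (r lam u - (lam - \<mu>) *\<^sub>R D1 u) \<le> t * e * norm u"
      using r_linear_part[of "t * e" lam] t e by auto
    have "(lam - \<mu>) * (\<sigma> * ip (r lam u) (C w)) > 0"
      if u: "norm u < d" "reduced lam w u" and w0: "w \<noteq> 0" for u w
    proof -
      have w: "w \<in> Ker" "u = w + R (r lam u - P (r lam u))" using u(2) by (auto simp: reduced_def)
      define y where "y = u - w"
      define s where "s = r lam u - (lam - \<mu>) *\<^sub>R D1 u"
      have s: "norm s \<le> t * e * norm u" using d(2)[OF u(1)] by (simp add: s_def)
      have "norm ((lam - \<mu>) *\<^sub>R D1 u) \<le> t * (norm u * m)" using m(2)[of u] t by (simp add: t_def mult_left_mono)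
      then have "norm (r lam u) \<le> t * (m + e) * norm u"
        using s norm_triangle_ineq[of s "(lam - \<mu>) *\<^sub>R D1 u"] by (simp add: s_def algebra_simps)
      then have "\<kappa> * norm (r lam u) \<le> \<kappa> * (t * (m + e) * norm u)" using \<kappa> by simp
      moreover have "y = R (r lam u - P (r lam u))" unfolding y_def using w(2) by (metis add_diff_cancel_left')
      ultimately have y: "norm y \<le> \<kappa> * t * (m + e) * norm u"
        using \<kappa>(2)[of "r lam u"] by (simp add: mult.assoc)
      also have "\<dots> \<le> 1/2 * norm u" using t1 by (intro mult_right_mono) auto
      finally have "norm y \<le> norm u / 2" by simp
      moreover have "norm u \<le> norm w + norm y" using norm_triangle_ineq[of w y] by (simp add: y_def)
      ultimately have u2: "norm u \<le> 2 * norm w" by simp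
      have y2: "norm y \<le> 2 * (\<kappa> * t * (m + e)) * norm w"
      proof -
        have "\<kappa> * t * (m + e) * norm u \<le> \<kappa> * t * (m + e) * (2 * norm w)"
          using u2 \<kappa> t m e by (intro mult_left_mono) auto
        then show ?thesis using y by simp
      qed
      have nw: "norm w > 0" using w0 by simp
      have dec: "\<sigma> * ip (r lam u) (C w) =
          (lam - \<mu>) * (\<sigma> * ip (D1 w) (C w)) + (lam - \<mu>) * (\<sigma> * ip (D1 y) (C w)) + \<sigma> * ip s (C w)"
      proof -
        have eq: "r lam u = (lam - \<mu>) *\<^sub>R D1 w + (lam - \<mu>) *\<^sub>R D1 y + s"
          by (simp add: s_def y_def D1.diff algebra_simps)
        show ?thesis by (subst eq) (simp add: ip.add_left ip.diff_left ip.scaleR_left algebra_simps)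
      qed
      have "\<bar>\<sigma> * ip (D1 y) (C w)\<bar> \<le> b * norm (D1 y) * norm w" by (rule ipb)
      also have "\<dots> \<le> b * (2 * (\<kappa> * t * (m + e)) * norm w * m) * norm w"
      proof -
        have "norm (D1 y) \<le> norm y * m" by (rule m)
        also have "\<dots> \<le> 2 * (\<kappa> * t * (m + e)) * norm w * m" using y2 m by (intro mult_right_mono) auto
        finally show ?thesis using b by (intro mult_right_mono mult_left_mono) auto
      qed
      also have "\<dots> = b * m * (2 * (\<kappa> * t * (m + e))) * (norm w)\<^sup>2" by (simp add: power2_eq_square)
      also have "\<dots> \<le> c / 4 * (norm w)\<^sup>2" using t2 by (intro mult_right_mono) auto
      finally have X: "\<bar>\<sigma> * ip (D1 y) (C w)\<bar> \<le> c / 4 * (norm w)\<^sup>2" .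
      have "\<bar>\<sigma> * ip s (C w)\<bar> \<le> b * norm s * norm w" by (rule ipb)
      also have "\<dots> \<le> b * (t * e * (2 * norm w)) * norm w"
      proof -
        have "t * e * norm u \<le> t * e * (2 * norm w)" using u2 t e by (intro mult_left_mono) auto
        then show ?thesis using s b by (intro mult_right_mono mult_left_mono) auto
      qed
      also have "\<dots> = t * (2 * b * e) * (norm w)\<^sup>2" by (simp add: power2_eq_square)
      finally have Y: "\<bar>\<sigma> * ip s (C w)\<bar> \<le> t * (c / 4) * (norm w)\<^sup>2" by (simp only: e)
      have tt: "(lam - \<mu>) * (lam - \<mu>) = t * t" by (simp add: t_def)
      have "(lam - \<mu>) * (\<sigma> * ip (r lam u) (C w)) = t * t * (\<sigma> * ip (D1 w) (C w))
          + t * t * (\<sigma> * ip (D1 y) (C w)) + (lam - \<mu>) * (\<sigma> * ip s (C w))"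
        unfolding dec tt[symmetric] by (simp add: algebra_simps)
      moreover have "t * t * (\<sigma> * ip (D1 w) (C w)) \<ge> t * t * (c * (norm w)\<^sup>2)"
        using c(2)[OF w(1)] t by (intro mult_left_mono) auto
      moreover have "t * t * (\<sigma> * ip (D1 y) (C w)) \<ge> t * t * (- (c / 4 * (norm w)\<^sup>2))"
        using X t by (intro mult_left_mono) auto
      moreover have "(lam - \<mu>) * (\<sigma> * ip s (C w)) \<ge> - (t * t * (c / 4 * (norm w)\<^sup>2))"
      proof -
        have "\<bar>(lam - \<mu>) * (\<sigma> * ip s (C w))\<bar> \<le> t * (t * (c / 4) * (norm w)\<^sup>2)"
          unfolding abs_mult[of "lam - \<mu>"] t_def[symmetric] using Y t by (intro mult_left_mono) auto
        then show ?thesis by (simp add: mult_ac)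
      qed
      moreover have "t * t * (c * (norm w)\<^sup>2) > 0" using t c nw by simp
      ultimately show ?thesis by (simp add: algebra_simps)
    qed
    then show "\<exists>d>0. \<forall>u w. norm u < d \<longrightarrow> reduced lam w u \<longrightarrow> w \<noteq> 0 \<longrightarrow> (lam - \<mu>) * (\<sigma> * ip (r lam u) (C w)) > 0"
      using d(1) by blast
  qed
qed

text \<open>
  The contraction principle on the ball of radius \<open>2 * norm w\<close>: the right hand side of the reduced equation has
  Lipschitz constant \<open>1/2\<close> there. This also gives Lipschitz dependence on \<open>w\<close> and on the parameter.
\<close>

lemma reduced_estimates:
  obtains \<kappa> \<delta> where "\<kappa> > 0" "\<delta> > 0"
    "\<And>lam w u w' u'. \<bar>lam - \<mu>\<bar> < \<delta> \<Longrightarrow> norm u < \<delta> \<Longrightarrow> norm u' < \<delta> \<Longrightarrow> reduced lam w u \<Longrightarrow> reduced lam w' u' \<Longrightarrow>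
       norm (u - u') \<le> 2 * norm (w - w')"
    "\<And>lam w. \<bar>lam - \<mu>\<bar> < \<delta> \<Longrightarrow> 2 * norm w < \<delta> \<Longrightarrow> w \<in> Ker \<Longrightarrow> \<exists>u. reduced lam w u \<and> norm u \<le> 2 * norm w"
    "\<And>lam w u u'. \<bar>lam - \<mu>\<bar> < \<delta> \<Longrightarrow> norm u < \<delta> \<Longrightarrow> norm u' < \<delta> \<Longrightarrow> reduced lam w u \<Longrightarrow> reduced \<mu> w u' \<Longrightarrow>
       norm (u - u') \<le> \<kappa> * norm (r lam u' - r \<mu> u')"
proof -
  obtain \<kappa> where \<kappa>: "\<kappa> > 0" "\<And>v. norm (R (v - P v)) \<le> \<kappa> * norm v" using correction_bound by blast
  obtain \<delta> where \<delta>: "\<delta> > 0" "\<And>lam u v. \<bar>lam - \<mu>\<bar> < \<delta> \<Longrightarrow> norm u < \<delta> \<Longrightarrow> norm v < \<delta> \<Longrightarrow>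
        norm (r lam u - r lam v) \<le> 1 / (2 * \<kappa>) * norm (u - v)"
    using r_lipschitz[of "1 / (2 * \<kappa>)"] \<kappa> by auto
  have half: "norm (R ((r lam u - r lam v) - P (r lam u - r lam v))) \<le> norm (u - v) / 2"
    if "\<bar>lam - \<mu>\<bar> < \<delta>" "norm u < \<delta>" "norm v < \<delta>" for lam u v
  proof -
    have "\<kappa> * norm (r lam u - r lam v) \<le> \<kappa> * (1 / (2 * \<kappa>) * norm (u - v))"
      using \<delta>(2)[OF that] \<kappa> by (intro mult_left_mono) auto
    also have "\<dots> = norm (u - v) / 2" using \<kappa> by simp
    finally show ?thesis using \<kappa>(2)[of "r lam u - r lam v"] by simp
  qed
  show thesis
  proof (rule that[of "2 * \<kappa>" \<delta>])
    fix lam w u w' u'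
    assume *: "\<bar>lam - \<mu>\<bar> < \<delta>" "norm u < \<delta>" "norm u' < \<delta>" "reduced lam w u" "reduced lam w' u'"
    let ?v = "r lam u - r lam u'"
    have "u = w + R (r lam u - P (r lam u))" "u' = w' + R (r lam u' - P (r lam u'))"
      using *(4,5) unfolding reduced_def by blast+
    then have "u - u' = (w + R (r lam u - P (r lam u))) - (w' + R (r lam u' - P (r lam u')))"
      by (rule arg_cong2[where f = "(-)"])
    also have "\<dots> = (w - w') + (R (r lam u - P (r lam u)) - R (r lam u' - P (r lam u')))" by simp
    also have "\<dots> = (w - w') + R (?v - P ?v)" by (simp add: R.diff P.diff)
    finally have "norm (u - u') \<le> norm (w - w') + norm (R (?v - P ?v))"
      by (simp only: norm_triangle_ineq)
    then show "norm (u - u') \<le> 2 * norm (w - w')" using half[OF *(1-3)] by simp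
  next
    fix lam w assume *: "\<bar>lam - \<mu>\<bar> < \<delta>" "2 * norm w < \<delta>" "w \<in> Ker"
    define F where "F u = w + R (r lam u - P (r lam u))" for u
    have diff: "dist (F u) (F v) \<le> 1/2 * dist u v" if "norm u < \<delta>" "norm v < \<delta>" for u v
    proof -
      have "F u - F v = R ((r lam u - r lam v) - P (r lam u - r lam v))" by (simp add: F_def R.diff P.diff)
      then show ?thesis using half[OF *(1) that] by (simp add: dist_norm)
    qed
    have "\<exists>!u\<in>cball 0 (2 * norm w). F u = u"
    proof (rule Banach_fix)
      show "F ` cball 0 (2 * norm w) \<subseteq> cball 0 (2 * norm w)"
      proof clarify
        fix u :: 'a assume u: "u \<in> cball 0 (2 * norm w)"
        have "norm (F u) \<le> norm (F 0) + norm (F u - F 0)" using norm_triangle_ineq[of "F 0" "F u - F 0"] by simp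
        also have "\<dots> \<le> norm w + 1/2 * norm u"
          using diff[of u 0] u * \<delta> by (simp add: dist_norm) (simp add: F_def P.zero R.zero)
        finally show "F u \<in> cball 0 (2 * norm w)" using u by simp
      qed
      fix u v :: 'a assume "u \<in> cball 0 (2 * norm w)" "v \<in> cball 0 (2 * norm w)"
      then show "dist (F u) (F v) \<le> 1/2 * dist u v" using * by (intro diff) auto
    qed (auto simp: complete_eq_closed)
    then obtain u where "norm u \<le> 2 * norm w" "F u = u" by auto
    then show "\<exists>u. reduced lam w u \<and> norm u \<le> 2 * norm w"
      using *(3) unfolding reduced_def F_def by metis
  next
    fix lam w u u'
    assume *: "\<bar>lam - \<mu>\<bar> < \<delta>" "norm u < \<delta>" "norm u' < \<delta>" "reduced lam w u" "reduced \<mu> w u'"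
    let ?v = "r lam u - r lam u'" and ?v' = "r lam u' - r \<mu> u'"
    have "u = w + R (r lam u - P (r lam u))" "u' = w + R (r \<mu> u' - P (r \<mu> u'))"
      using *(4,5) unfolding reduced_def by blast+
    then have "u - u' = (w + R (r lam u - P (r lam u))) - (w + R (r \<mu> u' - P (r \<mu> u')))"
      by (rule arg_cong2[where f = "(-)"])
    also have "\<dots> = R (?v - P ?v) + R (?v' - P ?v')" by (simp add: R.diff P.diff)
    finally have "norm (u - u') \<le> norm (R (?v - P ?v)) + norm (R (?v' - P ?v'))"
      by (simp only: norm_triangle_ineq)
    then show "norm (u - u') \<le> 2 * \<kappa> * norm (r lam u' - r \<mu> u')"
      using half[OF *(1-3)] \<kappa>(2)[of ?v'] by linarith
  qed (use \<kappa> \<delta> in auto)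
qed

text \<open>
  A solution has \<open>P (r lam u) = 0\<close>, so that the expression of the sign lemma vanishes and the kernel part
  of \<open>u\<close> must be zero; the reduced equation then leaves only \<open>u = 0\<close>.
\<close>

lemma isolated_trivial_solution:
  obtains \<delta> where "\<delta> > 0" "\<And>lam. lam \<noteq> \<mu> \<Longrightarrow> \<bar>lam - \<mu>\<bar> < \<delta> \<Longrightarrow>
    \<exists>d>0. \<forall>u. norm u < d \<longrightarrow> N lam u = 0 \<longrightarrow> u = 0"
proof -
  obtain \<delta>1 where \<delta>1: "\<delta>1 > 0" "\<And>lam. lam \<noteq> \<mu> \<Longrightarrow> \<bar>lam - \<mu>\<bar> < \<delta>1 \<Longrightarrow>
    \<exists>d>0. \<forall>u w. norm u < d \<longrightarrow> reduced lam w u \<longrightarrow> w \<noteq> 0 \<longrightarrow> (lam - \<mu>) * (\<sigma> * ip (r lam u) (C w)) > 0"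
    using reduced_sign by blast
  obtain \<kappa> \<delta>2 where \<delta>2: "\<kappa> > 0" "\<delta>2 > 0"
    "\<And>lam w u w' u'. \<bar>lam - \<mu>\<bar> < \<delta>2 \<Longrightarrow> norm u < \<delta>2 \<Longrightarrow> norm u' < \<delta>2 \<Longrightarrow> reduced lam w u \<Longrightarrow> reduced lam w' u' \<Longrightarrow>
       norm (u - u') \<le> 2 * norm (w - w')"
    "\<And>lam w. \<bar>lam - \<mu>\<bar> < \<delta>2 \<Longrightarrow> 2 * norm w < \<delta>2 \<Longrightarrow> w \<in> Ker \<Longrightarrow> \<exists>u. reduced lam w u \<and> norm u \<le> 2 * norm w"
    "\<And>lam w u u'. \<bar>lam - \<mu>\<bar> < \<delta>2 \<Longrightarrow> norm u < \<delta>2 \<Longrightarrow> norm u' < \<delta>2 \<Longrightarrow> reduced lam w u \<Longrightarrow> reduced \<mu> w u' \<Longrightarrow>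
       norm (u - u') \<le> \<kappa> * norm (r lam u' - r \<mu> u')"
    by (rule reduced_estimates) (rule that)
  show thesis
  proof (rule that[of "min \<delta>1 \<delta>2"])
    fix lam assume lam: "lam \<noteq> \<mu>" "\<bar>lam - \<mu>\<bar> < min \<delta>1 \<delta>2"
    then obtain d where d: "d > 0" "\<And>u w. norm u < d \<Longrightarrow> reduced lam w u \<Longrightarrow> w \<noteq> 0 \<Longrightarrow> (lam - \<mu>) * (\<sigma> * ip (r lam u) (C w)) > 0"
      using \<delta>1(2)[of lam] by auto
    have "u = 0" if u: "norm u < min d \<delta>2" "N lam u = 0" for u
    proof -
      note red = solution_reduced[OF u(2)]
      have "ip (r lam u) (C (P u)) = 0"
        using red(2) ip_P[of "C (P u)" "r lam u"] by (simp add: ip.zero_left)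
      then have "P u = 0" using d(2)[of u "P u"] u red by auto
      moreover have "reduced lam 0 0" by (simp add: reduced_def subspace_0[OF subspace_Ker] P.zero R.zero)
      ultimately show ?thesis using \<delta>2(3)[of lam u 0 "P u" 0] lam u red \<delta>2(2) by simp
    qed
    then show "\<exists>d>0. \<forall>u. norm u < d \<longrightarrow> N lam u = 0 \<longrightarrow> u = 0"
      using d(1) \<delta>2(2) by (intro exI[of _ "min d \<delta>2"]) auto
  qed (use \<delta>1 \<delta>2 in auto)
qed

end

section \<open>Bifurcation for potential equations\<close>

lemma has_derivative_quadratic_error:
  fixes \<phi> :: "'a::real_normed_vector \<Rightarrow> real"
  assumes L: "bounded_linear L" and d: "d > 0"
    and err: "\<And>h. norm h < d \<Longrightarrow> \<bar>\<phi> (z + h) - \<phi> z - L h\<bar> \<le> M * (norm h)\<^sup>2"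
  shows "(\<phi> has_derivative L) (at z)"
  unfolding has_derivative_at
proof
  show "bounded_linear L" by (rule L)
  have lim: "((\<lambda>h::'a. \<bar>M\<bar> * norm h) \<longlongrightarrow> 0) (at 0)"
    by (auto intro!: tendsto_eq_intros)
  show "((\<lambda>h. norm (\<phi> (z + h) - \<phi> z - L h) / norm h) \<longlongrightarrow> 0) (at 0)"
  proof (rule Lim_null_comparison[OF _ lim])
    have "norm (\<phi> (z + h) - \<phi> z - L h) / norm h \<le> \<bar>M\<bar> * norm h" if "h \<noteq> 0" "norm h < d" for h
    proof -
      have "\<bar>\<phi> (z + h) - \<phi> z - L h\<bar> \<le> M * (norm h)\<^sup>2" by (rule err[OF that(2)])
      also have "\<dots> \<le> \<bar>M\<bar> * (norm h)\<^sup>2" by (intro mult_right_mono) auto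
      finally show ?thesis using that by (simp add: divide_le_eq power2_eq_square mult.assoc)
    qed
    then show "\<forall>\<^sub>F h in at 0. norm (norm (\<phi> (z + h) - \<phi> z - L h) / norm h) \<le> \<bar>M\<bar> * norm h"
      unfolding eventually_at using d by (intro exI[of _ d]) (auto simp: dist_norm)
  qed
qed

locale potential_perturbation = perturbation ip A ev C D1 \<sigma> r \<mu>
  for ip :: "'a::banach \<Rightarrow> 'a \<Rightarrow> real" and A :: "'a \<Rightarrow> 'a" and ev :: "'a \<Rightarrow> 'z::euclidean_space"
    and C D1 :: "'a \<Rightarrow> 'a" and \<sigma> :: real and r :: "real \<Rightarrow> 'a \<Rightarrow> 'a" and \<mu> :: real +
  fixes f :: "real \<Rightarrow> 'a \<Rightarrow> real"
  assumes f_zero: "f lam 0 = 0"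
    and f_derivative: "\<exists>M \<delta>. \<delta> > 0 \<and> (\<forall>lam u v. \<bar>lam - \<mu>\<bar> < \<delta> \<longrightarrow> norm u < \<delta> \<longrightarrow> norm v < \<delta> \<longrightarrow>
        \<bar>f lam v - f lam u - ip (N lam u) (C (v - u))\<bar> \<le> M * (norm (v - u))\<^sup>2)"
    and parameter_lipschitz: "\<exists>M \<delta>. \<delta> > 0 \<and> (\<forall>lam u. \<bar>lam - \<mu>\<bar> < \<delta> \<longrightarrow> norm u < \<delta> \<longrightarrow>
        norm (r lam u - r \<mu> u) \<le> M * \<bar>lam - \<mu>\<bar> \<and> \<bar>f lam u - f \<mu> u\<bar> \<le> M * \<bar>lam - \<mu>\<bar>)"
begin

definition small_solution :: "real \<Rightarrow> real \<Rightarrow> bool" where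
  "small_solution lam \<epsilon> \<longleftrightarrow> (\<exists>u. u \<noteq> 0 \<and> norm u < \<epsilon> \<and> N lam u = 0)"

lemma small_solution_mono: "small_solution lam \<epsilon> \<Longrightarrow> \<epsilon> \<le> \<epsilon>' \<Longrightarrow> small_solution lam \<epsilon>'"
  unfolding small_solution_def by force

text \<open>
  Suppose that none of the alternatives holds. Then on both sides of \<open>\<mu>\<close>, arbitrarily close to it, there
  are parameters for which the trivial solution is the only one in a fixed ball. By the sign of the
  crossing form the origin is a strict local minimum of \<open>- \<sigma> f\<close> on the reduced space for such parameters
  on the right, and of \<open>\<sigma> f\<close> for those on the left, and it is the only critical point. The mountain-pass
  estimate holds uniformly as the parameter tends to \<open>\<mu>\<close>, hence in the limit both \<open>- \<sigma> f\<close> and \<open>\<sigma> f\<close> are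
  nonnegative near the origin. So \<open>f\<close> vanishes there, all points are critical, and \<open>\<mu>\<close> has small nontrivial
  solutions after all. In terms of the Conley index: a repeller cannot be continued to an attractor.
\<close>

theorem bifurcation_alternative:
  assumes K: "Ker \<noteq> {0}"
  shows "(\<forall>\<epsilon>>0. small_solution \<mu> \<epsilon>)
    \<or> (\<forall>\<epsilon>>0. \<exists>\<delta>>0. \<forall>lam. \<mu> < lam \<and> lam < \<mu> + \<delta> \<longrightarrow> small_solution lam \<epsilon>)
    \<or> (\<forall>\<epsilon>>0. \<exists>\<delta>>0. \<forall>lam. \<mu> - \<delta> < lam \<and> lam < \<mu> \<longrightarrow> small_solution lam \<epsilon>)"
proof (rule ccontr)
  assume neg: "\<not> ?thesis"
  then obtain e1 where e1: "e1 > 0" "\<not> small_solution \<mu> e1" by blast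
  from neg obtain e2 where e2: "e2 > 0"
    "\<And>\<delta>. \<delta> > 0 \<Longrightarrow> \<exists>lam. \<mu> < lam \<and> lam < \<mu> + \<delta> \<and> \<not> small_solution lam e2" by meson
  from neg obtain e3 where e3: "e3 > 0"
    "\<And>\<delta>. \<delta> > 0 \<Longrightarrow> \<exists>lam. \<mu> - \<delta> < lam \<and> lam < \<mu> \<and> \<not> small_solution lam e3" by meson
  define e0 where "e0 = min e1 (min e2 e3)"
  have e0: "e0 > 0" "e0 \<le> e1" "e0 \<le> e2" "e0 \<le> e3" using e1 e2 e3 by (auto simp: e0_def)
  define isolated where "isolated lam \<longleftrightarrow> \<not> small_solution lam e0" for lam
  have iso_\<mu>: "isolated \<mu>" using e1(2) small_solution_mono[OF _ e0(2)] by (auto simp: isolated_def)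
  have iso: "\<exists>lam. s * (lam - \<mu>) > 0 \<and> \<bar>lam - \<mu>\<bar> < \<delta> \<and> isolated lam" if d: "\<delta> > 0" "s = 1 \<or> s = -1" for s \<delta> :: real
    using d(2)
  proof
    assume s: "s = 1"
    obtain lam where "\<mu> < lam" "lam < \<mu> + \<delta>" "\<not> small_solution lam e2" using e2(2)[OF d(1)] by blast
    then show ?thesis using s small_solution_mono[OF _ e0(3)]
      by (intro exI[of _ lam]) (auto simp: isolated_def)
  next
    assume s: "s = -1"
    obtain lam where "\<mu> - \<delta> < lam" "lam < \<mu>" "\<not> small_solution lam e3" using e3(2)[OF d(1)] by blast
    then show ?thesis using s small_solution_mono[OF _ e0(4)]
      by (intro exI[of _ lam]) (auto simp: isolated_def)
  qed
  obtain w0 where w0: "w0 \<in> Ker" "w0 \<noteq> 0" using K subspace_0[OF subspace_Ker] by blast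
  have \<sigma>: "\<sigma> \<noteq> 0" using definite[of w0] w0 by (auto simp: Ker_def)
  obtain \<kappa> \<delta>1 where \<delta>1: "\<kappa> > 0" "\<delta>1 > 0"
    and lip: "\<And>lam w u w' u'. \<bar>lam - \<mu>\<bar> < \<delta>1 \<Longrightarrow> norm u < \<delta>1 \<Longrightarrow> norm u' < \<delta>1 \<Longrightarrow> reduced lam w u \<Longrightarrow> reduced lam w' u' \<Longrightarrow>
       norm (u - u') \<le> 2 * norm (w - w')"
    and ex: "\<And>lam w. \<bar>lam - \<mu>\<bar> < \<delta>1 \<Longrightarrow> 2 * norm w < \<delta>1 \<Longrightarrow> w \<in> Ker \<Longrightarrow> \<exists>u. reduced lam w u \<and> norm u \<le> 2 * norm w"
    and par: "\<And>lam w u u'. \<bar>lam - \<mu>\<bar> < \<delta>1 \<Longrightarrow> norm u < \<delta>1 \<Longrightarrow> norm u' < \<delta>1 \<Longrightarrow> reduced lam w u \<Longrightarrow> reduced \<mu> w u' \<Longrightarrow>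
       norm (u - u') \<le> \<kappa> * norm (r lam u' - r \<mu> u')"
    by (rule reduced_estimates) (rule that)
  obtain \<delta>2 where \<delta>2: "\<delta>2 > 0" and sign: "\<And>lam. lam \<noteq> \<mu> \<Longrightarrow> \<bar>lam - \<mu>\<bar> < \<delta>2 \<Longrightarrow>
    \<exists>d>0. \<forall>u w. norm u < d \<longrightarrow> reduced lam w u \<longrightarrow> w \<noteq> 0 \<longrightarrow> (lam - \<mu>) * (\<sigma> * ip (r lam u) (C w)) > 0"
    using reduced_sign by blast
  obtain M3' \<delta>3 where \<delta>3: "\<delta>3 > 0" and f_der': "\<And>lam u v. \<bar>lam - \<mu>\<bar> < \<delta>3 \<Longrightarrow> norm u < \<delta>3 \<Longrightarrow> norm v < \<delta>3 \<Longrightarrow>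
        \<bar>f lam v - f lam u - ip (N lam u) (C (v - u))\<bar> \<le> M3' * (norm (v - u))\<^sup>2"
    using f_derivative by blast
  obtain M4' \<delta>4 where \<delta>4: "\<delta>4 > 0"
    and r_par': "\<And>lam u. \<bar>lam - \<mu>\<bar> < \<delta>4 \<Longrightarrow> norm u < \<delta>4 \<Longrightarrow> norm (r lam u - r \<mu> u) \<le> M4' * \<bar>lam - \<mu>\<bar>"
    and f_par': "\<And>lam u. \<bar>lam - \<mu>\<bar> < \<delta>4 \<Longrightarrow> norm u < \<delta>4 \<Longrightarrow> \<bar>f lam u - f \<mu> u\<bar> \<le> M4' * \<bar>lam - \<mu>\<bar>"
    using parameter_lipschitz by blast
  obtain \<delta>5 where \<delta>5: "\<delta>5 > 0" and r_lip: "\<And>lam u v. \<bar>lam - \<mu>\<bar> < \<delta>5 \<Longrightarrow> norm u < \<delta>5 \<Longrightarrow> norm v < \<delta>5 \<Longrightarrow>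
        norm (r lam u - r lam v) \<le> 1 * norm (u - v)"
    using r_lipschitz[of 1] by auto
  define M3 where "M3 = \<bar>M3'\<bar>"
  define M4 where "M4 = \<bar>M4'\<bar>"
  have M: "M3 \<ge> 0" "M4 \<ge> 0" by (simp_all add: M3_def M4_def)
  define \<delta> where "\<delta> = min (min (min \<delta>1 \<delta>2) (min \<delta>3 \<delta>4)) (min \<delta>5 e0)"
  have \<delta>: "\<delta> > 0" "\<delta> \<le> \<delta>1" "\<delta> \<le> \<delta>2" "\<delta> \<le> \<delta>3" "\<delta> \<le> \<delta>4" "\<delta> \<le> \<delta>5" "\<delta> \<le> e0"
    using \<delta>1 \<delta>2 \<delta>3 \<delta>4 \<delta>5 e0 by (auto simp: \<delta>_def)
  have f_der: "\<bar>f lam v - f lam u - ip (N lam u) (C (v - u))\<bar> \<le> M3 * (norm (v - u))\<^sup>2"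
    if "\<bar>lam - \<mu>\<bar> < \<delta>" "norm u < \<delta>" "norm v < \<delta>" for lam u v
  proof -
    have "M3' * (norm (v - u))\<^sup>2 \<le> M3 * (norm (v - u))\<^sup>2" unfolding M3_def by (intro mult_right_mono) auto
    then show ?thesis using f_der'[of lam u v] that \<delta> by linarith
  qed
  have M4le: "M4' * \<bar>lam - \<mu>\<bar> \<le> M4 * \<bar>lam - \<mu>\<bar>" for lam unfolding M4_def by (intro mult_right_mono) auto
  have r_par: "norm (r lam u - r \<mu> u) \<le> M4 * \<bar>lam - \<mu>\<bar>" and f_par: "\<bar>f lam u - f \<mu> u\<bar> \<le> M4 * \<bar>lam - \<mu>\<bar>"
    if "\<bar>lam - \<mu>\<bar> < \<delta>" "norm u < \<delta>" for lam u
    using r_par'[of lam u] f_par'[of lam u] M4le[of lam] that \<delta> by linarith+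
  obtain m where m: "m > 0" "\<And>z. norm (E z) \<le> norm z * m" using E.pos_bounded by blast
  obtain mq where mq: "mq > 0" "\<And>z. norm (q z) \<le> norm z * mq" using q.pos_bounded by blast
  obtain mA where mA: "mA > 0" "\<And>z. norm (A z) \<le> norm z * mA" using A.pos_bounded by blast
  obtain mC where mC: "mC > 0" "\<And>z. norm (C z) \<le> norm z * mC" using C.pos_bounded by blast
  obtain b where b: "b > 0" "\<And>u v. norm (ip u v) \<le> norm u * norm v * b" using ip.pos_bounded by blast
  define \<epsilon>0 where "\<epsilon>0 = \<delta> / (2 * m)"
  have \<epsilon>0: "\<epsilon>0 > 0" using \<delta> m by (simp add: \<epsilon>0_def)
  have Esmall: "2 * norm (E z) < \<delta>" if "norm z < \<epsilon>0" for z
  proof -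
    have "2 * norm (E z) \<le> 2 * (norm z * m)" using m(2)[of z] by simp
    also have "\<dots> < \<delta>" using that m by (simp add: \<epsilon>0_def field_simps)
    finally show ?thesis .
  qed
  \<comment> \<open>the complementary equation is solved by \<open>U\<close>; what remains is a critical point problem for \<open>z\<close>\<close>
  define U where "U lam z = (SOME u. reduced lam (E z) u \<and> norm u \<le> 2 * norm (E z))" for lam z
  have U: "reduced lam (E z) (U lam z)" "norm (U lam z) \<le> 2 * norm (E z)" "norm (U lam z) < \<delta>"
    if "\<bar>lam - \<mu>\<bar> < \<delta>" "norm z < \<epsilon>0" for lam z
  proof -
    have "\<exists>u. reduced lam (E z) u \<and> norm u \<le> 2 * norm (E z)"
      by (rule ex) (use that \<delta> Esmall[of z] in auto)
    from someI_ex[OF this] show "reduced lam (E z) (U lam z)" "norm (U lam z) \<le> 2 * norm (E z)" "norm (U lam z) < \<delta>"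
      using Esmall[OF that(2)] by (auto simp: U_def[symmetric])
  qed
  have Ulip: "norm (U lam z - U lam z') \<le> 2 * norm (E (z - z'))"
    if "\<bar>lam - \<mu>\<bar> < \<delta>" "norm z < \<epsilon>0" "norm z' < \<epsilon>0" for lam z z'
    using lip[of lam "U lam z" "U lam z'" "E z" "E z'"] U[of lam z] U[of lam z'] that \<delta> by (simp add: E.diff)
  have Upar: "norm (U lam z - U \<mu> z) \<le> \<kappa> * M4 * \<bar>lam - \<mu>\<bar>" if "\<bar>lam - \<mu>\<bar> < \<delta>" "norm z < \<epsilon>0" for lam z
  proof -
    have "norm (U lam z - U \<mu> z) \<le> \<kappa> * norm (r lam (U \<mu> z) - r \<mu> (U \<mu> z))"
      using par[of lam "U lam z" "U \<mu> z" "E z"] U[of lam z] U[of \<mu> z] that \<delta> by simp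
    also have "\<dots> \<le> \<kappa> * (M4 * \<bar>lam - \<mu>\<bar>)" using r_par[of lam "U \<mu> z"] U[of \<mu> z] that \<delta> \<delta>1(1) by (intro mult_left_mono) auto
    finally show ?thesis by simp
  qed
  have PU: "P (U lam z) = E z" and NU: "N lam (U lam z) = - P (r lam (U lam z))" if "\<bar>lam - \<mu>\<bar> < \<delta>" "norm z < \<epsilon>0" for lam z
    using reduced_P reduced_N U(1)[OF that] by blast+
  \<comment> \<open>the quadratic term pins \<open>z\<close> to the directions that correspond to kernel elements, without changing the critical points among these\<close>
  define \<Phi> where "\<Phi> s lam z = s * f lam (U lam z) + (q z \<bullet> q z) / 2" for s lam z
  define D where "D s lam z h = s * ip (C (N lam (U lam z))) (E h) + q z \<bullet> q h" for s lam z h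
  have D_bl: "bounded_linear (D s lam z)" for s lam z
    unfolding D_def
    by (intro bounded_linear_add bounded_linear_const_mult
        bounded_linear_compose[OF ip.bounded_linear_right E.bounded_linear_axioms]
        bounded_linear_compose[OF bounded_linear_inner_right q.bounded_linear_axioms])
  have der: "(\<Phi> s lam has_derivative D s lam z) (at z)" if lam: "\<bar>lam - \<mu>\<bar> < \<delta>" and z: "norm z < \<epsilon>0" for s lam z
  proof (rule has_derivative_quadratic_error[where d = "\<epsilon>0 - norm z" and M = "\<bar>s\<bar> * M3 * 4 * m\<^sup>2 + mq\<^sup>2 / 2", OF D_bl])
    show "\<epsilon>0 - norm z > 0" using z by simp
    fix h :: 'z assume h: "norm h < \<epsilon>0 - norm z"
    then have zh: "norm (z + h) < \<epsilon>0" using norm_triangle_ineq[of z h] by simp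
    let ?u = "U lam z" and ?v = "U lam (z + h)"
    have NK: "C (N lam ?u) \<in> Ker" using NU[OF lam z] by (simp add: subspace_neg[OF subspace_Ker])
    \<comment> \<open>\<open>N\<close> is in the kernel along \<open>U\<close>, hence only the kernel part of the increment of \<open>U\<close> counts to first order; a Lipschitz bound for \<open>U\<close> is enough\<close>
    have "ip (N lam ?u) (C (?v - ?u)) = ip (C (N lam ?u)) (?v - ?u)" by (simp add: C_sym)
    also have "\<dots> = ip (C (N lam ?u)) (P (?v - ?u))" using NK P_sym[of "C (N lam ?u)" "?v - ?u"] by simp
    also have "P (?v - ?u) = E h" using PU[OF lam z] PU[OF lam zh] by (simp add: P.diff E.add)
    finally have id: "ip (N lam ?u) (C (?v - ?u)) = ip (C (N lam ?u)) (E h)" .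
    have "norm (?v - ?u) \<le> 2 * (norm h * m)" using Ulip[OF lam zh z] m(2)[of h] by simp
    then have "(norm (?v - ?u))\<^sup>2 \<le> (2 * (norm h * m))\<^sup>2" by (intro power_mono) auto
    then have "M3 * (norm (?v - ?u))\<^sup>2 \<le> M3 * (4 * m\<^sup>2 * (norm h)\<^sup>2)"
      using M by (intro mult_left_mono) (auto simp: power_mult_distrib mult_ac)
    then have fb: "\<bar>f lam ?v - f lam ?u - ip (C (N lam ?u)) (E h)\<bar> \<le> M3 * (4 * m\<^sup>2 * (norm h)\<^sup>2)"
      using f_der[OF lam U(3)[OF lam z] U(3)[OF lam zh]] id by linarith
    have qb: "q h \<bullet> q h / 2 \<le> mq\<^sup>2 / 2 * (norm h)\<^sup>2"
    proof -
      have "(norm (q h))\<^sup>2 \<le> (norm h * mq)\<^sup>2" using mq(2)[of h] by (intro power_mono) auto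
      then show ?thesis by (simp add: power2_norm_eq_inner[symmetric] power_mult_distrib mult_ac)
    qed
    have "\<Phi> s lam (z + h) - \<Phi> s lam z - D s lam z h
        = s * (f lam ?v - f lam ?u - ip (C (N lam ?u)) (E h)) + q h \<bullet> q h / 2"
      by (simp add: \<Phi>_def D_def q.add inner_add_left inner_add_right inner_commute[of "q h" "q z"] algebra_simps add_divide_distrib)
    then have "\<bar>\<Phi> s lam (z + h) - \<Phi> s lam z - D s lam z h\<bar>
        \<le> \<bar>s\<bar> * \<bar>f lam ?v - f lam ?u - ip (C (N lam ?u)) (E h)\<bar> + q h \<bullet> q h / 2"
      by (metis abs_mult abs_of_nonneg abs_triangle_ineq inner_ge_zero divide_nonneg_nonneg zero_le_numeral)
    also have "\<dots> \<le> \<bar>s\<bar> * (M3 * (4 * m\<^sup>2 * (norm h)\<^sup>2)) + mq\<^sup>2 / 2 * (norm h)\<^sup>2"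
      using fb qb by (intro add_mono mult_left_mono) auto
    finally show "\<bar>\<Phi> s lam (z + h) - \<Phi> s lam z - D s lam z h\<bar> \<le> (\<bar>s\<bar> * M3 * 4 * m\<^sup>2 + mq\<^sup>2 / 2) * (norm h)\<^sup>2"
      by (simp add: algebra_simps)
  qed
  have Ncont: "continuous_on (ball 0 \<epsilon>0) (\<lambda>z. N lam (U lam z))" if lam: "\<bar>lam - \<mu>\<bar> < \<delta>" for lam
  proof -
    have "norm (r lam (U lam z) - r lam (U lam z')) \<le> 2 * m * norm (z - z') \<and> norm (U lam z - U lam z') \<le> 2 * m * norm (z - z')"
      if "norm z < \<epsilon>0" "norm z' < \<epsilon>0" for z z'
      using r_lip[of lam "U lam z" "U lam z'"] U[OF lam that(1)] U[OF lam that(2)] Ulip[OF lam that] m(2)[of "z - z'"] lam \<delta>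
      by (simp add: mult_ac)
    then have "(2 * m)-lipschitz_on (ball 0 \<epsilon>0) (\<lambda>z. r lam (U lam z))" "(2 * m)-lipschitz_on (ball 0 \<epsilon>0) (U lam)"
      using m by (auto intro!: lipschitz_onI simp: dist_norm)
    then have "continuous_on (ball 0 \<epsilon>0) (\<lambda>z. r lam (U lam z))" "continuous_on (ball 0 \<epsilon>0) (U lam)"
      by (auto dest: lipschitz_on_continuous_on)
    then show ?thesis unfolding N_def by (intro continuous_intros A.continuous_on)
  qed
  have cont: "continuous_on (ball 0 \<epsilon>0) (\<lambda>z. D s lam z h)" if "\<bar>lam - \<mu>\<bar> < \<delta>" for s lam h
    unfolding D_def by (intro continuous_intros ip.continuous_on C.continuous_on q.continuous_on Ncont[OF that])
  have critical: "N lam (U lam z) = 0"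
    if lam: "\<bar>lam - \<mu>\<bar> < \<delta>" and z: "norm z < \<epsilon>0" and s: "s \<noteq> 0" and 0: "\<And>h. D s lam z h = 0" for s lam z
  proof -
    let ?n = "N lam (U lam z)"
    have nK: "?n \<in> Ker" using NU[OF lam z] by (simp add: subspace_neg[OF subspace_Ker])
    then have CnK: "C ?n \<in> Ker" by simp
    have "q z = 0" using 0[of "q z"] by (simp add: D_def ip.zero_right)
    then have "s * ip (C ?n) (C ?n) = 0" using 0[of "ev (C ?n)"] by (simp add: D_def E_ev[OF CnK])
    then have "C ?n = 0" using s ip_eq_0_iff by simp
    then show ?thesis using C_inj[of ?n] nK by (simp add: Ker_def)
  qed
  have U0: "z = 0" if "\<bar>lam - \<mu>\<bar> < \<delta>" "norm z < \<epsilon>0" "U lam z = 0" "q z = 0" for lam z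
    using PU[OF that(1,2)] that(3,4) E_q_zero[of z] by (simp add: P.zero)
  have crit: "\<exists>h. D s lam z h < 0"
    if lam: "\<bar>lam - \<mu>\<bar> < \<delta>" "isolated lam" and z: "norm z < \<epsilon>0" "z \<noteq> 0" and s: "s \<noteq> 0" for s lam z
  proof (rule ccontr)
    assume "\<nexists>h. D s lam z h < 0"
    then have nonneg: "D s lam z h \<ge> 0" for h by (meson not_le)
    have 0: "D s lam z h = 0" for h
      using nonneg[of h] nonneg[of "-h"] linear_neg[OF bounded_linear.linear[OF D_bl], of s lam z h] by simp
    have n: "N lam (U lam z) = 0" by (rule critical[OF lam(1) z(1) s 0])
    have "q z = 0" using 0[of "q z"] by (simp add: D_def ip.zero_right)
    then have "U lam z \<noteq> 0" using U0[OF lam(1) z(1)] z(2) by blast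
    moreover have "norm (U lam z) < e0" using U(3)[OF lam(1) z(1)] \<delta> by simp
    ultimately show False using n lam(2) unfolding isolated_def small_solution_def by blast
  qed
  define \<epsilon> where "\<epsilon> = \<epsilon>0 / 2"
  have \<epsilon>: "\<epsilon> > 0" "\<epsilon> < \<epsilon>0" using \<epsilon>0 by (auto simp: \<epsilon>_def)
  have \<Phi>0: "\<Phi> s lam 0 = 0" if "\<bar>lam - \<mu>\<bar> < \<delta>" for s lam
  proof -
    have "U lam 0 = 0" using U(2)[OF that, of 0] \<epsilon>0 by (simp add: E.zero)
    then show ?thesis by (simp add: \<Phi>_def f_zero q.zero)
  qed
  define L where "L = (1 + mA + 1) * (\<kappa> * M4) + M4"
  have Npar: "norm (N lam (U lam z) - N \<mu> (U \<mu> z)) \<le> L * \<bar>lam - \<mu>\<bar>"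
    if lam: "\<bar>lam - \<mu>\<bar> < \<delta>" and z: "norm z < \<epsilon>0" for lam z
  proof -
    let ?u = "U lam z" and ?v = "U \<mu> z"
    have \<mu>: "\<bar>\<mu> - \<mu>\<bar> < \<delta>" using \<delta> by simp
    have d: "norm (?u - ?v) \<le> \<kappa> * M4 * \<bar>lam - \<mu>\<bar>" by (rule Upar[OF lam z])
    have "N lam ?u - N \<mu> ?v = (?u - ?v) - A (?u - ?v) - (r lam ?u - r lam ?v) - (r lam ?v - r \<mu> ?v)"
      by (simp add: N_def A.diff)
    also have "norm \<dots> \<le> norm (?u - ?v) + norm (A (?u - ?v)) + norm (r lam ?u - r lam ?v) + norm (r lam ?v - r \<mu> ?v)"
      using norm_triangle_ineq4[of "(?u - ?v) - A (?u - ?v) - (r lam ?u - r lam ?v)" "r lam ?v - r \<mu> ?v"]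
        norm_triangle_ineq4[of "(?u - ?v) - A (?u - ?v)" "r lam ?u - r lam ?v"]
        norm_triangle_ineq4[of "?u - ?v" "A (?u - ?v)"] by linarith
    also have "\<dots> \<le> norm (?u - ?v) + norm (?u - ?v) * mA + norm (?u - ?v) + M4 * \<bar>lam - \<mu>\<bar>"
      using mA(2)[of "?u - ?v"] r_lip[of lam ?u ?v] r_par[of lam ?v] U(3)[OF lam z] U(3)[OF \<mu> z] lam \<delta>
      by (intro add_mono) auto
    also have "\<dots> = (1 + mA + 1) * norm (?u - ?v) + M4 * \<bar>lam - \<mu>\<bar>" by (simp add: algebra_simps)
    also have "\<dots> \<le> (1 + mA + 1) * (\<kappa> * M4 * \<bar>lam - \<mu>\<bar>) + M4 * \<bar>lam - \<mu>\<bar>"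
      using d mA by (intro add_right_mono mult_left_mono) auto
    finally show ?thesis by (simp add: L_def algebra_simps)
  qed
  define LD where "LD s = \<bar>s\<bar> * (b * mC * L * m)" for s :: real
  have L0: "L \<ge> 0" using M \<delta>1(1) mA by (simp add: L_def)
  have LD0: "LD s \<ge> 0" for s using L0 b mC m by (simp add: LD_def)
  have Dpar: "\<bar>D s lam z h - D s \<mu> z h\<bar> \<le> LD s * \<bar>lam - \<mu>\<bar> * norm h"
    if lam: "\<bar>lam - \<mu>\<bar> < \<delta>" and z: "norm z < \<epsilon>0" for s lam z h
  proof -
    let ?n = "N lam (U lam z) - N \<mu> (U \<mu> z)"
    have "D s lam z h - D s \<mu> z h = s * ip (C ?n) (E h)"
      by (simp add: D_def C.diff ip.diff_left algebra_simps)
    then have "\<bar>D s lam z h - D s \<mu> z h\<bar> = \<bar>s\<bar> * norm (ip (C ?n) (E h))" by (simp add: abs_mult)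
    also have "\<dots> \<le> \<bar>s\<bar> * (norm (C ?n) * norm (E h) * b)" using b(2) by (intro mult_left_mono) auto
    also have "\<dots> \<le> \<bar>s\<bar> * ((L * \<bar>lam - \<mu>\<bar> * mC) * (norm h * m) * b)"
    proof -
      have "norm (C ?n) \<le> norm ?n * mC" by (rule mC)
      also have "\<dots> \<le> L * \<bar>lam - \<mu>\<bar> * mC" using Npar[OF lam z] mC by (intro mult_right_mono) auto
      finally show ?thesis using m(2)[of h] b m L0 mC
        by (intro mult_left_mono mult_right_mono mult_mono) auto
    qed
    finally show ?thesis by (simp add: LD_def mult_ac)
  qed
  have \<Phi>par: "((\<lambda>lam. \<Phi> s lam z) \<longlongrightarrow> \<Phi> s \<mu> z) (at \<mu>)" if z: "norm z < \<epsilon>0" for s z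
  proof -
    let ?v = "U \<mu> z"
    have \<mu>: "\<bar>\<mu> - \<mu>\<bar> < \<delta>" using \<delta> by simp
    have near: "eventually (\<lambda>lam. \<bar>lam - \<mu>\<bar> < \<delta>) (at \<mu>)"
      using \<delta>(1) by (auto simp: eventually_at dist_real_def)
    have t0: "((\<lambda>lam. \<bar>lam - \<mu>\<bar>) \<longlongrightarrow> 0) (at \<mu>)" by (auto intro!: tendsto_eq_intros)
    have tu: "((\<lambda>lam. norm (U lam z - ?v)) \<longlongrightarrow> 0) (at \<mu>)"
    proof (rule Lim_null_comparison)
      show "eventually (\<lambda>lam. norm (norm (U lam z - ?v)) \<le> \<kappa> * M4 * \<bar>lam - \<mu>\<bar>) (at \<mu>)"
        using near by eventually_elim (use Upar[OF _ z] in simp)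
      show "((\<lambda>lam. \<kappa> * M4 * \<bar>lam - \<mu>\<bar>) \<longlongrightarrow> 0) (at \<mu>)" using tendsto_mult_left[OF t0, of "\<kappa> * M4"] by simp
    qed
    have bound: "\<bar>f lam (U lam z) - f \<mu> ?v\<bar> \<le> b * norm (N \<mu> ?v) * mC * norm (U lam z - ?v) + M3 * (norm (U lam z - ?v))\<^sup>2 + M4 * \<bar>lam - \<mu>\<bar>"
      if lam: "\<bar>lam - \<mu>\<bar> < \<delta>" for lam
    proof -
      let ?u = "U lam z"
      have "\<bar>ip (N \<mu> ?v) (C (?u - ?v))\<bar> \<le> norm (N \<mu> ?v) * norm (C (?u - ?v)) * b"
        using b(2)[of "N \<mu> ?v" "C (?u - ?v)"] by simp
      also have "\<dots> \<le> norm (N \<mu> ?v) * (norm (?u - ?v) * mC) * b"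
        using mC b by (intro mult_right_mono mult_left_mono) auto
      finally have "\<bar>ip (N \<mu> ?v) (C (?u - ?v))\<bar> \<le> b * norm (N \<mu> ?v) * mC * norm (?u - ?v)" by (simp add: mult_ac)
      then show ?thesis using f_der[OF \<mu> U(3)[OF \<mu> z] U(3)[OF lam z]] f_par[OF lam U(3)[OF lam z]] by linarith
    qed
    have "((\<lambda>lam. f lam (U lam z) - f \<mu> ?v) \<longlongrightarrow> 0) (at \<mu>)"
    proof (rule Lim_null_comparison)
      show "eventually (\<lambda>lam. norm (f lam (U lam z) - f \<mu> ?v) \<le>
          b * norm (N \<mu> ?v) * mC * norm (U lam z - ?v) + M3 * (norm (U lam z - ?v))\<^sup>2 + M4 * \<bar>lam - \<mu>\<bar>) (at \<mu>)"
        using near by eventually_elim (use bound in simp)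
      have "((\<lambda>lam. b * norm (N \<mu> ?v) * mC * norm (U lam z - ?v) + M3 * (norm (U lam z - ?v))\<^sup>2 + M4 * \<bar>lam - \<mu>\<bar>)
          \<longlongrightarrow> b * norm (N \<mu> ?v) * mC * 0 + M3 * 0\<^sup>2 + M4 * 0) (at \<mu>)"
        by (intro tendsto_intros tu t0)
      then show "((\<lambda>lam. b * norm (N \<mu> ?v) * mC * norm (U lam z - ?v) + M3 * (norm (U lam z - ?v))\<^sup>2 + M4 * \<bar>lam - \<mu>\<bar>)
          \<longlongrightarrow> 0) (at \<mu>)" by simp
    qed
    then have "((\<lambda>lam. f lam (U lam z)) \<longlongrightarrow> f \<mu> ?v) (at \<mu>)" by (simp add: LIM_zero_iff)
    then show ?thesis unfolding \<Phi>_def by (intro tendsto_intros)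
  qed
  \<comment> \<open>approach \<open>\<mu>\<close> from the side given by \<open>sg\<close>, with the sign of \<open>f\<close> for which the origin is a minimum on that side\<close>
  have nonneg: "\<exists>\<rho>>0. \<forall>z. norm z < \<rho> \<longrightarrow> \<Phi> (- (sg * \<sigma>)) \<mu> z \<ge> 0" if sg: "sg = 1 \<or> sg = -1" for sg :: real
  proof -
    define s where "s = - (sg * \<sigma>)"
    have s: "s \<noteq> 0" using sg \<sigma> by (auto simp: s_def)
    have \<mu>: "\<bar>\<mu> - \<mu>\<bar> < \<delta>" using \<delta> by simp
    define G where "G z = (\<Sum>i\<in>Basis. D s \<mu> z i *\<^sub>R i)" for z
    have G: "D s \<mu> z h = G z \<bullet> h" for z h
    proof -
      have "D s \<mu> z h = D s \<mu> z (\<Sum>i\<in>Basis. (h \<bullet> i) *\<^sub>R i)" by (simp add: euclidean_representation)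
      also have "\<dots> = (\<Sum>i\<in>Basis. (h \<bullet> i) * D s \<mu> z i)"
        using bounded_linear.linear[OF D_bl[of s \<mu> z]] by (simp add: linear_sum linear_cmul)
      finally show ?thesis by (simp add: G_def inner_sum_left inner_sum_right mult.commute inner_commute)
    qed
    define An where "An = cball 0 \<epsilon> - ball (0::'z) (\<epsilon> / 2)"
    have cAn: "compact An" unfolding An_def by (intro compact_diff compact_cball open_ball)
    have neAn: "An \<noteq> {}"
    proof -
      obtain z :: 'z where "norm z = \<epsilon>" using vector_choose_size[of \<epsilon>] \<epsilon> by auto
      then have "z \<in> An" using \<epsilon> by (auto simp: An_def)
      then show ?thesis by blast
    qed
    have contAn: "continuous_on An (\<lambda>z. norm (G z))"
    proof -
      have "continuous_on (ball 0 \<epsilon>0) G" unfolding G_def by (intro continuous_intros cont[OF \<mu>])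
      then have "continuous_on An G" by (rule continuous_on_subset) (use \<epsilon> in \<open>auto simp: An_def\<close>)
      then show ?thesis by (intro continuous_intros)
    qed
    obtain z1 where z1: "z1 \<in> An" "\<And>z. z \<in> An \<Longrightarrow> norm (G z1) \<le> norm (G z)"
      using continuous_attains_inf[OF cAn neAn contAn] by blast
    \<comment> \<open>half of the least slope at \<open>\<mu>\<close> in the annulus, so that \<open>\<eta>\<close> remains a lower bound for nearby parameters\<close>
    define \<eta> where "\<eta> = norm (G z1) / 2"
    have "norm z1 < \<epsilon>0" "z1 \<noteq> 0" using z1(1) \<epsilon> by (auto simp: An_def)
    then have "G z1 \<noteq> 0" using crit[OF \<mu> iso_\<mu> _ _ s, of z1] by (auto simp: G)
    then have \<eta>: "\<eta> > 0" by (simp add: \<eta>_def)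
    define \<gamma> where "\<gamma> = \<eta> * \<epsilon> / 16"
    have \<gamma>: "\<gamma> > 0" using \<eta> \<epsilon> by (simp add: \<gamma>_def)
    define \<Gamma> where "\<Gamma> = \<bar>s\<bar> * M3 * 4 * m\<^sup>2 + mq\<^sup>2 / 2 + 1"
    have \<Gamma>: "\<Gamma> > 0" using M by (simp add: \<Gamma>_def add_nonneg_pos)
    define \<rho> where "\<rho> = min \<epsilon> (min 1 (\<gamma> / \<Gamma>))"
    have \<rho>: "\<rho> > 0" "\<rho> \<le> \<epsilon>" "\<rho> \<le> 1" "\<rho> \<le> \<gamma> / \<Gamma>" using \<epsilon> \<gamma> \<Gamma> by (auto simp: \<rho>_def)
    define \<delta>' where "\<delta>' = min \<delta> (\<eta> / (LD s + 1))"
    have \<delta>': "\<delta>' > 0" "\<delta>' \<le> \<delta>" "\<delta>' \<le> \<eta> / (LD s + 1)" using \<delta> \<eta> LD0[of s] by (auto simp: \<delta>'_def)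
    have key: "\<Phi> s lam z \<ge> 0" if lam: "sg * (lam - \<mu>) > 0" "\<bar>lam - \<mu>\<bar> < \<delta>'" "isolated lam" and z: "norm z < \<rho>" for lam z
    proof -
      have lam\<delta>: "\<bar>lam - \<mu>\<bar> < \<delta>" and lam_ne: "lam \<noteq> \<mu>" using lam \<delta>' by auto
      obtain d where d: "d > 0" "\<And>u w. norm u < d \<Longrightarrow> reduced lam w u \<Longrightarrow> w \<noteq> 0 \<Longrightarrow> (lam - \<mu>) * (\<sigma> * ip (r lam u) (C w)) > 0"
        using sign[OF lam_ne] lam\<delta> \<delta> by auto
      define d' where "d' = min \<epsilon>0 (d / (2 * m))"
      have d': "d' > 0" "d' \<le> \<epsilon>0" "d' \<le> d / (2 * m)" using \<epsilon>0 d(1) m by (auto simp: d'_def)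
      have radial: "D s lam z z > 0" if z: "z \<noteq> 0" "norm z < d'" for z
      proof -
        have z\<epsilon>: "norm z < \<epsilon>0" using z d' by simp
        let ?u = "U lam z" and ?w = "E z"
        have "norm ?u \<le> 2 * (norm z * m)" using U(2)[OF lam\<delta> z\<epsilon>] m(2)[of z] by simp
        also have "\<dots> < d"
        proof -
          have "norm z * (2 * m) < d' * (2 * m)" using z(2) m by (intro mult_strict_right_mono) auto
          also have "\<dots> \<le> d" using d'(3) m by (simp add: field_simps)
          finally show ?thesis by (simp add: mult_ac)
        qed
        finally have ud: "norm ?u < d" .
        have "ip (C (N lam ?u)) ?w = - ip (P (r lam ?u)) (C ?w)"
          using NU[OF lam\<delta> z\<epsilon>] by (simp add: linear_neg[OF C.linear] ip.minus_left C_sym)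
        also have "ip (P (r lam ?u)) (C ?w) = ip (r lam ?u) (C ?w)" by (rule ip_P) simp
        finally have eq: "D s lam z z = sg * (\<sigma> * ip (r lam ?u) (C ?w)) + q z \<bullet> q z"
          by (simp add: D_def s_def)
        show ?thesis
        proof (cases "?w = 0")
          case True
          then have "q z \<noteq> 0" using z E_q_zero by blast
          then show ?thesis using True eq by (simp add: C.zero ip.zero_right)
        next
          case False
          have "(lam - \<mu>) * (\<sigma> * ip (r lam ?u) (C ?w)) > 0" by (rule d(2)[OF ud U(1)[OF lam\<delta> z\<epsilon>] False])
          then have "sg * (\<sigma> * ip (r lam ?u) (C ?w)) > 0"
            using lam(1) sg by (auto simp: zero_less_mult_iff)
          then show ?thesis using eq by (simp add: add_pos_nonneg)
        qed
      qed
      \<comment> \<open>the radial derivative is positive, so \<open>\<Phi>\<close> increases along rays\<close>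
      have locmin: "\<Phi> s lam z > 0" if z: "z \<noteq> 0" "norm z < d'" for z
      proof -
        have n: "norm (0 + t *\<^sub>R z) < d'" if "0 \<le> t" "t \<le> 1" for t
          using that z(2) mult_right_mono[of t 1 "norm z"] by simp
        have dline: "((\<lambda>t. \<Phi> s lam (0 + t *\<^sub>R z)) has_real_derivative D s lam (0 + t *\<^sub>R z) z) (at t)"
          if "0 \<le> t" "t \<le> 1" for t
          by (rule derivative_along_line[OF der[OF lam\<delta>]]) (use n[OF that] d' in simp)
        have "\<exists>t>0. t < 1 \<and> \<Phi> s lam (0 + 1 *\<^sub>R z) - \<Phi> s lam (0 + 0 *\<^sub>R z) = (1 - 0) * D s lam (0 + t *\<^sub>R z) z"
          by (rule MVT2[of 0 1 "\<lambda>t. \<Phi> s lam (0 + t *\<^sub>R z)" "\<lambda>t. D s lam (0 + t *\<^sub>R z) z"]) (use dline in auto)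
        then obtain t where t: "0 < t" "t < 1" "\<Phi> s lam z = D s lam (t *\<^sub>R z) z"
          using \<Phi>0[OF lam\<delta>] by auto
        have "D s lam (t *\<^sub>R z) (t *\<^sub>R z) > 0" using radial[of "t *\<^sub>R z"] n[of t] t z by auto
        then have "t * D s lam (t *\<^sub>R z) z > 0"
          using linear_cmul[OF bounded_linear.linear[OF D_bl]] by simp
        then show ?thesis using t by (simp add: zero_less_mult_iff)
      qed
      show ?thesis
      proof (rule sublevel_component_nonneg[of \<epsilon> \<eta> \<gamma> "\<Phi> s lam" "D s lam" d' "ball 0 \<rho>"])
        show "16 * \<gamma> \<le> \<eta> * \<epsilon>" by (simp add: \<gamma>_def)
        show "(\<Phi> s lam has_derivative D s lam z) (at z)" if "norm z < \<epsilon>" for z using der[OF lam\<delta>] that \<epsilon> by simp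
        show "continuous_on (ball 0 \<epsilon>) (\<lambda>z. D s lam z h)" for h
          using continuous_on_subset[OF cont[OF lam\<delta>]] \<epsilon> by (simp add: subset_ball)
        show "\<exists>h. D s lam z h < 0" if "norm z < \<epsilon>" "z \<noteq> 0" for z using crit[OF lam\<delta> lam(3) _ _ s] that \<epsilon> by simp
        show "\<exists>h. norm h \<le> 1 \<and> D s lam z h \<le> - \<eta>" if z: "\<epsilon> / 2 \<le> norm z" "norm z < \<epsilon>" for z
        proof -
          have g2: "norm (G z) \<ge> 2 * \<eta>" using z1(2)[of z] z by (auto simp: \<eta>_def An_def)
          define h where "h = - (1 / norm (G z)) *\<^sub>R G z"
          have gp: "norm (G z) > 0" using g2 \<eta> by linarith
          then have "norm h = 1" by (simp add: h_def)
          moreover have "D s \<mu> z h \<le> - (2 * \<eta>)"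
            using g2 gp by (simp add: G h_def power2_norm_eq_inner[symmetric] power2_eq_square)
          moreover have "\<bar>D s lam z h - D s \<mu> z h\<bar> \<le> \<eta>"
          proof -
            have "LD s * \<bar>lam - \<mu>\<bar> \<le> (LD s + 1) * (\<eta> / (LD s + 1))"
              using lam(2) \<delta>' LD0[of s] by (intro mult_mono) auto
            also have "\<dots> = \<eta>" using LD0[of s] by simp
            finally show ?thesis using Dpar[OF lam\<delta>, of z s h] z \<epsilon> \<open>norm h = 1\<close> by simp
          qed
          ultimately show ?thesis by (intro exI[of _ h]) auto
        qed
        show "\<Phi> s lam z < \<gamma>" if "z \<in> ball 0 \<rho>" for z
        proof -
          have z: "norm z < \<rho>" "norm z < \<epsilon>0" using that \<rho> \<epsilon> by auto
          have "norm (U lam z) \<le> 2 * (norm z * m)" using U(2)[OF lam\<delta> z(2)] m(2)[of z] by simp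
          then have "(norm (U lam z))\<^sup>2 \<le> (2 * (norm z * m))\<^sup>2" by (intro power_mono) auto
          then have "M3 * (norm (U lam z))\<^sup>2 \<le> M3 * (4 * m\<^sup>2 * (norm z)\<^sup>2)"
            using M by (intro mult_left_mono) (auto simp: power_mult_distrib mult_ac)
          moreover have "\<bar>f lam (U lam z)\<bar> \<le> M3 * (norm (U lam z))\<^sup>2"
            using f_der[OF lam\<delta> _ U(3)[OF lam\<delta> z(2)], of 0] \<delta> by (simp add: f_zero ip.zero_left)
          ultimately have "\<bar>s\<bar> * \<bar>f lam (U lam z)\<bar> \<le> \<bar>s\<bar> * (M3 * (4 * m\<^sup>2 * (norm z)\<^sup>2))"
            by (intro mult_left_mono) auto
          moreover have "s * f lam (U lam z) \<le> \<bar>s\<bar> * \<bar>f lam (U lam z)\<bar>" by (metis abs_ge_self abs_mult)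
          moreover have "q z \<bullet> q z / 2 \<le> mq\<^sup>2 / 2 * (norm z)\<^sup>2"
          proof -
            have "(norm (q z))\<^sup>2 \<le> (norm z * mq)\<^sup>2" using mq(2)[of z] by (intro power_mono) auto
            then show ?thesis by (simp add: power2_norm_eq_inner[symmetric] power_mult_distrib mult_ac)
          qed
          ultimately have "\<Phi> s lam z \<le> (\<bar>s\<bar> * M3 * 4 * m\<^sup>2 + mq\<^sup>2 / 2) * (norm z)\<^sup>2"
            by (simp add: \<Phi>_def algebra_simps)
          also have "\<dots> \<le> \<Gamma> * (norm z)\<^sup>2" by (intro mult_right_mono) (auto simp: \<Gamma>_def)
          also have "\<dots> \<le> \<Gamma> * norm z"
          proof -
            have "norm z * norm z \<le> norm z * 1" using z \<rho> by (intro mult_left_mono) auto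
            then show ?thesis using \<Gamma> by (simp add: power2_eq_square)
          qed
          also have "\<dots> < \<Gamma> * (\<gamma> / \<Gamma>)" using z(1) \<rho> \<Gamma> by (intro mult_strict_left_mono) auto
          also have "\<dots> = \<gamma>" using \<Gamma> by simp
          finally show ?thesis .
        qed
      qed (use \<epsilon> \<eta> \<gamma> \<rho> d' z locmin \<Phi>0[OF lam\<delta>] in auto)
    qed
    have "\<Phi> s \<mu> z \<ge> 0" if z: "norm z < \<rho>" for z
    proof (rule ccontr)
      assume "\<not> ?thesis"
      then have "eventually (\<lambda>lam. \<Phi> s lam z < 0) (at \<mu>)"
        using order_tendstoD(2)[OF \<Phi>par[of z s], of 0] z \<rho> \<epsilon> by auto
      then obtain \<delta>'' where \<delta>'': "\<delta>'' > 0" "\<And>lam. lam \<noteq> \<mu> \<Longrightarrow> \<bar>lam - \<mu>\<bar> < \<delta>'' \<Longrightarrow> \<Phi> s lam z < 0"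
        by (auto simp: eventually_at dist_real_def)
      obtain lam where l: "sg * (lam - \<mu>) > 0" "\<bar>lam - \<mu>\<bar> < min \<delta>' \<delta>''" "isolated lam"
        using iso[of "min \<delta>' \<delta>''" sg] \<delta>' \<delta>'' sg by auto
      from l(1) have "lam \<noteq> \<mu>" by auto
      then show False using key[OF l(1) _ l(3) z] \<delta>''(2)[of lam] l(2) by simp
    qed
    then show ?thesis using \<rho>(1) unfolding s_def by blast
  qed
  obtain \<rho>1 where \<rho>1: "\<rho>1 > 0" "\<And>z. norm z < \<rho>1 \<Longrightarrow> \<Phi> (- (1 * \<sigma>)) \<mu> z \<ge> 0" using nonneg[of 1] by auto
  obtain \<rho>2 where \<rho>2: "\<rho>2 > 0" "\<And>z. norm z < \<rho>2 \<Longrightarrow> \<Phi> (- (-1 * \<sigma>)) \<mu> z \<ge> 0" using nonneg[of "-1"] by auto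
  define \<rho> where "\<rho> = min \<epsilon>0 (min \<rho>1 \<rho>2)"
  have \<rho>: "\<rho> > 0" "\<rho> \<le> \<epsilon>0" "\<rho> \<le> \<rho>1" "\<rho> \<le> \<rho>2" using \<rho>1 \<rho>2 \<epsilon>0 by (auto simp: \<rho>_def)
  \<comment> \<open>both signs together: \<open>f\<close> vanishes on the reduced space near the origin\<close>
  have flat: "\<Phi> \<sigma> \<mu> z = 0" if "norm z < \<rho>" "q z = 0" for z
    using \<rho>1(2)[of z] \<rho>2(2)[of z] that \<rho> by (simp add: \<Phi>_def)
  have ev0: "ev w0 \<noteq> 0" using ev_inj[of w0] w0 by (auto simp: Ker_def)
  define z where "z = (\<rho> / (2 * norm (ev w0))) *\<^sub>R ev w0"
  have z: "norm z < \<rho>" "z \<noteq> 0" "q z = 0" using \<rho>(1) ev0 w0 by (auto simp: z_def q.scaleR)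
  have \<mu>: "\<bar>\<mu> - \<mu>\<bar> < \<delta>" using \<delta> by simp
  have "D \<sigma> \<mu> z h = 0" for h
  proof -
    let ?k = "ev (E h)"
    have "D \<sigma> \<mu> z h = D \<sigma> \<mu> z ?k" using z(3) by (simp add: D_def E_ev)
    also have "D \<sigma> \<mu> z ?k = 0"
    proof -
      have "((\<lambda>t. \<Phi> \<sigma> \<mu> (z + t *\<^sub>R ?k)) has_real_derivative D \<sigma> \<mu> (z + 0 *\<^sub>R ?k) ?k) (at 0)"
        by (rule derivative_along_line[OF der[OF \<mu>]]) (use z \<rho> in auto)
      moreover have "((\<lambda>t. \<Phi> \<sigma> \<mu> (z + t *\<^sub>R ?k)) has_real_derivative 0) (at 0)"
      proof (rule DERIV_cong_ev[THEN iffD2, OF refl _ refl])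
        have "open {t. norm (z + t *\<^sub>R ?k) < \<rho>}" by (intro open_Collect_less continuous_intros)
        then have "\<forall>\<^sub>F t in nhds 0. norm (z + t *\<^sub>R ?k) < \<rho>"
          unfolding eventually_nhds using z(1) by (intro exI[of _ "{t. norm (z + t *\<^sub>R ?k) < \<rho>}"]) simp
        then show "\<forall>\<^sub>F t in nhds 0. \<Phi> \<sigma> \<mu> (z + t *\<^sub>R ?k) = (\<lambda>t. 0) t"
          by eventually_elim (use flat z(3) in \<open>simp add: q.add q.scaleR\<close>)
      qed simp
      ultimately show ?thesis using DERIV_unique by fastforce
    qed
    finally show ?thesis .
  qed
  then have "N \<mu> (U \<mu> z) = 0" using critical[OF \<mu> _ \<sigma>] z \<rho> by simp
  moreover have "U \<mu> z \<noteq> 0" using U0[OF \<mu> _ _ z(3)] z \<rho> by auto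
  moreover have "norm (U \<mu> z) < e0" using U(3)[OF \<mu>, of z] z \<rho> \<delta> by simp
  ultimately show False using iso_\<mu> unfolding isolated_def small_solution_def by blast
qed

end

section \<open>Antiperiodic functions and the integrated delay operator\<close>

text \<open>
  Continuous functions with \<open>x (t + 3) = - x t\<close>, the time being measured in units of the delay. They
  form a closed subspace of the bounded continuous functions, hence a Banach space for the supremum norm.
\<close>

typedef (overloaded) 'a antiperiodic =
  "{f :: real \<Rightarrow>\<^sub>C 'a::real_normed_vector. \<forall>t. apply_bcontfun f (t + 3) = - apply_bcontfun f t}"
  morphisms bcf Antiperiodic
  by (rule exI[of _ 0]) simp

definition ap :: "'a::real_normed_vector antiperiodic \<Rightarrow> real \<Rightarrow> 'a" where "ap f = apply_bcontfun (bcf f)"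

lemma ap_shift: "ap f (t + 3) = - ap f t"
  using bcf[of f] by (simp add: ap_def)

lemma ap_shift_diff: "ap f (t - 3) = - ap f t"
  using ap_shift[of f "t - 3"] by simp

lemma continuous_on_ap [continuous_intros]: "continuous_on S (ap f)"
  unfolding ap_def by simp

lemma continuous_on_ap_compose [continuous_intros]:
  "continuous_on S g \<Longrightarrow> continuous_on S (\<lambda>t. ap f (g t))"
  by (rule continuous_on_compose2[OF continuous_on_ap[of UNIV]]) auto

lemma ap_eqI: "(\<And>t. ap f t = ap g t) \<Longrightarrow> f = g"
  by (metis ap_def bcf_inject bcontfun_eqI)

instantiation antiperiodic :: (real_normed_vector) real_normed_vector
begin

definition zero_antiperiodic :: "'a antiperiodic" where "0 = Antiperiodic 0"
definition plus_antiperiodic :: "'a antiperiodic \<Rightarrow> 'a antiperiodic \<Rightarrow> 'a antiperiodic" where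
  "f + g = Antiperiodic (bcf f + bcf g)"
definition minus_antiperiodic :: "'a antiperiodic \<Rightarrow> 'a antiperiodic \<Rightarrow> 'a antiperiodic" where
  "f - g = Antiperiodic (bcf f - bcf g)"
definition uminus_antiperiodic :: "'a antiperiodic \<Rightarrow> 'a antiperiodic" where "- f = Antiperiodic (- bcf f)"
definition scaleR_antiperiodic :: "real \<Rightarrow> 'a antiperiodic \<Rightarrow> 'a antiperiodic" where
  "scaleR_antiperiodic a f = Antiperiodic (a *\<^sub>R bcf f)"
definition norm_antiperiodic :: "'a antiperiodic \<Rightarrow> real" where "norm_antiperiodic f = norm (bcf f)"
definition dist_antiperiodic :: "'a antiperiodic \<Rightarrow> 'a antiperiodic \<Rightarrow> real" where "dist_antiperiodic f g = norm (f - g)"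
definition sgn_antiperiodic :: "'a antiperiodic \<Rightarrow> 'a antiperiodic" where "sgn_antiperiodic f = scaleR (inverse (norm f)) f"
definition uniformity_antiperiodic :: "('a antiperiodic \<times> 'a antiperiodic) filter" where
  "uniformity_antiperiodic = (INF e\<in>{0<..}. principal {(x, y). dist x y < e})"
definition open_antiperiodic :: "'a antiperiodic set \<Rightarrow> bool" where
  "open_antiperiodic U \<longleftrightarrow> (\<forall>x\<in>U. \<forall>\<^sub>F (x', y) in uniformity. x' = x \<longrightarrow> y \<in> U)"

lemma bcf_zero: "bcf 0 = 0" unfolding zero_antiperiodic_def by (rule Antiperiodic_inverse) simp
lemma bcf_plus: "bcf (f + g) = bcf f + bcf g" unfolding plus_antiperiodic_def
  by (rule Antiperiodic_inverse) (use bcf[of f] bcf[of g] in simp)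
lemma bcf_minus: "bcf (f - g) = bcf f - bcf g" unfolding minus_antiperiodic_def
  by (rule Antiperiodic_inverse) (use bcf[of f] bcf[of g] in simp)
lemma bcf_uminus: "bcf (- f) = - bcf f" unfolding uminus_antiperiodic_def
  by (rule Antiperiodic_inverse) (use bcf[of f] in simp)
lemma bcf_scaleR: "bcf (a *\<^sub>R f) = a *\<^sub>R bcf f" unfolding scaleR_antiperiodic_def
  by (rule Antiperiodic_inverse) (use bcf[of f] in simp)

lemmas bcf_simps = bcf_zero bcf_plus bcf_minus bcf_uminus bcf_scaleR

instance
proof
  fix f g h :: "'a antiperiodic" and a b :: real
  show "f + g + h = f + (g + h)" "f + g = g + f" "0 + f = f" "- f + f = 0" "f - g = f + - g"
    "a *\<^sub>R (f + g) = a *\<^sub>R f + a *\<^sub>R g" "(a + b) *\<^sub>R f = a *\<^sub>R f + b *\<^sub>R f"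
    "a *\<^sub>R b *\<^sub>R f = (a * b) *\<^sub>R f" "1 *\<^sub>R f = f"
    by (simp_all add: bcf_inject[symmetric] bcf_simps algebra_simps)
  show "dist f g = norm (f - g)" by (rule dist_antiperiodic_def)
  show "sgn f = scaleR (inverse (norm f)) f" by (rule sgn_antiperiodic_def)
  show "uniformity = (INF e\<in>{0<..}. principal {(x :: 'a antiperiodic, y). dist x y < e})"
    by (rule uniformity_antiperiodic_def)
  show "open U \<longleftrightarrow> (\<forall>x\<in>U. \<forall>\<^sub>F (x', y) in uniformity. x' = x \<longrightarrow> y \<in> U)" for U :: "'a antiperiodic set"
    by (rule open_antiperiodic_def)
  show "norm f = 0 \<longleftrightarrow> f = 0" "norm (f + g) \<le> norm f + norm g" "norm (a *\<^sub>R f) = \<bar>a\<bar> * norm f"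
    by (simp_all add: norm_antiperiodic_def bcf_simps norm_triangle_ineq bcf_inject[symmetric])
qed

end

lemma ap_simps [simp]:
  "ap 0 t = 0" "ap (f + g) t = ap f t + ap g t" "ap (f - g) t = ap f t - ap g t"
  "ap (- f) t = - ap f t" "ap (a *\<^sub>R f) t = a *\<^sub>R ap f t"
  by (simp_all add: ap_def bcf_simps)

lemma norm_ap_le: "norm (ap f t) \<le> norm f"
  unfolding ap_def norm_antiperiodic_def by (rule norm_bounded)

lemma norm_antiperiodic_le: "(\<And>t. norm (ap f t) \<le> b) \<Longrightarrow> norm f \<le> b"
  unfolding ap_def norm_antiperiodic_def by (rule norm_bound)

lemma antiperiodic_representative:
  fixes f :: "real \<Rightarrow> 'a::real_normed_vector"
  assumes f: "\<And>t. f (t + 3) = - f t"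
  obtains s where "0 \<le> s" "s < 3" "f t = f s \<or> f t = - f s"
proof -
  have nat: "f (s + 3 * real n) = f s \<or> f (s + 3 * real n) = - f s" for s n
  proof (induction n)
    case (Suc n)
    have "f (s + 3 * real (Suc n)) = - f (s + 3 * real n)" using f[of "s + 3 * real n"] by (simp add: algebra_simps)
    then show ?case using Suc by auto
  qed simp
  define s where "s = t - 3 * of_int \<lfloor>t / 3\<rfloor>"
  have "0 \<le> s" "s < 3" unfolding s_def by linarith+
  moreover have "f t = f s \<or> f t = - f s"
  proof (cases "\<lfloor>t / 3\<rfloor> \<ge> 0")
    case True
    then have "t = s + 3 * real (nat \<lfloor>t / 3\<rfloor>)" by (simp add: s_def)
    then show ?thesis using nat[of s "nat \<lfloor>t / 3\<rfloor>"] by metis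
  next
    case False
    then have "s = t + 3 * real (nat (- \<lfloor>t / 3\<rfloor>))" by (simp add: s_def)
    then show ?thesis using nat[of t "nat (- \<lfloor>t / 3\<rfloor>)"] by (metis minus_minus)
  qed
  ultimately show thesis by (rule that)
qed

lemma ap_representative:
  obtains s where "0 \<le> s" "s < 3" "ap f t = ap f s \<or> ap f t = - ap f s"
  using antiperiodic_representative[of "ap f" t, OF ap_shift] .

lemma norm_antiperiodic_le_period: 
  assumes "\<And>t. 0 \<le> t \<Longrightarrow> t \<le> 3 \<Longrightarrow> norm (ap f t) \<le> b" shows "norm f \<le> b"
proof (rule norm_antiperiodic_le)
  fix t obtain s where "0 \<le> s" "s < 3" "ap f t = ap f s \<or> ap f t = - ap f s"
    using ap_representative by blast
  then show "norm (ap f t) \<le> b" using assms[of s] by auto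
qed

instance antiperiodic :: (banach) banach
proof
  fix X :: "nat \<Rightarrow> 'a antiperiodic" assume X: "Cauchy X"
  have dist: "dist f g = dist (bcf f) (bcf g)" for f g :: "'a antiperiodic"
    by (simp add: dist_norm norm_antiperiodic_def bcf_minus)
  have "Cauchy (\<lambda>n. bcf (X n))" using X unfolding Cauchy_def dist .
  then obtain L where L: "(\<lambda>n. bcf (X n)) \<longlonglongrightarrow> L" using Cauchy_convergent convergent_def by blast
  have pt: "(\<lambda>n. ap (X n) t) \<longlonglongrightarrow> apply_bcontfun L t" for t
  proof (rule metric_tendsto_imp_tendsto[OF L])
    show "\<forall>\<^sub>F n in sequentially. dist (ap (X n) t) (apply_bcontfun L t) \<le> dist (bcf (X n)) L"
      unfolding ap_def by (intro always_eventually allI dist_bounded)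
  qed
  have "apply_bcontfun L (t + 3) = - apply_bcontfun L t" for t
    using LIMSEQ_unique[OF pt[of "t + 3"]] tendsto_minus[OF pt[of t]] by (simp add: ap_shift)
  then have "bcf (Antiperiodic L) = L" by (intro Antiperiodic_inverse) simp
  then have "X \<longlonglongrightarrow> Antiperiodic L" using L by (simp add: tendsto_iff dist)
  then show "convergent X" by (auto simp: convergent_def)
qed

definition of_fun :: "(real \<Rightarrow> 'a::real_normed_vector) \<Rightarrow> 'a antiperiodic" where "of_fun g = Antiperiodic (Bcontfun g)"

lemma ap_of_fun:
  assumes c: "continuous_on UNIV g" and a: "\<And>t. g (t + 3) = - g t"
  shows "ap (of_fun g) = g"
proof -
  have "compact (g ` {0..3})" using c by (intro compact_continuous_image) (auto intro: continuous_on_subset)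
  then obtain b where b: "\<And>t. t \<in> {0..3} \<Longrightarrow> norm (g t) \<le> b"
    using compact_imp_bounded bounded_iff by (metis imageI)
  have "norm (g t) \<le> b" for t
  proof -
    obtain s where "0 \<le> s" "s < 3" "g t = g s \<or> g t = - g s"
      using antiperiodic_representative[of g t, OF a] by blast
    then show ?thesis using b[of s] by auto
  qed
  then have "g \<in> bcontfun" using c by (rule bcontfun_normI[rotated])
  then have g: "apply_bcontfun (Bcontfun g) = g" by (rule Bcontfun_inverse)
  then have "bcf (Antiperiodic (Bcontfun g)) = Bcontfun g" by (intro Antiperiodic_inverse) (simp add: a)
  then show ?thesis by (simp add: ap_def of_fun_def g)
qed

lemma window_integral_derivative:
  fixes g :: "real \<Rightarrow> 'a::euclidean_space"
  assumes g: "continuous_on UNIV g" and "a \<le> b"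
  shows "((\<lambda>t. integral {t + a..t + b} g) has_vector_derivative g (t + b) - g (t + a)) (at t)"
proof -
  define l where "l = t + a - 1"
  define u where "u = t + b + 1"
  define G where "G x = integral {l..x} g" for x
  have gS: "continuous_on S g" for S using g continuous_on_subset by blast
  have G: "(G has_vector_derivative g x) (at x)" if "l < x" "x < u" for x
  proof -
    have "(G has_vector_derivative g x) (at x within {l..u})"
      unfolding G_def using that by (intro integral_has_vector_derivative gS) auto
    moreover have "at x within {l..u} = at x" by (rule at_within_interior) (use that in simp)
    ultimately show ?thesis by simp
  qed
  have shift: "((\<lambda>s. G (s + c)) has_vector_derivative g (t + c)) (at t)" if "l < t + c" "t + c < u" for c
  proof -
    have "((\<lambda>s. s + c) has_vector_derivative 1) (at t)" by (auto intro!: derivative_eq_intros)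
    from vector_diff_chain_at[OF this, of G "g (t + c)"] G[OF that] show ?thesis by (simp add: o_def)
  qed
  have "((\<lambda>s. G (s + b) - G (s + a)) has_vector_derivative g (t + b) - g (t + a)) (at t)"
    using assms by (intro has_vector_derivative_diff shift) (auto simp: l_def u_def)
  then show ?thesis
  proof (rule has_vector_derivative_transform_within_open[where S = "{t - 1<..<t + 1}"])
    fix s assume "s \<in> {t - 1<..<t + 1}"
    then have "l \<le> s + a" "s + a \<le> s + b" using assms by (auto simp: l_def)
    then have "integral {l..s + a} g + integral {s + a..s + b} g = integral {l..s + b} g"
      by (intro Henstock_Kurzweil_Integration.integral_combine integrable_continuous_real gS) auto
    then show "G (s + b) - G (s + a) = integral {s + a..s + b} g" by (simp add: G_def algebra_simps)
  qed auto
qed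

lemma periodic_integral_shift:
  fixes w :: "real \<Rightarrow> real"
  assumes c: "continuous_on UNIV w" and p: "\<And>t. w (t + 3) = w t"
  shows "integral {0..3} (\<lambda>t. w (t + r)) = integral {0..3} w"
proof -
  have "((\<lambda>t. integral {t + 0..t + 3} w) has_real_derivative 0) (at t)" for t
    using window_integral_derivative[OF c, of 0 3 t] p[of t] by (simp add: has_real_derivative_iff_has_vector_derivative)
  then have "integral {r + 0..r + 3} w = integral {0 + 0..0 + 3} w" by (rule DERIV_isconst_all[OF allI])
  moreover have "integral {0..3} (w \<circ> (\<lambda>x. x + r)) = integral {0 + r..3 + r} w"
    by (rule integral_shift) (rule continuous_on_subset[OF c], simp)
  ultimately show ?thesis by (simp add: o_def add.commute)
qed

text \<open>
  The operator that integrates the delay equation. If \<open>x' t = u (t - 1) + u (t - 2)\<close> with \<open>u\<close> antiperiodic,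
  then \<open>u (t - 2) = - u (t + 1)\<close>, so that minus the integral of \<open>u\<close> over \<open>{t - 1..t + 1}\<close> is a primitive; it is
  the only antiperiodic one. The window is symmetric about \<open>t\<close>, which makes the operator symmetric
  although the equation contains delays only.
\<close>

definition Cop :: "'a::euclidean_space antiperiodic \<Rightarrow> 'a antiperiodic" where
  "Cop u = of_fun (\<lambda>t. - integral {t - 1..t + 1} (ap u))"

lemma window_ap_derivative:
  fixes u :: "'a::euclidean_space antiperiodic"
  shows "((\<lambda>t. - integral {t - 1..t + 1} (ap u)) has_vector_derivative ap u (t - 1) + ap u (t - 2)) (at t)"
proof -
  have "((\<lambda>t. - integral {t + - 1..t + 1} (ap u)) has_vector_derivative - (ap u (t + 1) - ap u (t + - 1))) (at t)"
    by (intro has_vector_derivative_minus window_integral_derivative continuous_on_ap) simp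
  moreover have "ap u (t + 1) = - ap u (t - 2)" using ap_shift[of u "t - 2"] by (simp add: add.commute)
  ultimately show ?thesis by simp
qed

lemma ap_Cop: "ap (Cop u) t = - integral {t - 1..t + 1} (ap u)"
proof -
  have "ap (Cop u) = (\<lambda>t. - integral {t - 1..t + 1} (ap u))"
    unfolding Cop_def
  proof (rule ap_of_fun)
    show "continuous_on UNIV (\<lambda>t. - integral {t - 1..t + 1} (ap u))"
      by (intro continuous_at_imp_continuous_on ballI has_vector_derivative_continuous[OF window_ap_derivative])
    fix t
    have "integral {t - 1..t + 1} (ap u \<circ> (\<lambda>x. x + 3)) = integral {t - 1 + 3..t + 1 + 3} (ap u)"
      by (rule integral_shift) (rule continuous_on_ap)
    moreover have "ap u \<circ> (\<lambda>x. x + 3) = (\<lambda>x. - ap u x)" by (auto simp: ap_shift)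
    ultimately show "- integral {t + 3 - 1..t + 3 + 1} (ap u) = - (- integral {t - 1..t + 1} (ap u))"
      by (simp add: algebra_simps)
  qed
  then show ?thesis by simp
qed

lemma Cop_derivative: "(ap (Cop u) has_vector_derivative ap u (t - 1) + ap u (t - 2)) (at t)"
  using window_ap_derivative[of u t] unfolding ap_Cop[abs_def] .

lemma antiperiodic_primitive_unique:
  assumes d: "\<And>t. (ap x has_vector_derivative ap u (t - 1) + ap u (t - 2)) (at t)"
  shows "x = Cop u"
proof -
  have "ap (x - Cop u) = (\<lambda>t. ap x t - ap (Cop u) t)" by (simp add: fun_eq_iff)
  then have z: "(ap (x - Cop u) has_vector_derivative 0) (at t)" for t
    using has_vector_derivative_diff[OF d Cop_derivative[of u]] by simp
  obtain c where "\<And>t. t \<in> UNIV \<Longrightarrow> ap (x - Cop u) t = c"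
    by (rule has_vector_derivative_zero_constant[of UNIV "ap (x - Cop u)"]) (use z in auto)
  then have c: "ap (x - Cop u) t = c" for t by blast
  have "c = - c" using ap_shift[of "x - Cop u" 0] unfolding c .
  then have "c = 0" by (simp add: eq_neg_iff_add_eq_0 flip: scaleR_2)
  then have "x - Cop u = 0" using c by (intro ap_eqI) simp
  then show ?thesis by simp
qed

lemma Cop_add: "Cop (u + v) = Cop u + Cop v"
proof (rule antiperiodic_primitive_unique[symmetric])
  fix t
  have "ap (Cop u + Cop v) = (\<lambda>t. ap (Cop u) t + ap (Cop v) t)" by (simp add: fun_eq_iff)
  then show "(ap (Cop u + Cop v) has_vector_derivative ap (u + v) (t - 1) + ap (u + v) (t - 2)) (at t)"
    using has_vector_derivative_add[OF Cop_derivative[of u] Cop_derivative[of v], of t] by (simp add: algebra_simps)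
qed

lemma Cop_linear_image:
  fixes B :: "'a::euclidean_space \<Rightarrow> 'b::euclidean_space"
  assumes B: "bounded_linear B" and u: "\<And>t. ap u' t = B (ap u t)" and y: "\<And>t. ap y t = B (ap (Cop u) t)"
  shows "Cop u' = y"
proof (rule antiperiodic_primitive_unique[symmetric])
  fix t
  have "ap y = (\<lambda>t. B (ap (Cop u) t))" by (simp add: fun_eq_iff y)
  then show "(ap y has_vector_derivative ap u' (t - 1) + ap u' (t - 2)) (at t)"
    using bounded_linear.has_vector_derivative[OF B Cop_derivative[of u t]]
    by (simp add: u linear_add[OF bounded_linear.linear[OF B]])
qed

lemma Cop_scaleR: "Cop (a *\<^sub>R u) = a *\<^sub>R Cop u"
  by (rule Cop_linear_image[OF bounded_linear_scaleR_right[of a]]) auto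

lemma norm_ap_Cop: "norm (ap (Cop u) t) \<le> 2 * norm u"
proof -
  have "norm (integral {t - 1..t + 1} (ap u)) \<le> norm u * (t + 1 - (t - 1))"
    by (rule integral_bound) (auto simp: norm_ap_le intro: continuous_on_ap)
  then show ?thesis by (simp add: ap_Cop)
qed

lemma norm_Cop: "norm (Cop u) \<le> 2 * norm u"
  by (rule norm_antiperiodic_le) (rule norm_ap_Cop)

lemma bounded_linear_Cop: "bounded_linear (Cop :: 'a::euclidean_space antiperiodic \<Rightarrow> _)"
proof (rule bounded_linear_intro[where K = 2])
  show "norm (Cop u) \<le> norm u * 2" for u :: "'a antiperiodic" using norm_Cop[of u] by simp
qed (rule Cop_add Cop_scaleR)+

lemma Cop_lipschitz: "norm (ap (Cop u) s - ap (Cop u) t) \<le> 2 * norm u * \<bar>s - t\<bar>"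
proof -
  have "norm (ap (Cop u) s - ap (Cop u) t) \<le> (2 * norm u) * norm (s - t)"
  proof (rule differentiable_bound[where S = UNIV and f' = "\<lambda>t h. h *\<^sub>R (ap u (t - 1) + ap u (t - 2))"])
    fix x :: real
    show "(ap (Cop u) has_derivative (\<lambda>h. h *\<^sub>R (ap u (x - 1) + ap u (x - 2)))) (at x within UNIV)"
      using Cop_derivative[of u x] by (simp add: has_vector_derivative_def)
    have "norm (ap u (x - 1) + ap u (x - 2)) \<le> 2 * norm u"
      using norm_triangle_ineq[of "ap u (x - 1)" "ap u (x - 2)"] norm_ap_le[of u "x - 1"] norm_ap_le[of u "x - 2"] by linarith
    then show "onorm (\<lambda>h. h *\<^sub>R (ap u (x - 1) + ap u (x - 2))) \<le> 2 * norm u"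
      by (intro onorm_bound) (auto simp: mult.commute mult_left_mono)
  qed auto
  then show ?thesis by simp
qed

text \<open>
  The functions \<open>Cop u\<close> with \<open>norm u\<close> bounded are equi-Lipschitz, so Arzela-Ascoli applies on one period.
\<close>

lemma compact_operator_Cop: "compact_operator (Cop :: 'a::euclidean_space antiperiodic \<Rightarrow> _)"
  unfolding compact_operator_def
proof (intro conjI allI impI bounded_linear_Cop)
  fix x :: "nat \<Rightarrow> 'a antiperiodic" assume "bounded (range x)"
  then obtain b where b: "b > 0" "\<And>n. norm (x n) \<le> b" unfolding bounded_pos by auto
  define F where "F n t = ap (Cop (x n)) t" for n t
  obtain g k where k: "strict_mono (k :: nat \<Rightarrow> nat)"
    "\<And>e. 0 < e \<Longrightarrow> \<exists>N. \<forall>n t. n \<ge> N \<and> t \<in> {0..3} \<longrightarrow> norm (F (k n) t - g t) < e"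
  proof (rule Arzela_Ascoli[of "{0..3::real}" F "2 * b"])
    show "norm (F n t) \<le> 2 * b" for n t
      unfolding F_def using norm_ap_Cop[of "x n" t] b(2)[of n] by linarith
    show "\<exists>d>0. \<forall>n s. s \<in> {0..3} \<and> norm (t - s) < d \<longrightarrow> norm (F n t - F n s) < e" if "e > 0" for t e :: real
    proof (intro exI[of _ "e / (2 * b)"] conjI allI impI)
      show "e / (2 * b) > 0" using that b by simp
      fix n s assume "s \<in> {0..3} \<and> norm (t - s) < e / (2 * b)"
      then have ts: "2 * b * \<bar>t - s\<bar> < e" using b by (simp add: field_simps)
      have "norm (F n t - F n s) \<le> 2 * norm (x n) * \<bar>t - s\<bar>" unfolding F_def by (rule Cop_lipschitz)
      also have "\<dots> \<le> 2 * b * \<bar>t - s\<bar>" using b(2)[of n] by (intro mult_right_mono) auto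
      finally show "norm (F n t - F n s) < e" using ts by simp
    qed
  qed auto
  have "Cauchy (\<lambda>n. Cop (x (k n)))"
  proof (rule CauchyI)
    fix e :: real assume "e > 0"
    then obtain N where N: "\<And>n t. n \<ge> N \<Longrightarrow> t \<in> {0..3} \<Longrightarrow> norm (F (k n) t - g t) < e / 4" using k(2)[of "e / 4"] by auto
    have "norm (Cop (x (k m)) - Cop (x (k n))) < e" if "m \<ge> N" "n \<ge> N" for m n
    proof -
      have "norm (Cop (x (k m)) - Cop (x (k n))) \<le> e / 2"
      proof (rule norm_antiperiodic_le_period)
        fix t :: real assume t: "0 \<le> t" "t \<le> 3"
        have "F (k m) t - F (k n) t = (F (k m) t - g t) - (F (k n) t - g t)" by simp
        then have "norm (F (k m) t - F (k n) t) \<le> norm (F (k m) t - g t) + norm (F (k n) t - g t)"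
          using norm_triangle_ineq4 by metis
        also have "\<dots> \<le> e / 2" using N[of m t] N[of n t] that t by simp
        finally show "norm (ap (Cop (x (k m)) - Cop (x (k n))) t) \<le> e / 2" by (simp add: F_def)
      qed
      then show ?thesis using \<open>e > 0\<close> by simp
    qed
    then show "\<exists>M. \<forall>m\<ge>M. \<forall>n\<ge>M. norm (Cop (x (k m)) - Cop (x (k n))) < e" by blast
  qed
  then show "\<exists>r l. strict_mono r \<and> (\<lambda>n. Cop (x (r n))) \<longlonglongrightarrow> l"
    using k(1) Cauchy_convergent convergent_def by blast
qed

definition ipa :: "'a::euclidean_space antiperiodic \<Rightarrow> 'a antiperiodic \<Rightarrow> real" where
  "ipa u v = integral {0..3} (\<lambda>t. ap u t \<bullet> ap v t)"

lemma integrable_ip: "(\<lambda>t. ap u t \<bullet> ap v t) integrable_on {a..b}"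
  by (intro integrable_continuous_real continuous_intros)

lemma ipa_commute: "ipa u v = ipa v u" by (simp add: ipa_def inner_commute)

lemma bounded_bilinear_ipa: "bounded_bilinear (ipa :: 'a::euclidean_space antiperiodic \<Rightarrow> _)"
proof
  fix u v w :: "'a antiperiodic" and c :: real
  show add: "ipa (u + v) w = ipa u w + ipa v w" for u v w :: "'a antiperiodic"
    by (simp add: ipa_def inner_add_left integral_add integrable_ip)
  show sc: "ipa (c *\<^sub>R u) v = c *\<^sub>R ipa u v" for u v :: "'a antiperiodic"
    by (simp add: ipa_def)
  show "ipa u (v + w) = ipa u v + ipa u w" using add[of v w u] by (simp add: ipa_commute)
  show "ipa u (c *\<^sub>R v) = c *\<^sub>R ipa u v" using sc[of v u] by (simp add: ipa_commute)
  have "norm (ipa u v) \<le> norm u * norm v * 3" for u v :: "'a antiperiodic"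
  proof -
    have "norm (ipa u v) \<le> (norm u * norm v) * (3 - 0)"
      unfolding ipa_def
    proof (rule integral_bound)
      fix t :: real
      have "norm (ap u t \<bullet> ap v t) \<le> norm (ap u t) * norm (ap v t)" by (simp add: Cauchy_Schwarz_ineq2)
      also have "\<dots> \<le> norm u * norm v" by (intro mult_mono norm_ap_le) auto
      finally show "norm (ap u t \<bullet> ap v t) \<le> norm u * norm v" .
    qed (auto intro!: continuous_intros)
    then show ?thesis by simp
  qed
  then show "\<exists>K. \<forall>u v. norm (ipa u v) \<le> norm (u :: 'a antiperiodic) * norm v * K" by blast
qed

lemma integral_density_pos:
  fixes x :: "'a::euclidean_space antiperiodic" and Q :: "'a \<Rightarrow> real"
  assumes "continuous_on UNIV Q" "\<And>v. v \<noteq> 0 \<Longrightarrow> Q v > 0" "Q 0 = 0" "x \<noteq> 0"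
  shows "integral {0..3} (\<lambda>t. Q (ap x t)) > 0"
proof -
  have c: "continuous_on {0..3} (\<lambda>t. Q (ap x t))"
    by (rule continuous_on_compose2[OF assms(1)]) (auto intro: continuous_on_ap)
  have nn: "Q v \<ge> 0" for v using assms(2,3) by (cases "v = 0") (auto intro: less_imp_le)
  obtain t where "ap x t \<noteq> 0" using assms(4) ap_eqI[of x 0] by auto
  moreover obtain s where s: "0 \<le> s" "s < 3" "ap x t = ap x s \<or> ap x t = - ap x s" using ap_representative by blast
  ultimately have "Q (ap x s) \<noteq> 0" using assms(2)[of "ap x s"] by auto
  then have "integral {0..3} (\<lambda>t. Q (ap x t)) \<noteq> 0"
    using integral_eq_0_iff[OF c] nn s by force
  moreover have "integral {0..3} (\<lambda>t. Q (ap x t)) \<ge> 0"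
    by (rule integral_nonneg) (use c nn in \<open>auto intro: integrable_continuous_real\<close>)
  ultimately show ?thesis by simp
qed

lemma ipa_pos: "u \<noteq> 0 \<Longrightarrow> ipa u u > 0"
  unfolding ipa_def by (rule integral_density_pos[where Q = "\<lambda>v. v \<bullet> v"]) (auto intro!: continuous_intros)

text \<open>
  By Fubini's theorem the inner product is an integral over the offset \<open>r\<close> in \<open>{-1..1}\<close> of the correlations
  of \<open>u (t + r)\<close> with \<open>v t\<close>. A translation moves the offset to \<open>v\<close>, with the opposite sign, since the
  product of two antiperiodic functions is periodic.
\<close>

lemma Cop_symmetric: "ipa (Cop u) v = ipa u (Cop v)"
proof -
  have swap: "ipa (Cop u) v = - integral {-1..1} (\<lambda>r. integral {0..3} (\<lambda>t. ap u (t + r) \<bullet> ap v t))"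
    for u v :: "'a antiperiodic"
  proof -
    have "ap (Cop u) t \<bullet> ap v t = - integral {-1..1} (\<lambda>r. ap u (t + r) \<bullet> ap v t)" for t
    proof -
      have "integral {-1..1} (ap u \<circ> (\<lambda>r. r + t)) = integral {-1 + t..1 + t} (ap u)"
        by (rule integral_shift) (rule continuous_on_ap)
      moreover have "integral {-1..1} (\<lambda>r. ap u (t + r) \<bullet> ap v t) = integral {-1..1} (\<lambda>r. ap u (t + r)) \<bullet> ap v t"
        using integral_linear[OF _ bounded_linear_inner_left, of "\<lambda>r. ap u (t + r)" "{-1..1}" "ap v t"]
        by (simp add: o_def integrable_continuous_real continuous_intros)
      ultimately show ?thesis by (simp add: ap_Cop o_def add.commute)
    qed
    then have "ipa (Cop u) v = - integral {0..3} (\<lambda>t. integral {-1..1} (\<lambda>r. ap u (t + r) \<bullet> ap v t))"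
      by (simp add: ipa_def)
    also have "integral {0..3} (\<lambda>t. integral {-1..1} (\<lambda>r. ap u (t + r) \<bullet> ap v t))
        = integral {-1..1} (\<lambda>r. integral {0..3} (\<lambda>t. ap u (t + r) \<bullet> ap v t))"
      using integral_swap_continuous[of 0 "-1" 3 1 "\<lambda>t r. ap u (t + r) \<bullet> ap v t"]
      by (simp add: case_prod_unfold continuous_intros)
    finally show ?thesis .
  qed
  have shift: "integral {0..3} (\<lambda>t. ap u (t + r) \<bullet> ap v t) = integral {0..3} (\<lambda>t. ap v (t + - r) \<bullet> ap u t)" for r
  proof -
    let ?w = "\<lambda>t. ap u t \<bullet> ap v (t - r)"
    have "integral {0..3} (\<lambda>t. ?w (t + r)) = integral {0..3} ?w"
    proof (rule periodic_integral_shift)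
      show "continuous_on UNIV ?w" by (intro continuous_intros)
      fix t
      have "ap v (t + 3 - r) = - ap v (t - r)" using ap_shift[of v "t - r"] by (simp add: algebra_simps)
      then show "?w (t + 3) = ?w t" by (simp add: ap_shift)
    qed
    then show ?thesis by (simp add: inner_commute)
  qed
  have "ipa (Cop u) v = - integral {-1..1} (\<lambda>r. integral {0..3} (\<lambda>t. ap v (t + - r) \<bullet> ap u t))"
    unfolding swap shift ..
  also have "\<dots> = - integral {-1..1} (\<lambda>r. integral {0..3} (\<lambda>t. ap v (t + r) \<bullet> ap u t))"
    using Henstock_Kurzweil_Integration.integral_reflect_real[of 1 "-1" "\<lambda>r. integral {0..3} (\<lambda>t. ap v (t + r) \<bullet> ap u t)"] by simp
  also have "\<dots> = ipa (Cop v) u" by (rule swap[symmetric])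
  finally show ?thesis by (simp add: ipa_commute)
qed

definition nemytskii :: "('a::real_normed_vector \<Rightarrow> 'b::real_normed_vector) \<Rightarrow> 'a antiperiodic \<Rightarrow> 'b antiperiodic" where
  "nemytskii g u = of_fun (\<lambda>t. g (ap u t))"

lemma ap_nemytskii: "continuous_on UNIV g \<Longrightarrow> (\<And>x. g (- x) = - g x) \<Longrightarrow> ap (nemytskii g u) t = g (ap u t)"
  unfolding nemytskii_def
  by (subst ap_of_fun) (auto simp: ap_shift intro!: continuous_on_compose2[of UNIV g] continuous_on_ap)

section \<open>Gradients and Hessians of even functions\<close>

lemma gradient_works:
  fixes f :: "'a::euclidean_space \<Rightarrow> real"
  assumes "f differentiable (at x)"
  shows "(f has_derivative (\<lambda>h. gradient f x \<bullet> h)) (at x)"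
proof -
  obtain L where L: "(f has_derivative L) (at x)" using assms by (auto simp: differentiable_def)
  then have lin: "linear L" by (rule has_derivative_linear)
  define D where "D = (\<Sum>b\<in>Basis. L b *\<^sub>R b)"
  have "L h = h \<bullet> D" for h
  proof -
    have "L h = L (\<Sum>b\<in>Basis. (h \<bullet> b) *\<^sub>R b)" by (simp add: euclidean_representation)
    also have "\<dots> = (\<Sum>b\<in>Basis. (h \<bullet> b) * L b)" by (simp add: linear_sum[OF lin] linear_cmul[OF lin])
    finally show ?thesis by (simp add: D_def inner_sum_right mult.commute)
  qed
  then have "L = (\<lambda>h. h \<bullet> D)" by blast
  then have D: "GDERIV f x :> D" using L by (simp add: gderiv_def)
  have "gradient f x = D"
    unfolding gradient_def
  proof (rule the_equality[where P = "\<lambda>D. GDERIV f x :> D", OF D])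
    fix D' assume "GDERIV f x :> D'"
    then have "(\<lambda>h. h \<bullet> D') = (\<lambda>h. h \<bullet> D)" using D has_derivative_unique unfolding gderiv_def by blast
    then show "D' = D" by (metis inner_commute vector_eq_rdot)
  qed
  then show ?thesis using D by (simp add: gderiv_def inner_commute)
qed

lemma C2_derivatives:
  assumes "C2 f"
  shows C2_has_gradient: "(f has_derivative (\<lambda>h. gradient f x \<bullet> h)) (at x)"
    and C2_has_hessian: "(gradient f has_derivative (\<lambda>h. hessian f x *v h)) (at x)"
    and C2_continuous_gradient: "continuous_on S (gradient f)"
    and C2_continuous: "continuous_on S f"
proof -
  show f: "(f has_derivative (\<lambda>h. gradient f x \<bullet> h)) (at x)" for x
    using assms by (intro gradient_works) (simp add: C2_def)
  show g: "(gradient f has_derivative (\<lambda>h. hessian f x *v h)) (at x)" for x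
    using assms jacobian_works unfolding C2_def hessian_def by blast
  show "continuous_on S (gradient f)" by (intro continuous_at_imp_continuous_on ballI has_derivative_continuous[OF g])
  show "continuous_on S f" by (intro continuous_at_imp_continuous_on ballI has_derivative_continuous[OF f])
qed

lemma even_gradient_odd:
  fixes f :: "real^'n \<Rightarrow> real"
  assumes "C2 f" "even_function f"
  shows "gradient f (- x) = - gradient f x"
proof -
  have "((\<lambda>x. f (- x)) has_derivative (\<lambda>h. gradient f (- x) \<bullet> (- h))) (at x)"
    by (rule has_derivative_compose[OF _ C2_has_gradient[OF assms(1)]]) (auto intro!: derivative_eq_intros)
  then have "(f has_derivative (\<lambda>h. gradient f (- x) \<bullet> (- h))) (at x)"
    using assms(2) by (simp add: even_function_def)
  then have "(\<lambda>h. gradient f (- x) \<bullet> (- h)) = (\<lambda>h. gradient f x \<bullet> h)"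
    using C2_has_gradient[OF assms(1)] has_derivative_unique by blast
  then have "(- gradient f (- x)) \<bullet> h = gradient f x \<bullet> h" for h
    by (simp add: fun_eq_iff)
  then have "- gradient f (- x) = gradient f x" by (metis vector_eq_ldot inner_commute)
  then show ?thesis by (metis minus_minus)
qed

lemma even_gradient_zero:
  fixes f :: "real^'n \<Rightarrow> real"
  assumes "C2 f" "even_function f"
  shows "gradient f 0 = 0"
  using even_gradient_odd[OF assms, of 0] by (simp add: eq_neg_iff_add_eq_0 flip: scaleR_2)

lemma matrix_vector_norm_bound:
  obtains c where "c > 0" "\<And>(A :: real^'n^'m) x. norm (A *v x) \<le> c * norm A * norm x"
proof -
  have "bilinear (\<lambda>(A :: real^'n^'m) x. A *v x)"
    unfolding bilinear_def
    by (auto intro!: linearI simp: matrix_vector_mult_add_rdistrib matrix_vector_right_distrib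
        scaleR_matrix_vector_assoc[symmetric] matrix_vector_mult_scaleR)
  then show thesis using bilinear_bounded_pos that by metis
qed

lemma gradient_strictly_differentiable:
  fixes f :: "real^'n \<Rightarrow> real"
  assumes f: "C2 f" and e: "\<epsilon> > 0"
  obtains \<delta> where "\<delta> > 0" "\<And>x y. norm x < \<delta> \<Longrightarrow> norm y < \<delta> \<Longrightarrow>
      norm (gradient f x - gradient f y - hessian f 0 *v (x - y)) \<le> \<epsilon> * norm (x - y)"
proof -
  obtain c where c: "c > 0" "\<And>(A :: real^'n^'n) x. norm (A *v x) \<le> c * norm A * norm x"
    using matrix_vector_norm_bound by blast
  have "isCont (hessian f) 0" using f by (simp add: C2_def continuous_on_eq_continuous_at)
  then obtain \<delta> where \<delta>: "\<delta> > 0" "\<And>x. dist x 0 < \<delta> \<Longrightarrow> dist (hessian f x) (hessian f 0) < \<epsilon> / c"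
    unfolding continuous_at_eps_delta using e c by (metis divide_pos_pos)
  show thesis
  proof (rule that[OF \<delta>(1)])
    fix x y :: "real^'n" assume xy: "norm x < \<delta>" "norm y < \<delta>"
    define k where "k x = gradient f x - hessian f 0 *v x" for x
    have "norm (k x - k y) \<le> \<epsilon> * norm (x - y)"
    proof (rule differentiable_bound[where S = "ball 0 \<delta>" and f' = "\<lambda>x h. (hessian f x - hessian f 0) *v h"])
      fix z :: "real^'n" assume z: "z \<in> ball 0 \<delta>"
      have "(k has_derivative (\<lambda>h. hessian f z *v h - hessian f 0 *v h)) (at z)"
        unfolding k_def
        by (intro has_derivative_diff C2_has_hessian[OF f] bounded_linear_imp_has_derivative matrix_vector_mul_bounded_linear)
      then show "(k has_derivative (\<lambda>h. (hessian f z - hessian f 0) *v h)) (at z within ball 0 \<delta>)"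
        by (simp add: matrix_vector_mult_diff_rdistrib has_derivative_at_withinI)
      show "onorm (\<lambda>h. (hessian f z - hessian f 0) *v h) \<le> \<epsilon>"
      proof (rule onorm_bound)
        fix h :: "real^'n"
        have "c * norm (hessian f z - hessian f 0) \<le> \<epsilon>"
          using \<delta>(2)[of z] z c(1) by (simp add: dist_norm field_simps less_imp_le)
        then have "c * norm (hessian f z - hessian f 0) * norm h \<le> \<epsilon> * norm h" by (intro mult_right_mono) auto
        then show "norm ((hessian f z - hessian f 0) *v h) \<le> \<epsilon> * norm h"
          using c(2)[of "hessian f z - hessian f 0" h] by linarith
      qed (use e in simp)
    qed (use xy in auto)
    then show "norm (gradient f x - gradient f y - hessian f 0 *v (x - y)) \<le> \<epsilon> * norm (x - y)"
      by (simp add: k_def matrix_vector_mult_diff_distrib algebra_simps)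
  qed
qed

text \<open>
  The second difference \<open>\<Delta>\<close> is symmetric in \<open>a\<close> and \<open>b\<close>. The mean value theorem in direction \<open>b\<close> turns it into
  a difference of gradients, and strict differentiability of the gradient gives its leading term.
\<close>

lemma hessian_symmetric:
  fixes f :: "real^'n \<Rightarrow> real"
  assumes f: "C2 f"
  shows "a \<bullet> (hessian f 0 *v b) = (hessian f 0 *v a) \<bullet> b"
proof -
  define g where "g = gradient f"
  define H where "H = hessian f 0"
  define \<Delta> where "\<Delta> a b h = f (h *\<^sub>R a + h *\<^sub>R b) - f (h *\<^sub>R a) - f (h *\<^sub>R b) + f 0" for a b and h :: real
  have lim: "((\<lambda>h. \<Delta> a b h / h\<^sup>2) \<longlongrightarrow> (H *v a) \<bullet> b) (at_right 0)" for a b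
  proof (rule tendstoI)
    fix e :: real assume e: "e > 0"
    define p where "p = (norm a + 1) * (norm b + 1)"
    have p: "p > 0" unfolding p_def by (intro mult_pos_pos) (auto intro: add_nonneg_pos)
    define \<epsilon> where "\<epsilon> = e / (2 * p)"
    have \<epsilon>: "\<epsilon> > 0" "\<epsilon> * p = e / 2" using e p by (auto simp: \<epsilon>_def)
    obtain \<delta> where \<delta>: "\<delta> > 0" "\<And>x y. norm x < \<delta> \<Longrightarrow> norm y < \<delta> \<Longrightarrow> norm (g x - g y - H *v (x - y)) \<le> \<epsilon> * norm (x - y)"
      using gradient_strictly_differentiable[OF f \<epsilon>(1)] unfolding g_def H_def by blast
    define d where "d = \<delta> / (norm a + norm b + 1)"
    have d: "d > 0" using \<delta> by (simp add: d_def add_nonneg_pos)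
    have "dist (\<Delta> a b h / h\<^sup>2) ((H *v a) \<bullet> b) < e" if h: "0 < h" "h < d" for h
    proof -
      define \<psi> where "\<psi> s = f (h *\<^sub>R a + s *\<^sub>R (h *\<^sub>R b)) - f (0 + s *\<^sub>R (h *\<^sub>R b))" for s :: real
      have dl: "((\<lambda>s. f (x + s *\<^sub>R v)) has_real_derivative g (x + s *\<^sub>R v) \<bullet> v) (at s)" for x v s
      proof -
        have "((\<lambda>s. f (x + s *\<^sub>R v)) has_derivative (\<lambda>t. gradient f (x + s *\<^sub>R v) \<bullet> (t *\<^sub>R v))) (at s)"
          by (rule has_derivative_compose[OF _ C2_has_gradient[OF f]]) (auto intro!: derivative_eq_intros)
        then show ?thesis
          by (rule has_derivative_imp_has_field_derivative) (simp add: g_def mult.commute)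
      qed
      define \<psi>' where "\<psi>' s = g (h *\<^sub>R a + s *\<^sub>R (h *\<^sub>R b)) \<bullet> (h *\<^sub>R b) - g (0 + s *\<^sub>R (h *\<^sub>R b)) \<bullet> (h *\<^sub>R b)" for s
      have d\<psi>: "(\<psi> has_real_derivative \<psi>' s) (at s)" for s
        unfolding \<psi>_def \<psi>'_def by (intro DERIV_diff dl)
      obtain s where s: "0 < s" "s < 1" "\<psi> 1 - \<psi> 0 = (1 - 0) * \<psi>' s"
        using MVT2[of 0 1 \<psi> \<psi>', OF zero_less_one d\<psi>] by blast
      let ?x = "h *\<^sub>R a + s *\<^sub>R (h *\<^sub>R b)" and ?y = "s *\<^sub>R (h *\<^sub>R b)"
      have "\<Delta> a b h = \<psi> 1 - \<psi> 0" by (simp add: \<Delta>_def \<psi>_def)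
      then have D: "\<Delta> a b h = h * ((g ?x - g ?y) \<bullet> b)" using s(3) by (simp add: \<psi>'_def inner_diff_left algebra_simps)
      have hd: "h * (norm a + norm b + 1) < \<delta>" using h(2) by (simp add: d_def pos_less_divide_eq add_nonneg_pos)
      have ny: "norm ?y \<le> h * norm b" using s h by (simp add: mult_left_le_one_le)
      have nx: "norm ?x \<le> h * norm a + h * norm b" using norm_triangle_ineq[of "h *\<^sub>R a" ?y] ny h by simp
      have "norm (g ?x - g ?y - H *v (?x - ?y)) \<le> \<epsilon> * norm (?x - ?y)"
        by (rule \<delta>(2)) (use nx ny hd h in \<open>auto simp: algebra_simps intro: le_less_trans\<close>, smt (verit) mult_nonneg_nonneg norm_ge_zero)
      then have n: "norm (g ?x - g ?y - h *\<^sub>R (H *v a)) \<le> \<epsilon> * (h * norm a)"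
        using h by (simp add: matrix_vector_mult_scaleR)
      have "\<bar>(g ?x - g ?y - h *\<^sub>R (H *v a)) \<bullet> b\<bar> \<le> norm (g ?x - g ?y - h *\<^sub>R (H *v a)) * norm b"
        by (rule Cauchy_Schwarz_ineq2)
      also have "\<dots> \<le> \<epsilon> * (h * norm a) * norm b" using n by (intro mult_right_mono) auto
      also have "\<dots> = h * (\<epsilon> * (norm a * norm b))" by simp
      also have "\<dots> \<le> h * (\<epsilon> * ((norm a + 1) * (norm b + 1)))"
        using h \<epsilon> by (intro mult_left_mono mult_mono) auto
      also have "\<dots> = e / 2 * h" by (simp only: p_def[symmetric] \<epsilon>(2) mult.commute)
      finally have "\<bar>(g ?x - g ?y) \<bullet> b - h * ((H *v a) \<bullet> b)\<bar> \<le> e / 2 * h" by (simp add: inner_diff_left)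
      moreover have "\<Delta> a b h / h\<^sup>2 - (H *v a) \<bullet> b = ((g ?x - g ?y) \<bullet> b - h * ((H *v a) \<bullet> b)) / h"
        using h by (simp add: D power2_eq_square field_simps)
      ultimately have "\<bar>\<Delta> a b h / h\<^sup>2 - (H *v a) \<bullet> b\<bar> \<le> e / 2"
        using h(1) by (simp only: abs_divide abs_of_pos pos_divide_le_eq)
      then show ?thesis using e by (simp add: dist_real_def)
    qed
    then show "\<forall>\<^sub>F h in at_right 0. dist (\<Delta> a b h / h\<^sup>2) ((H *v a) \<bullet> b) < e"
      using d by (auto simp: eventually_at_right_field)
  qed
  have "\<Delta> a b h = \<Delta> b a h" for h by (simp add: \<Delta>_def add.commute)
  then have "(H *v a) \<bullet> b = (H *v b) \<bullet> a" using tendsto_unique[OF _ lim[of a b]] lim[of b a] by simp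
  then show ?thesis by (simp add: H_def inner_commute)
qed

section \<open>The delay problem as a Hammerstein equation\<close>

lemma compact_operator_compose:
  fixes T :: "'a::real_normed_vector \<Rightarrow> 'b::real_normed_vector" and B :: "'b \<Rightarrow> 'c::real_normed_vector"
  assumes B: "bounded_linear B" and T: "compact_operator T"
  shows "compact_operator (\<lambda>x. B (T x))"
  unfolding compact_operator_def
proof (intro conjI allI impI)
  show "bounded_linear (\<lambda>x. B (T x))" using bounded_linear_compose[OF B compact_operatorD(1)[OF T]] .
  fix x :: "nat \<Rightarrow> 'a" assume "bounded (range x)"
  then obtain r :: "nat \<Rightarrow> nat" and l where "strict_mono r" "(\<lambda>n. T (x (r n))) \<longlonglongrightarrow> l" using compact_operatorD(2)[OF T] by blast
  then show "\<exists>r l. strict_mono r \<and> (\<lambda>n. B (T (x (r n)))) \<longlonglongrightarrow> l"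
    using bounded_linear.tendsto[OF B] by blast
qed

lemma ap_nemytskii_linear: "bounded_linear B \<Longrightarrow> ap (nemytskii B u) t = B (ap u t)"
  by (rule ap_nemytskii) (auto simp: linear_continuous_on linear_neg[OF bounded_linear.linear])

lemma bounded_linear_nemytskii:
  assumes B: "bounded_linear B" shows "bounded_linear (nemytskii B)"
proof -
  obtain K where K: "\<And>x. norm (B x) \<le> norm x * K" "K > 0" using bounded_linear.pos_bounded[OF B] by blast
  note ap = ap_nemytskii_linear[OF B]
  show ?thesis
  proof (rule bounded_linear_intro[where K = K])
    show "nemytskii B (u + v) = nemytskii B u + nemytskii B v" for u v
      by (rule ap_eqI) (simp add: ap linear_add[OF bounded_linear.linear[OF B]])
    show "nemytskii B (a *\<^sub>R u) = a *\<^sub>R nemytskii B u" for a u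
      by (rule ap_eqI) (simp add: ap linear_cmul[OF bounded_linear.linear[OF B]])
    show "norm (nemytskii B u) \<le> norm u * K" for u
    proof (rule norm_antiperiodic_le)
      fix t
      have "norm (B (ap u t)) \<le> norm (ap u t) * K" by (rule K)
      also have "\<dots> \<le> norm u * K" using K norm_ap_le[of u t] by (intro mult_right_mono) auto
      finally show "norm (ap (nemytskii B u) t) \<le> norm u * K" by (simp add: ap)
    qed
  qed
qed

lemma nemytskii_Cop_commute: "bounded_linear B \<Longrightarrow> nemytskii B (Cop u) = Cop (nemytskii B u)"
  by (rule Cop_linear_image[symmetric]) (auto simp: ap_nemytskii_linear)

lemma ipa_nemytskii_symmetric:
  assumes "bounded_linear B" "\<And>x y. B x \<bullet> y = x \<bullet> B y"
  shows "ipa (nemytskii B u) v = ipa u (nemytskii B v)"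
  by (simp add: ipa_def ap_nemytskii_linear assms)

text \<open>
  The state of the delay system at time \<open>2\<close>: the value and the two delayed values determine the solution.
\<close>

definition samples :: "'a::euclidean_space antiperiodic \<Rightarrow> 'a \<times> 'a \<times> 'a" where
  "samples u = (ap u 0, ap u 1, ap u 2)"

lemma bounded_linear_samples: "bounded_linear samples"
proof (rule bounded_linear_intro[where K = 3])
  show "norm (samples u) \<le> norm u * 3" for u :: "'a antiperiodic"
  proof -
    have "norm (samples u) \<le> norm (ap u 0) + norm (ap u 1, ap u 2)" unfolding samples_def by (rule norm_Pair_le)
    also have "norm (ap u 1, ap u 2) \<le> norm (ap u 1) + norm (ap u 2)" by (rule norm_Pair_le)
    finally show ?thesis using norm_ap_le[of u 0] norm_ap_le[of u 1] norm_ap_le[of u 2] by linarith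
  qed
qed (simp_all add: samples_def)

text \<open>
  The vectors \<open>u t\<close>, \<open>u (t - 1)\<close> and \<open>u (t - 2)\<close> satisfy a linear system of ordinary differential equations,
  because \<open>u (t - 3) = - u t\<close>. Its coefficient matrix is skew, as \<open>B\<close> is symmetric and the delays occur with
  opposite signs, so the sum \<open>e\<close> of the squared norms is conserved.
\<close>

lemma samples_injective:
  fixes B :: "'a::euclidean_space \<Rightarrow> 'a"
  assumes B: "bounded_linear B" "\<And>x y. B x \<bullet> y = x \<bullet> B y"
    and u: "nemytskii B (Cop u) = u" and s: "samples u = 0"
  shows "u = 0"
proof -
  interpret B: bounded_linear B by (rule B)
  have uB: "ap u = (\<lambda>t. B (ap (Cop u) t))" using ap_nemytskii_linear[OF B(1), of "Cop u"] u by (auto simp: fun_eq_iff)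
  have du: "(ap u has_vector_derivative B (ap u (t - 1) + ap u (t - 2))) (at t)" for t
    by (subst uB) (rule B.has_vector_derivative[OF Cop_derivative])
  have dk: "((\<lambda>t. ap u (t - k)) has_vector_derivative B (ap u (t - k - 1) + ap u (t - k - 2))) (at t)" for t k
  proof -
    have "((\<lambda>t. t - k) has_vector_derivative 1) (at t)" by (auto intro!: derivative_eq_intros)
    from vector_diff_chain_at[OF this du] show ?thesis by (simp add: o_def)
  qed
  define e where "e t = ap u (t - 0) \<bullet> ap u (t - 0) + ap u (t - 1) \<bullet> ap u (t - 1) + ap u (t - 2) \<bullet> ap u (t - 2)" for t
  have "(e has_real_derivative 0) (at t)" for t
  proof -
    have d2: "((\<lambda>t. ap u (t - k) \<bullet> ap u (t - k)) has_vector_derivative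
        ap u (t - k) \<bullet> B (ap u (t - k - 1) + ap u (t - k - 2)) + B (ap u (t - k - 1) + ap u (t - k - 2)) \<bullet> ap u (t - k)) (at t)" for k
      by (rule bounded_bilinear.has_vector_derivative[OF bounded_bilinear_inner dk dk])
    define a where "a = ap u t"
    define b where "b = ap u (t - 1)"
    define c where "c = ap u (t - 2)"
    have p: "ap u (t - 3) = - a" "ap u (t - 4) = - b"
      using ap_shift_diff[of u t] ap_shift_diff[of u "t - 1"] by (simp_all add: a_def b_def)
    have q: "t - 1 - 1 = t - 2" "t - 1 - 2 = t - 3" "t - 2 - 1 = t - 3" "t - 2 - 2 = t - 4" by simp_all
    have "(e has_vector_derivative (a \<bullet> B (b + c) + B (b + c) \<bullet> a) + (b \<bullet> B (c + - a) + B (c + - a) \<bullet> b)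
        + (c \<bullet> B (- a + - b) + B (- a + - b) \<bullet> c)) (at t)"
      using has_vector_derivative_add[OF has_vector_derivative_add[OF d2[of 0] d2[of 1]] d2[of 2]]
      unfolding e_def[abs_def] by (simp only: q p diff_zero a_def[symmetric] b_def[symmetric] c_def[symmetric])
    moreover have "(a \<bullet> B (b + c) + B (b + c) \<bullet> a) + (b \<bullet> B (c + - a) + B (c + - a) \<bullet> b)
        + (c \<bullet> B (- a + - b) + B (- a + - b) \<bullet> c) = 0"
    proof -
      have "a \<bullet> B (b + c) + B (b + c) \<bullet> a = 2 * (B b \<bullet> a + B c \<bullet> a)"
        by (simp add: inner_commute[of a] B.add inner_add_left)
      moreover have "b \<bullet> B (c + - a) + B (c + - a) \<bullet> b = 2 * (B c \<bullet> b - B a \<bullet> b)"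
        by (simp add: inner_commute[of b] B.diff inner_diff_left)
      moreover have "c \<bullet> B (- a + - b) + B (- a + - b) \<bullet> c = 2 * (- (B a \<bullet> c) - B b \<bullet> c)"
        by (simp add: inner_commute[of c] B.diff linear_neg[OF B.linear] inner_diff_left)
      moreover have "B a \<bullet> b = B b \<bullet> a" "B a \<bullet> c = B c \<bullet> a" "B b \<bullet> c = B c \<bullet> b"
        by (metis B(2) inner_commute)+
      ultimately show ?thesis by simp
    qed
    ultimately show ?thesis by (simp add: has_real_derivative_iff_has_vector_derivative)
  qed
  then have "e t = e 2" for t by (rule DERIV_isconst_all[OF allI])
  moreover have "e 2 = 0" using s by (simp add: e_def samples_def zero_prod_def)
  ultimately have "e t = 0" for t by simp
  then have "ap u t = 0" for t
    unfolding e_def using inner_ge_zero by (metis add_nonneg_eq_0_iff add_nonneg_nonneg diff_zero inner_eq_zero_iff)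
  then show ?thesis by (intro ap_eqI) simp
qed

text \<open>
  Rescaling the time by \<open>\<tau>\<close> multiplies the gradients by \<open>\<tau>\<close>. The problem becomes \<open>u = G lam (Cop u)\<close>, and
  \<open>x = Cop u\<close> is the rescaled solution.
\<close>

locale even_C2_family =
  fixes V0 V1 :: "real^'n \<Rightarrow> real" and \<tau> :: real
  assumes \<tau>: "\<tau> > 0"
    and C2_0: "C2 V0" and C2_1: "C2 V1"
    and even_0: "even_function V0" and even_1: "even_function V1"
begin

definition G :: "real \<Rightarrow> real^'n \<Rightarrow> real^'n" where
  "G lam x = \<tau> *\<^sub>R (gradient V0 x + lam *\<^sub>R gradient V1 x)"
definition W :: "real \<Rightarrow> real^'n \<Rightarrow> real" where
  "W lam x = \<tau> * ((V0 x - V0 0) + lam * (V1 x - V1 0))"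
definition H1 :: "real^'n \<Rightarrow> real^'n" where "H1 v = \<tau> *\<^sub>R (hessian V1 0 *v v)"
definition B :: "real \<Rightarrow> real^'n \<Rightarrow> real^'n" where
  "B lam v = \<tau> *\<^sub>R (hessian V0 0 *v v) + lam *\<^sub>R H1 v"

lemma continuous_G [continuous_intros]: "continuous_on S (G lam)"
  unfolding G_def by (intro continuous_intros C2_continuous_gradient C2_0 C2_1)

lemma continuous_W [continuous_intros]: "continuous_on S (W lam)"
  unfolding W_def by (intro continuous_intros C2_continuous C2_0 C2_1)

lemma G_odd: "G lam (- x) = - G lam x"
  by (simp add: G_def even_gradient_odd C2_0 C2_1 even_0 even_1 algebra_simps)

lemma G_zero: "G lam 0 = 0"
  by (simp add: G_def even_gradient_zero C2_0 C2_1 even_0 even_1)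

lemma W_derivative: "(W lam has_derivative (\<lambda>h. G lam x \<bullet> h)) (at x)"
proof -
  have "(W lam has_derivative (\<lambda>h. \<tau> * (gradient V0 x \<bullet> h - 0 + lam * (gradient V1 x \<bullet> h - 0)))) (at x)"
    unfolding W_def[abs_def]
    by (intro has_derivative_mult_right has_derivative_add has_derivative_diff has_derivative_const
        C2_has_gradient C2_0 C2_1)
  then show ?thesis by (simp add: G_def inner_add_left algebra_simps)
qed

lemma bounded_linear_H1: "bounded_linear H1"
  unfolding H1_def by (intro bounded_linear_scaleR_right[THEN bounded_linear_compose] matrix_vector_mul_bounded_linear)

lemma bounded_linear_B: "bounded_linear (B lam)"
  unfolding B_def
  by (intro bounded_linear_add bounded_linear_scaleR_right[THEN bounded_linear_compose] matrix_vector_mul_bounded_linear bounded_linear_H1)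

lemma H1_symmetric: "H1 x \<bullet> y = x \<bullet> H1 y"
  by (simp add: H1_def hessian_symmetric[OF C2_1])

lemma B_symmetric: "B lam x \<bullet> y = x \<bullet> B lam y"
  by (simp add: B_def inner_add_left inner_add_right H1_symmetric hessian_symmetric[OF C2_0])

lemma B_param: "B lam v = B \<mu> v + (lam - \<mu>) *\<^sub>R H1 v"
  by (simp add: B_def algebra_simps)

lemma G_strictly_differentiable:
  assumes "\<epsilon> > 0"
  obtains \<delta> where "\<delta> > 0" "\<And>lam x y. \<bar>lam - \<mu>\<bar> < 1 \<Longrightarrow> norm x < \<delta> \<Longrightarrow> norm y < \<delta> \<Longrightarrow>
      norm (G lam x - G lam y - B lam (x - y)) \<le> \<epsilon> * norm (x - y)"
proof -
  define e where "e = \<epsilon> / (\<tau> * (\<bar>\<mu>\<bar> + 2))"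
  have p: "\<tau> * (\<bar>\<mu>\<bar> + 2) > 0" using \<tau> by (simp add: add_nonneg_pos)
  then have e: "e > 0" "\<tau> * (\<bar>\<mu>\<bar> + 2) * e = \<epsilon>" using assms by (auto simp: e_def)
  obtain \<delta>0 where \<delta>0: "\<delta>0 > 0" "\<And>x y. norm x < \<delta>0 \<Longrightarrow> norm y < \<delta>0 \<Longrightarrow>
      norm (gradient V0 x - gradient V0 y - hessian V0 0 *v (x - y)) \<le> e * norm (x - y)"
    using gradient_strictly_differentiable[OF C2_0 e(1)] by blast
  obtain \<delta>1 where \<delta>1: "\<delta>1 > 0" "\<And>x y. norm x < \<delta>1 \<Longrightarrow> norm y < \<delta>1 \<Longrightarrow>
      norm (gradient V1 x - gradient V1 y - hessian V1 0 *v (x - y)) \<le> e * norm (x - y)"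
    using gradient_strictly_differentiable[OF C2_1 e(1)] by blast
  show thesis
  proof (rule that[of "min \<delta>0 \<delta>1"])
    fix lam :: real and x y :: "real^'n"
    assume *: "\<bar>lam - \<mu>\<bar> < 1" "norm x < min \<delta>0 \<delta>1" "norm y < min \<delta>0 \<delta>1"
    let ?a = "gradient V0 x - gradient V0 y - hessian V0 0 *v (x - y)"
    let ?b = "gradient V1 x - gradient V1 y - hessian V1 0 *v (x - y)"
    have ab: "norm ?a \<le> e * norm (x - y)" "norm ?b \<le> e * norm (x - y)" using \<delta>0(2)[of x y] \<delta>1(2)[of x y] * by auto
    have l: "\<bar>lam\<bar> \<le> \<bar>\<mu>\<bar> + 1" using *(1) by linarith
    have "G lam x - G lam y - B lam (x - y) = \<tau> *\<^sub>R (?a + lam *\<^sub>R ?b)"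
      by (simp add: G_def B_def H1_def algebra_simps)
    then have "norm (G lam x - G lam y - B lam (x - y)) = \<tau> * norm (?a + lam *\<^sub>R ?b)" using \<tau> by simp
    also have "\<dots> \<le> \<tau> * (norm ?a + \<bar>lam\<bar> * norm ?b)"
      using norm_triangle_ineq[of ?a "lam *\<^sub>R ?b"] \<tau> by (intro mult_left_mono) auto
    also have "\<dots> \<le> \<tau> * (e * norm (x - y) + (\<bar>\<mu>\<bar> + 1) * (e * norm (x - y)))"
      using ab l \<tau> by (intro mult_left_mono add_mono mult_mono) auto
    also have "\<dots> = (\<tau> * (\<bar>\<mu>\<bar> + 2) * e) * norm (x - y)" by (simp add: algebra_simps)
    finally show "norm (G lam x - G lam y - B lam (x - y)) \<le> \<epsilon> * norm (x - y)" by (simp only: e(2))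
  qed (use \<delta>0 \<delta>1 in auto)
qed

text \<open>
  The linearization at the origin, its derivative with respect to the parameter, and the full right hand
  side, each composed with the integration operator.
\<close>

definition Ah :: "real \<Rightarrow> (real^'n) antiperiodic \<Rightarrow> (real^'n) antiperiodic" where "Ah lam u = nemytskii (B lam) (Cop u)"
definition Dh :: "(real^'n) antiperiodic \<Rightarrow> (real^'n) antiperiodic" where "Dh u = nemytskii H1 (Cop u)"
definition Gh :: "real \<Rightarrow> (real^'n) antiperiodic \<Rightarrow> (real^'n) antiperiodic" where "Gh lam u = nemytskii (G lam) (Cop u)"

definition small_branch :: "real \<Rightarrow> real \<Rightarrow> bool" where
  "small_branch lam \<epsilon> \<longleftrightarrow> (\<exists>u. u \<noteq> 0 \<and> norm u < \<epsilon> \<and> Gh lam u = u)"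

lemma ap_Ah: "ap (Ah lam u) t = B lam (ap (Cop u) t)" by (simp add: Ah_def ap_nemytskii_linear bounded_linear_B)
lemma ap_Dh: "ap (Dh u) t = H1 (ap (Cop u) t)" by (simp add: Dh_def ap_nemytskii_linear bounded_linear_H1)
lemma ap_Gh: "ap (Gh lam u) t = G lam (ap (Cop u) t)" unfolding Gh_def by (rule ap_nemytskii) (auto simp: G_odd continuous_G)

lemma Ah_param: "Ah lam u = Ah \<mu> u + (lam - \<mu>) *\<^sub>R Dh u"
  by (rule ap_eqI) (simp add: ap_Ah ap_Dh B_param[of lam _ \<mu>])

lemma compact_Ah: "compact_operator (Ah lam)"
  unfolding Ah_def by (rule compact_operator_compose[OF bounded_linear_nemytskii[OF bounded_linear_B] compact_operator_Cop])

lemma bounded_linear_Dh: "bounded_linear Dh"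
  unfolding Dh_def by (rule bounded_linear_compose[OF bounded_linear_nemytskii[OF bounded_linear_H1] bounded_linear_Cop])

lemma Ah_symmetric: "ipa (Ah lam u) v = ipa u (Ah lam v)"
  unfolding Ah_def
  by (simp add: ipa_nemytskii_symmetric[OF bounded_linear_B B_symmetric] Cop_symmetric nemytskii_Cop_commute[OF bounded_linear_B])

lemma symmetric_compact_Ah: "symmetric_compact ipa (Ah lam) samples"
proof (rule symmetric_compact.intro)
  show "bounded_bilinear (ipa :: (real^'n) antiperiodic \<Rightarrow> _)" by (rule bounded_bilinear_ipa)
  show "compact_operator (Ah lam)" by (rule compact_Ah)
  show "bounded_linear (samples :: (real^'n) antiperiodic \<Rightarrow> _)" by (rule bounded_linear_samples)
  fix u v :: "(real^'n) antiperiodic"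
  show "ipa u v = ipa v u" by (rule ipa_commute)
  show "ipa (Ah lam u) v = ipa u (Ah lam v)" by (rule Ah_symmetric)
  show "u \<noteq> 0 \<Longrightarrow> 0 < ipa u u" by (rule ipa_pos)
  show "Ah lam u = u \<Longrightarrow> samples u = 0 \<Longrightarrow> u = 0"
    unfolding Ah_def by (rule samples_injective[OF bounded_linear_B B_symmetric])
qed

end

locale definite_C2_family = even_C2_family V0 V1 \<tau> for V0 V1 :: "real^'n \<Rightarrow> real" and \<tau> :: real +
  fixes \<sigma> :: real
  assumes definite: "v \<noteq> 0 \<Longrightarrow> \<sigma> * (v \<bullet> (hessian V1 0 *v v)) > 0"
begin

lemma crossing_Ah: "crossing ipa (Ah \<mu>) samples Cop Dh \<sigma>"
proof -
  show ?thesis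
  proof (intro crossing.intro symmetric_compact_Ah crossing_axioms.intro)
    show "bounded_linear (Cop :: (real^'n) antiperiodic \<Rightarrow> _)" by (rule bounded_linear_Cop)
    show "bounded_linear Dh" by (rule bounded_linear_Dh)
    fix u v :: "(real^'n) antiperiodic"
    show "ipa (Cop u) v = ipa u (Cop v)" by (rule Cop_symmetric)
    show "Cop (Ah \<mu> u) = Ah \<mu> (Cop u)" by (simp add: Ah_def nemytskii_Cop_commute[OF bounded_linear_B])
    have inj: "u = 0" if "Ah \<mu> u = u" "Cop u = 0" for u
    proof -
      have "ap u t = B \<mu> (ap (Cop u) t)" for t using ap_Ah[of \<mu> u t] that(1) by simp
      then have "ap u t = 0" for t using that(2) linear_0[OF bounded_linear.linear[OF bounded_linear_B]] by simp
      then show ?thesis by (intro ap_eqI) simp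
    qed
    then show "Ah \<mu> u = u \<Longrightarrow> Cop u = 0 \<Longrightarrow> u = 0" .
    show "0 < \<sigma> * ipa (Dh u) (Cop u)" if u: "Ah \<mu> u = u" "u \<noteq> 0"
    proof -
      let ?Q = "\<lambda>v. \<sigma> * (H1 v \<bullet> v)"
      have "Cop u \<noteq> 0" using inj u by blast
      then have "integral {0..3} (\<lambda>t. ?Q (ap (Cop u) t)) > 0"
      proof (rule integral_density_pos[rotated 3])
        show "continuous_on UNIV ?Q"
          by (intro continuous_intros bounded_linear.continuous_on[OF bounded_linear_H1])
        show "?Q 0 = 0" by simp
        fix v :: "real^'n" assume "v \<noteq> 0"
        then have "\<tau> * (\<sigma> * (v \<bullet> (hessian V1 0 *v v))) > 0" using definite \<tau> by simp
        then show "?Q v > 0" by (simp add: H1_def inner_commute mult_ac)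
      qed
      then show ?thesis by (simp add: ipa_def ap_Dh)
    qed
  qed
qed

text \<open>
  The linearized problem is itself of the form studied above, with vanishing nonlinear part. This yields
  the isolatedness of the degenerate parameters.
\<close>

lemma linear_perturbation: "perturbation ipa (Ah \<mu>) samples Cop Dh \<sigma> (\<lambda>lam u. (lam - \<mu>) *\<^sub>R Dh u) \<mu>"
proof -
  interpret crossing ipa "Ah \<mu>" samples Cop Dh \<sigma> by (rule crossing_Ah)
  obtain K where K: "K > 0" "\<And>u. norm (Dh u) \<le> norm u * K"
    using bounded_linear.pos_bounded[OF bounded_linear_Dh] by blast
  show ?thesis
  proof (intro perturbation.intro crossing_Ah perturbation_axioms.intro)
    fix \<epsilon> :: real assume \<epsilon>: "\<epsilon> > 0"
    show "\<exists>\<delta>>0. \<forall>lam u v. \<bar>lam - \<mu>\<bar> < \<delta> \<longrightarrow> norm u < \<delta> \<longrightarrow> norm v < \<delta> \<longrightarrow>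
        norm ((lam - \<mu>) *\<^sub>R Dh u - (lam - \<mu>) *\<^sub>R Dh v) \<le> \<epsilon> * norm (u - v)"
    proof (intro exI[of _ "\<epsilon> / K"] conjI allI impI)
      show "\<epsilon> / K > 0" using \<epsilon> K by simp
      fix lam :: real and u v :: "(real^'n) antiperiodic" assume l: "\<bar>lam - \<mu>\<bar> < \<epsilon> / K"
      have "norm ((lam - \<mu>) *\<^sub>R Dh u - (lam - \<mu>) *\<^sub>R Dh v) = \<bar>lam - \<mu>\<bar> * norm (Dh (u - v))"
        by (simp add: linear_diff[OF bounded_linear.linear[OF bounded_linear_Dh]] flip: scaleR_diff_right)
      also have "\<dots> \<le> (\<epsilon> / K) * (norm (u - v) * K)" using l K \<epsilon> by (intro mult_mono) auto
      also have "\<dots> = \<epsilon> * norm (u - v)" using K by simp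
      finally show "norm ((lam - \<mu>) *\<^sub>R Dh u - (lam - \<mu>) *\<^sub>R Dh v) \<le> \<epsilon> * norm (u - v)" .
    qed
    fix lam
    show "\<exists>\<delta>>0. \<forall>u. norm u < \<delta> \<longrightarrow> norm ((lam - \<mu>) *\<^sub>R Dh u - (lam - \<mu>) *\<^sub>R Dh u) \<le> \<epsilon> * norm u"
      using \<epsilon> by (intro exI[of _ 1]) auto
  qed
qed

lemma linear_solutions_isolated:
  obtains \<delta> where "\<delta> > 0" "\<And>lam u. lam \<noteq> \<mu> \<Longrightarrow> \<bar>lam - \<mu>\<bar> < \<delta> \<Longrightarrow> Ah lam u = u \<Longrightarrow> u = 0"
proof -
  interpret lin: perturbation ipa "Ah \<mu>" samples Cop Dh \<sigma> "\<lambda>lam u. (lam - \<mu>) *\<^sub>R Dh u" \<mu> by (rule linear_perturbation)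
  obtain \<delta> where \<delta>: "\<delta> > 0" "\<And>lam. lam \<noteq> \<mu> \<Longrightarrow> \<bar>lam - \<mu>\<bar> < \<delta> \<Longrightarrow> \<exists>d>0. \<forall>u. norm u < d \<longrightarrow> lin.N lam u = 0 \<longrightarrow> u = 0"
    using lin.isolated_trivial_solution by blast
  show thesis
  proof (rule that[OF \<delta>(1)])
    fix lam u assume l: "lam \<noteq> \<mu>" "\<bar>lam - \<mu>\<bar> < \<delta>" and u: "Ah lam u = u"
    obtain d where d: "d > 0" "\<And>u. norm u < d \<Longrightarrow> lin.N lam u = 0 \<Longrightarrow> u = 0" using \<delta>(2)[OF l] by blast
    have N: "lin.N lam v = v - Ah lam v" for v by (simp add: lin.N_def Ah_param[of lam v \<mu>])
    define c where "c = d / (2 * (norm u + 1))"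
    have c: "c > 0" using d by (simp add: c_def add_nonneg_pos)
    have "c * norm u < d"
    proof -
      have "d * norm u < d * (2 * (norm u + 1))" using d(1) by (intro mult_strict_left_mono) (auto intro: add_nonneg_pos)
      then show ?thesis by (simp add: c_def pos_divide_less_eq add_nonneg_pos)
    qed
    moreover have "lin.N lam (c *\<^sub>R u) = 0"
      using u linear_cmul[OF bounded_linear.linear[OF compact_operatorD(1)[OF compact_Ah]], of lam c u] by (simp add: N)
    ultimately have "c *\<^sub>R u = 0" using c d(2)[of "c *\<^sub>R u"] by simp
    then show "u = 0" using c by simp
  qed
qed

definition rh :: "real \<Rightarrow> real \<Rightarrow> (real^'n) antiperiodic \<Rightarrow> (real^'n) antiperiodic" where
  "rh \<mu> lam u = Gh lam u - Ah \<mu> u"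

lemma G_remainder_Gh:
  assumes g: "\<And>x y. norm x < \<delta> \<Longrightarrow> norm y < \<delta> \<Longrightarrow> norm (G lam x - G lam y - B lam (x - y)) \<le> \<epsilon> * norm (x - y)"
    and e: "\<epsilon> \<ge> 0" and uv: "norm u < \<delta> / 2" "norm v < \<delta> / 2"
  shows "norm (Gh lam u - Gh lam v - Ah lam (u - v)) \<le> 2 * \<epsilon> * norm (u - v)"
proof (rule norm_antiperiodic_le)
  fix t
  have C: "ap (Cop (u - v)) t = ap (Cop u) t - ap (Cop v) t"
    by (simp add: linear_diff[OF bounded_linear.linear[OF bounded_linear_Cop]])
  have "norm (ap (Cop u) t) < \<delta>" "norm (ap (Cop v) t) < \<delta>"
    using norm_ap_Cop[of u t] norm_ap_Cop[of v t] uv by linarith+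
  then have "norm (ap (Gh lam u - Gh lam v - Ah lam (u - v)) t) \<le> \<epsilon> * norm (ap (Cop (u - v)) t)"
    using g by (simp add: ap_Gh ap_Ah C)
  also have "\<dots> \<le> \<epsilon> * (2 * norm (u - v))" using e norm_ap_Cop by (intro mult_left_mono) auto
  finally show "norm (ap (Gh lam u - Gh lam v - Ah lam (u - v)) t) \<le> 2 * \<epsilon> * norm (u - v)" by simp
qed

lemma Gh_zero: "Gh lam 0 = 0"
  by (rule ap_eqI) (simp add: ap_Gh linear_0[OF bounded_linear.linear[OF bounded_linear_Cop]] G_zero)

lemma perturbation_rh: "perturbation ipa (Ah \<mu>) samples Cop Dh \<sigma> (rh \<mu>) \<mu>"
proof -
  interpret crossing ipa "Ah \<mu>" samples Cop Dh \<sigma> by (rule crossing_Ah)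
  obtain K where K: "K > 0" "\<And>u. norm (Dh u) \<le> norm u * K"
    using bounded_linear.pos_bounded[OF bounded_linear_Dh] by blast
  show ?thesis
  proof (intro perturbation.intro crossing_Ah perturbation_axioms.intro)
    fix \<epsilon> :: real assume \<epsilon>: "\<epsilon> > 0"
    then have "\<epsilon> / 4 > 0" by simp
    then obtain \<delta> where \<delta>: "\<delta> > 0" "\<And>lam x y. \<bar>lam - \<mu>\<bar> < 1 \<Longrightarrow> norm x < \<delta> \<Longrightarrow> norm y < \<delta> \<Longrightarrow>
      norm (G lam x - G lam y - B lam (x - y)) \<le> \<epsilon> / 4 * norm (x - y)"
      using G_strictly_differentiable[of "\<epsilon> / 4" \<mu>] by blast
    show "\<exists>\<delta>>0. \<forall>lam u v. \<bar>lam - \<mu>\<bar> < \<delta> \<longrightarrow> norm u < \<delta> \<longrightarrow> norm v < \<delta> \<longrightarrow>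
        norm (rh \<mu> lam u - rh \<mu> lam v) \<le> \<epsilon> * norm (u - v)"
    proof (intro exI[of _ "min (min 1 (\<delta> / 2)) (\<epsilon> / (2 * K))"] conjI allI impI)
      show "min (min 1 (\<delta> / 2)) (\<epsilon> / (2 * K)) > 0" using \<epsilon> K \<delta> by simp
      fix lam :: real and u v :: "(real^'n) antiperiodic"
      assume l: "\<bar>lam - \<mu>\<bar> < min (min 1 (\<delta> / 2)) (\<epsilon> / (2 * K))"
        "norm u < min (min 1 (\<delta> / 2)) (\<epsilon> / (2 * K))" "norm v < min (min 1 (\<delta> / 2)) (\<epsilon> / (2 * K))"
      have 1: "norm (Gh lam u - Gh lam v - Ah lam (u - v)) \<le> 2 * (\<epsilon> / 4) * norm (u - v)"
        by (rule G_remainder_Gh[of \<delta>]) (use l \<delta> \<epsilon> in auto)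
      have 2: "norm ((lam - \<mu>) *\<^sub>R Dh (u - v)) \<le> \<epsilon> / 2 * norm (u - v)"
      proof -
        have "\<bar>lam - \<mu>\<bar> * norm (Dh (u - v)) \<le> (\<epsilon> / (2 * K)) * (norm (u - v) * K)"
          using l K \<epsilon> by (intro mult_mono) auto
        then show ?thesis using K by simp
      qed
      have eq: "rh \<mu> lam u - rh \<mu> lam v = (Gh lam u - Gh lam v - Ah lam (u - v)) + (lam - \<mu>) *\<^sub>R Dh (u - v)"
        by (simp add: rh_def Ah_param[of lam _ \<mu>] A.diff)
      have "norm (rh \<mu> lam u - rh \<mu> lam v) \<le> 2 * (\<epsilon> / 4) * norm (u - v) + \<epsilon> / 2 * norm (u - v)"
        unfolding eq by (rule order_trans[OF norm_triangle_ineq add_mono[OF 1 2]])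
      then show "norm (rh \<mu> lam u - rh \<mu> lam v) \<le> \<epsilon> * norm (u - v)" by simp
    qed
    fix lam
    have "\<epsilon> / 2 > 0" using \<epsilon> by simp
    then obtain \<delta> where \<delta>: "\<delta> > 0" "\<And>lam' x y. \<bar>lam' - lam\<bar> < 1 \<Longrightarrow> norm x < \<delta> \<Longrightarrow> norm y < \<delta> \<Longrightarrow>
      norm (G lam' x - G lam' y - B lam' (x - y)) \<le> \<epsilon> / 2 * norm (x - y)"
      using G_strictly_differentiable[of "\<epsilon> / 2" lam] by blast
    show "\<exists>\<delta>>0. \<forall>u. norm u < \<delta> \<longrightarrow> norm (rh \<mu> lam u - (lam - \<mu>) *\<^sub>R Dh u) \<le> \<epsilon> * norm u"
    proof (intro exI[of _ "\<delta> / 2"] conjI allI impI)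
      fix u :: "(real^'n) antiperiodic" assume u: "norm u < \<delta> / 2"
      have "norm (Gh lam u - Gh lam 0 - Ah lam (u - 0)) \<le> 2 * (\<epsilon> / 2) * norm (u - 0)"
        by (rule G_remainder_Gh[of \<delta>]) (use u \<delta> \<epsilon> in auto)
      then show "norm (rh \<mu> lam u - (lam - \<mu>) *\<^sub>R Dh u) \<le> \<epsilon> * norm u"
        by (simp add: rh_def Gh_zero Ah_param[of lam u \<mu>] algebra_simps)
    qed (use \<delta> in simp)
  qed
qed

text \<open>
  The functional dual to the usual action. Its derivative at \<open>u\<close> in direction \<open>h\<close> is the inner product of
  \<open>u - G lam (Cop u)\<close> with \<open>Cop h\<close>; the potential \<open>W\<close> is normalized to vanish at the origin.
\<close>

definition action :: "real \<Rightarrow> (real^'n) antiperiodic \<Rightarrow> real" where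
  "action lam u = ipa u (Cop u) / 2 - integral {0..3} (\<lambda>t. W lam (ap (Cop u) t))"

lemma G_locally_lipschitz:
  obtains L \<delta> where "L > 0" "\<delta> > 0" "\<And>lam x y. \<bar>lam - \<mu>\<bar> < 1 \<Longrightarrow> norm x < \<delta> \<Longrightarrow> norm y < \<delta> \<Longrightarrow>
      norm (G lam x - G lam y) \<le> L * norm (x - y)"
proof -
  obtain \<delta> where \<delta>: "\<delta> > 0" "\<And>lam x y. \<bar>lam - \<mu>\<bar> < 1 \<Longrightarrow> norm x < \<delta> \<Longrightarrow> norm y < \<delta> \<Longrightarrow>
      norm (G lam x - G lam y - B lam (x - y)) \<le> 1 * norm (x - y)"
    using G_strictly_differentiable[of 1 \<mu>] by auto
  obtain K where K: "K > 0" "\<And>v. norm (B \<mu> v) \<le> norm v * K" using bounded_linear.pos_bounded[OF bounded_linear_B] by blast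
  obtain K1 where K1: "K1 > 0" "\<And>v. norm (H1 v) \<le> norm v * K1" using bounded_linear.pos_bounded[OF bounded_linear_H1] by blast
  show thesis
  proof (rule that[of "1 + K + K1" \<delta>])
    fix lam :: real and x y :: "real^'n"
    assume *: "\<bar>lam - \<mu>\<bar> < 1" "norm x < \<delta>" "norm y < \<delta>"
    have "\<bar>lam - \<mu>\<bar> * norm (H1 (x - y)) \<le> 1 * (norm (x - y) * K1)" using * K1 by (intro mult_mono) auto
    then have "norm (B lam (x - y)) \<le> norm (x - y) * K + norm (x - y) * K1"
      unfolding B_param[of lam "x - y" \<mu>]
      using norm_triangle_ineq[of "B \<mu> (x - y)" "(lam - \<mu>) *\<^sub>R H1 (x - y)"] K(2)[of "x - y"] by simp
    moreover have "norm (G lam x - G lam y) \<le> norm (G lam x - G lam y - B lam (x - y)) + norm (B lam (x - y))"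
      using norm_triangle_ineq[of "G lam x - G lam y - B lam (x - y)" "B lam (x - y)"] by simp
    ultimately show "norm (G lam x - G lam y) \<le> (1 + K + K1) * norm (x - y)"
      using \<delta>(2)[OF *] by (simp add: algebra_simps)
  qed (use \<delta> K K1 in auto)
qed

lemma W_taylor:
  assumes L: "\<And>x y. norm x < \<delta> \<Longrightarrow> norm y < \<delta> \<Longrightarrow> norm (G lam x - G lam y) \<le> L * norm (x - y)"
    and xy: "norm x < \<delta>" "norm y < \<delta>" and L0: "L \<ge> 0"
  shows "\<bar>W lam y - W lam x - G lam x \<bullet> (y - x)\<bar> \<le> L * (norm (y - x))\<^sup>2"
proof -
  define k where "k z = W lam z - G lam x \<bullet> z" for z
  have seg: "closed_segment x y \<subseteq> ball 0 \<delta>" using xy by (intro closed_segment_subset) auto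
  have "norm (k y - k x) \<le> (L * norm (y - x)) * norm (y - x)"
  proof (rule differentiable_bound[where S = "closed_segment x y" and f' = "\<lambda>z h. (G lam z - G lam x) \<bullet> h"])
    fix z assume z: "z \<in> closed_segment x y"
    have "(k has_derivative (\<lambda>h. G lam z \<bullet> h - G lam x \<bullet> h)) (at z)"
      unfolding k_def
      by (intro has_derivative_diff W_derivative bounded_linear_imp_has_derivative bounded_linear_inner_right)
    then show "(k has_derivative (\<lambda>h. (G lam z - G lam x) \<bullet> h)) (at z within closed_segment x y)"
      by (simp add: inner_diff_left has_derivative_at_withinI)
    show "onorm (\<lambda>h. (G lam z - G lam x) \<bullet> h) \<le> L * norm (y - x)"
    proof (rule onorm_bound)
      fix h
      have "norm (z - x) \<le> norm (y - x)" using z segment_bound(1)[of z x y] by simp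
      then have "norm (G lam z - G lam x) \<le> L * norm (y - x)"
        using L[of z x] z seg xy L0 mult_left_mono[of "norm (z - x)" "norm (y - x)" L] by force
      then show "norm ((G lam z - G lam x) \<bullet> h) \<le> L * norm (y - x) * norm h"
        using Cauchy_Schwarz_ineq2[of "G lam z - G lam x" h] mult_right_mono[of _ _ "norm h"] by (smt (verit) norm_ge_zero real_norm_def)
    qed (use L0 in simp)
  qed auto
  then show ?thesis by (simp add: k_def inner_diff_right power2_eq_square algebra_simps)
qed

lemma action_derivative:
  "\<exists>M \<delta>. \<delta> > 0 \<and> (\<forall>lam u v. \<bar>lam - \<mu>\<bar> < \<delta> \<longrightarrow> norm u < \<delta> \<longrightarrow> norm v < \<delta> \<longrightarrow>
      \<bar>action lam v - action lam u - ipa (u - Gh lam u) (Cop (v - u))\<bar> \<le> M * (norm (v - u))\<^sup>2)"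
proof -
  obtain L \<delta> where L: "L > 0" "\<delta> > 0" "\<And>lam x y. \<bar>lam - \<mu>\<bar> < 1 \<Longrightarrow> norm x < \<delta> \<Longrightarrow> norm y < \<delta> \<Longrightarrow>
      norm (G lam x - G lam y) \<le> L * norm (x - y)"
    using G_locally_lipschitz by blast
  interpret ip: bounded_bilinear ipa by (rule bounded_bilinear_ipa)
  obtain b where b: "b > 0" "\<And>u v :: (real^'n) antiperiodic. norm (ipa u v) \<le> norm u * norm v * b"
    using bounded_bilinear.pos_bounded[OF bounded_bilinear_ipa] by blast
  define M where "M = b + 12 * L"
  have "\<bar>action lam v - action lam u - ipa (u - Gh lam u) (Cop (v - u))\<bar> \<le> M * (norm (v - u))\<^sup>2"
    if *: "\<bar>lam - \<mu>\<bar> < min 1 (\<delta> / 2)" "norm u < min 1 (\<delta> / 2)" "norm v < min 1 (\<delta> / 2)" for lam u v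
  proof -
    define h where "h = v - u"
    have v: "v = u + h" by (simp add: h_def)
    have Cv: "Cop v = Cop u + Cop h" by (simp add: v Cop_add)
    let ?x = "ap (Cop u)" and ?y = "ap (Cop v)" and ?k = "ap (Cop h)"
    let ?R = "\<lambda>t. W lam (?y t) - W lam (?x t) - G lam (?x t) \<bullet> ?k t"
    have cR: "continuous_on {0..3} ?R"
      by (intro continuous_intros continuous_on_compose2[OF continuous_W[of UNIV]] continuous_on_compose2[OF continuous_G[of UNIV]]) auto
    have RI: "\<bar>integral {0..3} ?R\<bar> \<le> (L * (2 * norm h)\<^sup>2) * 3"
    proof -
      have "norm (integral {0..3} ?R) \<le> (L * (2 * norm h)\<^sup>2) * (3 - 0)"
      proof (rule integral_bound[OF _ cR])
        fix t :: real
        have n: "norm (?x t) < \<delta>" "norm (?y t) < \<delta>" using norm_ap_Cop[of u t] norm_ap_Cop[of v t] * by linarith+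
        have "\<bar>W lam (?y t) - W lam (?x t) - G lam (?x t) \<bullet> (?y t - ?x t)\<bar> \<le> L * (norm (?y t - ?x t))\<^sup>2"
          by (rule W_taylor[OF L(3) n]) (use * L in auto)
        moreover have "?y t - ?x t = ?k t" by (simp add: Cv)
        moreover have "L * (norm (?k t))\<^sup>2 \<le> L * (2 * norm h)\<^sup>2"
          using L(1) norm_ap_Cop[of h t] by (intro mult_left_mono power_mono) auto
        ultimately show "norm (?R t) \<le> L * (2 * norm h)\<^sup>2" by simp
      qed simp
      then show ?thesis by simp
    qed
    have int: "(\<lambda>t. W lam (ap (Cop w) t)) integrable_on {0..3}" for w
      by (intro integrable_continuous_real continuous_on_compose2[OF continuous_W[of UNIV]] continuous_on_ap) auto
    have "ipa (Gh lam u) (Cop h) = integral {0..3} (\<lambda>t. G lam (?x t) \<bullet> ?k t)" by (simp add: ipa_def ap_Gh)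
    moreover have "(\<lambda>t. G lam (?x t) \<bullet> ?k t) integrable_on {0..3}"
      by (intro integrable_continuous_real continuous_intros continuous_on_compose2[OF continuous_G[of UNIV]]) auto
    ultimately have "integral {0..3} ?R = integral {0..3} (\<lambda>t. W lam (?y t)) - integral {0..3} (\<lambda>t. W lam (?x t)) - ipa (Gh lam u) (Cop h)"
      using int[of v] int[of u] by (simp add: integral_diff integrable_diff)
    moreover have "ipa v (Cop v) = ipa u (Cop u) + 2 * ipa u (Cop h) + ipa h (Cop h)"
      by (simp add: v Cop_add ip.add_left ip.add_right Cop_symmetric[of h u, symmetric] ipa_commute[of h "Cop u"])
        (simp add: Cop_symmetric ipa_commute)
    ultimately have "action lam v - action lam u - ipa (u - Gh lam u) (Cop h) = ipa h (Cop h) / 2 - integral {0..3} ?R"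
      by (simp add: action_def ip.diff_left add_divide_distrib)
    moreover have "\<bar>ipa h (Cop h)\<bar> \<le> 2 * b * (norm h)\<^sup>2"
    proof -
      have "\<bar>ipa h (Cop h)\<bar> \<le> norm h * norm (Cop h) * b" using b(2)[of h "Cop h"] by simp
      also have "\<dots> \<le> norm h * (2 * norm h) * b" using b(1) norm_Cop[of h] by (intro mult_right_mono mult_left_mono) auto
      finally show ?thesis by (simp add: power2_eq_square algebra_simps)
    qed
    ultimately have "\<bar>action lam v - action lam u - ipa (u - Gh lam u) (Cop h)\<bar> \<le> b * (norm h)\<^sup>2 + (L * (2 * norm h)\<^sup>2) * 3"
      using RI by linarith
    then show ?thesis by (simp add: M_def h_def power_mult_distrib algebra_simps)
  qed
  then show ?thesis using L(2) by (intro exI[of _ M] exI[of _ "min 1 (\<delta> / 2)"]) auto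
qed

lemma action_parameter:
  "\<exists>M \<delta>. \<delta> > 0 \<and> (\<forall>lam u. \<bar>lam - \<mu>\<bar> < \<delta> \<longrightarrow> norm u < \<delta> \<longrightarrow>
      norm (rh \<mu> lam u - rh \<mu> \<mu> u) \<le> M * \<bar>lam - \<mu>\<bar> \<and> \<bar>action lam u - action \<mu> u\<bar> \<le> M * \<bar>lam - \<mu>\<bar>)"
proof -
  have c: "compact (gradient V1 ` cball 0 2)" "compact (V1 ` cball 0 2)"
    by (auto intro!: compact_continuous_image C2_continuous_gradient C2_continuous C2_1)
  obtain m1 where m1: "\<forall>y\<in>gradient V1 ` cball 0 2. norm y \<le> m1"
    using compact_imp_bounded[OF c(1)] unfolding bounded_iff by blast
  obtain m2 where m2: "\<forall>y\<in>V1 ` cball 0 2. norm y \<le> m2"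
    using compact_imp_bounded[OF c(2)] unfolding bounded_iff by blast
  have m: "norm (gradient V1 x) \<le> m1" "norm (V1 x) \<le> m2" if "norm x \<le> 2" for x
    using m1 m2 that by auto
  define M where "M = \<tau> * \<bar>m1\<bar> + \<tau> * (m2 + \<bar>V1 0\<bar>) * 3"
  have m2: "m2 \<ge> 0" using m(2)[of 0] by simp
  have bd: "norm (ap (Cop u) t) \<le> 2" if "norm u < 1" for u :: "(real^'n) antiperiodic" and t
    using norm_ap_Cop[of u t] that by linarith
  have M0: "\<tau> * \<bar>m1\<bar> \<ge> 0" "\<tau> * (m2 + \<bar>V1 0\<bar>) * 3 \<ge> 0" using \<tau> m2 by auto
  have 1: "norm (rh \<mu> lam u - rh \<mu> \<mu> u) \<le> M * \<bar>lam - \<mu>\<bar>" if u: "norm u < 1" for lam u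
  proof (rule norm_antiperiodic_le)
    fix t
    have "ap (rh \<mu> lam u - rh \<mu> \<mu> u) t = (\<tau> * (lam - \<mu>)) *\<^sub>R gradient V1 (ap (Cop u) t)"
      by (simp add: rh_def ap_Gh G_def algebra_simps)
    then have "norm (ap (rh \<mu> lam u - rh \<mu> \<mu> u) t) = \<tau> * \<bar>lam - \<mu>\<bar> * norm (gradient V1 (ap (Cop u) t))"
      using \<tau> by (simp add: abs_mult)
    also have "\<dots> \<le> \<tau> * \<bar>lam - \<mu>\<bar> * \<bar>m1\<bar>" using m(1)[OF bd[OF u, of t]] \<tau> by (intro mult_left_mono) auto
    also have "\<dots> \<le> M * \<bar>lam - \<mu>\<bar>" using mult_right_mono[OF M0(2), of "\<bar>lam - \<mu>\<bar>"] by (simp add: M_def algebra_simps)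
    finally show "norm (ap (rh \<mu> lam u - rh \<mu> \<mu> u) t) \<le> M * \<bar>lam - \<mu>\<bar>" .
  qed
  have 2: "\<bar>action lam u - action \<mu> u\<bar> \<le> M * \<bar>lam - \<mu>\<bar>" if u: "norm u < 1" for lam u
  proof -
    let ?x = "ap (Cop u)"
    have int: "(\<lambda>t. W lam (?x t)) integrable_on {0..3}" for lam
      by (intro integrable_continuous_real continuous_on_compose2[OF continuous_W[of UNIV]] continuous_on_ap) auto
    let ?R = "\<lambda>t. W \<mu> (?x t) - W lam (?x t)"
    have cR: "continuous_on {0..3} ?R"
      by (intro continuous_intros continuous_on_compose2[OF continuous_W[of UNIV]]) auto
    have "action lam u - action \<mu> u = integral {0..3} ?R"
      using int by (simp add: action_def integral_diff)
    moreover have "norm (integral {0..3} ?R) \<le> (\<tau> * (m2 + \<bar>V1 0\<bar>) * \<bar>lam - \<mu>\<bar>) * (3 - 0)"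
    proof (rule integral_bound[OF _ cR])
      fix t :: real
      have "?R t = (\<tau> * (\<mu> - lam)) * (V1 (?x t) - V1 0)" by (simp add: W_def algebra_simps)
      then have "norm (?R t) = \<tau> * \<bar>lam - \<mu>\<bar> * \<bar>V1 (?x t) - V1 0\<bar>" using \<tau> by (simp add: abs_mult abs_minus_commute)
      also have "\<dots> \<le> \<tau> * \<bar>lam - \<mu>\<bar> * (m2 + \<bar>V1 0\<bar>)"
      proof -
        have "\<bar>V1 (?x t) - V1 0\<bar> \<le> m2 + \<bar>V1 0\<bar>" using m(2)[OF bd[OF u, of t]] unfolding real_norm_def by linarith
        then show ?thesis using \<tau> by (intro mult_left_mono) auto
      qed
      finally show "norm (?R t) \<le> \<tau> * (m2 + \<bar>V1 0\<bar>) * \<bar>lam - \<mu>\<bar>" by (simp add: mult_ac)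
    qed simp
    moreover have "\<tau> * (m2 + \<bar>V1 0\<bar>) * \<bar>lam - \<mu>\<bar> * 3 \<le> M * \<bar>lam - \<mu>\<bar>"
      using mult_right_mono[OF M0(1), of "\<bar>lam - \<mu>\<bar>"] by (simp add: M_def algebra_simps)
    ultimately show ?thesis by simp
  qed
  show ?thesis using 1 2 by (intro exI[of _ M] exI[of _ 1]) auto
qed

lemma potential_perturbation_rh: "potential_perturbation ipa (Ah \<mu>) samples Cop Dh \<sigma> (rh \<mu>) \<mu> action"
proof -
  interpret perturbation ipa "Ah \<mu>" samples Cop Dh \<sigma> "rh \<mu>" \<mu> by (rule perturbation_rh)
  have N: "N lam u = u - Gh lam u" for lam u by (simp add: N_def rh_def)
  show ?thesis
  proof (intro potential_perturbation.intro perturbation_rh potential_perturbation_axioms.intro)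
    show "action lam 0 = 0" for lam by (simp add: action_def ip.zero_left C.zero W_def)
    show "\<exists>M \<delta>. \<delta> > 0 \<and> (\<forall>lam u v. \<bar>lam - \<mu>\<bar> < \<delta> \<longrightarrow> norm u < \<delta> \<longrightarrow> norm v < \<delta> \<longrightarrow>
        \<bar>action lam v - action lam u - ipa (N lam u) (Cop (v - u))\<bar> \<le> M * (norm (v - u))\<^sup>2)"
      unfolding N by (rule action_derivative)
    show "\<exists>M \<delta>. \<delta> > 0 \<and> (\<forall>lam u. \<bar>lam - \<mu>\<bar> < \<delta> \<longrightarrow> norm u < \<delta> \<longrightarrow>
        norm (rh \<mu> lam u - rh \<mu> \<mu> u) \<le> M * \<bar>lam - \<mu>\<bar> \<and> \<bar>action lam u - action \<mu> u\<bar> \<le> M * \<bar>lam - \<mu>\<bar>)"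
      by (rule action_parameter)
  qed
qed

theorem hammerstein_bifurcation:
  assumes "w \<noteq> 0" "Ah \<mu> w = w"
  shows "(\<forall>\<epsilon>>0. small_branch \<mu> \<epsilon>)
    \<or> (\<forall>\<epsilon>>0. \<exists>\<delta>>0. \<forall>lam. \<mu> < lam \<and> lam < \<mu> + \<delta> \<longrightarrow> small_branch lam \<epsilon>)
    \<or> (\<forall>\<epsilon>>0. \<exists>\<delta>>0. \<forall>lam. \<mu> - \<delta> < lam \<and> lam < \<mu> \<longrightarrow> small_branch lam \<epsilon>)"
proof -
  interpret potential_perturbation ipa "Ah \<mu>" samples Cop Dh \<sigma> "rh \<mu>" \<mu> action by (rule potential_perturbation_rh)
  have "N lam u = 0 \<longleftrightarrow> Gh lam u = u" for lam u by (auto simp: N_def rh_def)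
  then have eq: "small_solution = small_branch" by (intro ext) (simp add: small_solution_def small_branch_def)
  have "Ker \<noteq> {0}" using assms by (auto simp: Ker_def)
  from bifurcation_alternative[OF this] show ?thesis unfolding eq .
qed

end

section \<open>Solutions of the delay problem\<close>

text \<open>
  The solution of the delay problem in the original time, translated by \<open>s\<close>. The translations produce
  different solutions from a single one.
\<close>

definition rescaled :: "real \<Rightarrow> 'a::euclidean_space antiperiodic \<Rightarrow> real \<Rightarrow> real \<Rightarrow> 'a" where
  "rescaled \<tau> u s t = ap (Cop u) (t / \<tau> + s)"

lemma rescaled_derivative:
  assumes "\<tau> > 0"
  shows "(rescaled \<tau> u s has_vector_derivative
      (1 / \<tau>) *\<^sub>R (ap u (t / \<tau> + s - 1) + ap u (t / \<tau> + s - 2))) (at t)"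
proof -
  have "((\<lambda>t. t / \<tau> + s) has_vector_derivative 1 / \<tau>) (at t)"
    using assms by (auto intro!: derivative_eq_intros simp: has_real_derivative_iff_has_vector_derivative[symmetric])
  from vector_diff_chain_at[OF this Cop_derivative[of u]]
  show ?thesis unfolding rescaled_def[abs_def] by (simp add: o_def)
qed

lemma sum_two: "(\<Sum>j=1..2. f (real j)) = f 1 + f 2" for f :: "real \<Rightarrow> 'a::comm_monoid_add"
  by (simp add: numeral_2_eq_2)

text \<open>
  A continuous function with arbitrarily small periods takes, arbitrarily close to any time, the value it
  has at \<open>t0\<close>; near \<open>t0 + 3\<close> this is impossible, because the sign is reversed there.
\<close>

lemma periods_bounded_below:
  fixes y :: "'a::real_normed_vector antiperiodic"
  assumes "y \<noteq> 0"
  obtains \<delta> where "\<delta> > 0" "\<And>p. 0 < p \<Longrightarrow> p < \<delta> \<Longrightarrow> \<not> (\<forall>t. ap y (t + p) = ap y t)"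
proof -
  obtain t0 where t0: "ap y t0 \<noteq> 0" using assms ap_eqI[of y 0] by auto
  have "continuous (at (t0 + 3)) (ap y)" using continuous_on_ap[of UNIV y] by (simp add: continuous_on_eq_continuous_at)
  then obtain \<delta> where \<delta>: "\<delta> > 0" "\<And>x. dist x (t0 + 3) < \<delta> \<Longrightarrow> dist (ap y x) (ap y (t0 + 3)) < 2 * norm (ap y t0)"
    unfolding continuous_at_eps_delta using t0 by (metis mult_pos_pos zero_less_norm_iff zero_less_numeral)
  show thesis
  proof (rule that[OF \<delta>(1)], rule notI)
    fix p :: real assume p: "0 < p" "p < \<delta>" and per: "\<forall>t. ap y (t + p) = ap y t"
    have mult: "ap y (t0 + real n * p) = ap y t0" for n
    proof (induction n)
      case (Suc n)
      have "ap y (t0 + real (Suc n) * p) = ap y (t0 + real n * p + p)" by (simp add: algebra_simps)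
      then show ?case using per Suc by simp
    qed simp
    define n where "n = nat \<lfloor>3 / p\<rfloor>"
    have "real n \<le> 3 / p" "3 / p < real n + 1" using p(1) by (auto simp: n_def)
    then have "real n * p \<le> 3" "3 < real n * p + p" using p(1) by (auto simp: field_simps)
    then have "dist (t0 + real n * p) (t0 + 3) < \<delta>" using p by (simp add: dist_real_def)
    from \<delta>(2)[OF this] have "norm (ap y t0 + ap y t0) < 2 * norm (ap y t0)" by (simp add: mult dist_norm ap_shift)
    then show False by (simp flip: scaleR_2)
  qed
qed

text \<open>
  If two translates by \<open>s i\<close> and \<open>s j\<close> agree up to sign, then \<open>2 (s j - s i)\<close> is a period. So translations by
  amounts small against the least period give distinct pairs.
\<close>

lemma rescaled_distinct_pairs:
  fixes u :: "'a::euclidean_space antiperiodic"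
  assumes "\<tau> > 0" "Cop u \<noteq> 0"
  obtains s :: "nat \<Rightarrow> real" where "inj_on (\<lambda>i. {rescaled \<tau> u (s i), - rescaled \<tau> u (s i)}) {1..n}"
proof -
  obtain \<delta> where \<delta>: "\<delta> > 0" "\<And>p. 0 < p \<Longrightarrow> p < \<delta> \<Longrightarrow> \<not> (\<forall>t. ap (Cop u) (t + p) = ap (Cop u) t)"
    using periods_bounded_below[OF assms(2)] by blast
  define s where "s i = \<delta> * real i / (4 * (real n + 1))" for i :: nat
  have neq: "{rescaled \<tau> u (s i), - rescaled \<tau> u (s i)} \<noteq> {rescaled \<tau> u (s j), - rescaled \<tau> u (s j)}"
    if ij: "i < j" "j \<le> n" for i j
  proof
    assume "{rescaled \<tau> u (s i), - rescaled \<tau> u (s i)} = {rescaled \<tau> u (s j), - rescaled \<tau> u (s j)}"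
    then have cases: "rescaled \<tau> u (s i) = rescaled \<tau> u (s j) \<or> rescaled \<tau> u (s i) = - rescaled \<tau> u (s j)" by blast
    have val: "ap (Cop u) (t + s k) = rescaled \<tau> u (s k) (\<tau> * t)" for t k
      using assms(1) by (simp add: rescaled_def)
    define d where "d = s j - s i"
    have dn: "d = \<delta> * (real j - real i) / (4 * (real n + 1))" by (simp add: d_def s_def diff_divide_distrib algebra_simps)
    have d: "0 < 2 * d" "2 * d < \<delta>"
    proof -
      show "0 < 2 * d" using \<delta>(1) ij by (simp add: dn)
      have "\<delta> * (2 * (real j - real i)) < \<delta> * (4 * (real n + 1))" using \<delta>(1) ij by (intro mult_strict_left_mono) auto
      moreover have "2 * d = \<delta> * (2 * (real j - real i)) / (4 * (real n + 1))" by (simp add: dn)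
      moreover have "4 * (real n + 1) > 0" by simp
      ultimately show "2 * d < \<delta>" by (simp only: pos_divide_less_eq)
    qed
    obtain c :: real where c: "c * c = 1" "\<And>t. ap (Cop u) (t + s i) = c *\<^sub>R ap (Cop u) (t + s j)"
      using cases
    proof
      assume "rescaled \<tau> u (s i) = rescaled \<tau> u (s j)"
      then show thesis by (intro that[of 1]) (simp_all add: val)
    next
      assume "rescaled \<tau> u (s i) = - rescaled \<tau> u (s j)"
      then show thesis by (intro that[of "-1"]) (simp_all add: val)
    qed
    have step: "ap (Cop u) t = c *\<^sub>R ap (Cop u) (t + d)" for t
      using c(2)[of "t - s i"] by (simp add: d_def algebra_simps)
    have "ap (Cop u) (t + 2 * d) = ap (Cop u) t" for t
    proof -
      have "ap (Cop u) t = (c * c) *\<^sub>R ap (Cop u) (t + d + d)" using step[of t] step[of "t + d"] by (metis scaleR_scaleR)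
      then show ?thesis by (simp add: c(1) algebra_simps)
    qed
    then show False using \<delta>(2)[OF d] by blast
  qed
  have "inj_on (\<lambda>i. {rescaled \<tau> u (s i), - rescaled \<tau> u (s i)}) {1..n}"
  proof (rule inj_onI)
    fix i j assume ij: "i \<in> {1..n}" "j \<in> {1..n}"
      and eq: "{rescaled \<tau> u (s i), - rescaled \<tau> u (s i)} = {rescaled \<tau> u (s j), - rescaled \<tau> u (s j)}"
    show "i = j"
    proof (rule linorder_cases[of i j])
      assume "i < j" then show ?thesis using neq[of i j] ij eq by auto
    next
      assume "j < i" then show ?thesis using neq[of j i] ij eq by auto
    qed
  qed
  then show thesis by (rule that)
qed

lemma rescaled_C1_limit:
  fixes u :: "'i \<Rightarrow> 'a::euclidean_space antiperiodic"
  assumes \<tau>: "\<tau> > 0" and lim: "(u \<longlongrightarrow> 0) F"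
    and X: "eventually (\<lambda>i. X i = rescaled \<tau> (u i) (s i)) F"
  shows "C1_loc_limit X 0 F"
  unfolding C1_loc_limit_def
proof (intro allI impI conjI)
  fix K :: "real set"
  have ev: "eventually (\<lambda>i. X i = rescaled \<tau> (u i) (s i) \<and> norm (u i) < e) F" if "e > 0" for e
    using X tendstoD[OF lim that] by eventually_elim (simp add: dist_norm)
  show "uniform_limit K X 0 F"
  proof (rule uniform_limitI)
    fix e :: real assume e: "e > 0"
    then have "e / 2 > 0" by simp
    from ev[OF this] show "\<forall>\<^sub>F i in F. \<forall>t\<in>K. dist (X i t) ((0 :: real \<Rightarrow> 'a) t) < e"
    proof eventually_elim
      case (elim i)
      have "norm (rescaled \<tau> (u i) (s i) t) < e" for t
        using norm_ap_Cop[of "u i" "t / \<tau> + s i"] elim by (simp add: rescaled_def)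
      then show ?case using elim by (simp add: dist_norm)
    qed
  qed
  show "uniform_limit K (\<lambda>i t. vector_derivative (X i) (at t)) (\<lambda>t. vector_derivative (0 :: real \<Rightarrow> 'a) (at t)) F"
  proof (rule uniform_limitI)
    fix e :: real assume e: "e > 0"
    then have "e * \<tau> / 2 > 0" using \<tau> by simp
    from ev[OF this] show "\<forall>\<^sub>F i in F. \<forall>t\<in>K. dist (vector_derivative (X i) (at t)) (vector_derivative (0 :: real \<Rightarrow> 'a) (at t)) < e"
    proof eventually_elim
      case (elim i)
      show ?case
      proof
        fix t
        let ?t = "t / \<tau> + s i"
        have "vector_derivative (X i) (at t) = (1 / \<tau>) *\<^sub>R (ap (u i) (?t - 1) + ap (u i) (?t - 2))"
          using elim vector_derivative_at[OF rescaled_derivative[OF \<tau>]] by simp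
        moreover have "norm (ap (u i) (?t - 1) + ap (u i) (?t - 2)) < e * \<tau>"
          using norm_triangle_ineq[of "ap (u i) (?t - 1)" "ap (u i) (?t - 2)"] norm_ap_le[of "u i" "?t - 1"]
            norm_ap_le[of "u i" "?t - 2"] elim by linarith
        moreover have "vector_derivative (0 :: real \<Rightarrow> 'a) (at t) = 0" by (simp add: zero_fun_def)
        ultimately show "dist (vector_derivative (X i) (at t)) (vector_derivative (0 :: real \<Rightarrow> 'a) (at t)) < e"
          using \<tau> by (simp add: dist_norm pos_divide_less_eq)
      qed
    qed
  qed
qed

context even_C2_family
begin

lemma rescaled_solution:
  assumes "Gh lam u = u"
  shows "rescaled \<tau> u s \<in> delay_solutions V0 V1 \<tau> lam"
  unfolding delay_solutions_def
proof (intro CollectI conjI allI)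
  fix t
  have u: "ap u r = \<tau> *\<^sub>R (gradient V0 (ap (Cop u) r) + lam *\<^sub>R gradient V1 (ap (Cop u) r))" for r
    using ap_Gh[of lam u r] assms by (simp add: G_def)
  have r: "rescaled \<tau> u s (t - real j * \<tau>) = ap (Cop u) (t / \<tau> + s - real j)" for j
    using \<tau> by (simp add: rescaled_def diff_divide_distrib algebra_simps)
  have "(1 / \<tau>) *\<^sub>R (ap u (t / \<tau> + s - 1) + ap u (t / \<tau> + s - 2)) =
      (\<Sum>j=1..2. gradient V0 (rescaled \<tau> u s (t - real j * \<tau>))) +
      lam *\<^sub>R (\<Sum>j=1..2. gradient V1 (rescaled \<tau> u s (t - real j * \<tau>)))"
    using \<tau> unfolding u r sum_two[of "\<lambda>j. gradient V0 (ap (Cop u) (t / \<tau> + s - j))"]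
      sum_two[of "\<lambda>j. gradient V1 (ap (Cop u) (t / \<tau> + s - j))"]
    by (simp add: algebra_simps)
  then show "(rescaled \<tau> u s has_vector_derivative
      ((\<Sum>j=1..2. gradient V0 (rescaled \<tau> u s (t - real j * \<tau>))) +
      lam *\<^sub>R (\<Sum>j=1..2. gradient V1 (rescaled \<tau> u s (t - real j * \<tau>))))) (at t)"
    using rescaled_derivative[OF \<tau>, of u s t] by simp
  have shift: "(t + 3 * \<tau>) / \<tau> + s = t / \<tau> + s + 3" using \<tau> by (simp add: field_simps)
  show "rescaled \<tau> u s (t + 3 * \<tau>) = - rescaled \<tau> u s t" unfolding rescaled_def shift by (rule ap_shift)
qed

lemma Cop_nonzero: "Gh lam u = u \<Longrightarrow> u \<noteq> 0 \<Longrightarrow> Cop u \<noteq> 0"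
proof
  assume u: "Gh lam u = u" "u \<noteq> 0" "Cop u = 0"
  have "ap u t = 0" for t using ap_Gh[of lam u t] u by (simp add: G_zero)
  then show False using u(2) ap_eqI[of u 0] by simp
qed

lemma rescaled_nonzero: "Cop u \<noteq> 0 \<Longrightarrow> rescaled \<tau> u s \<noteq> 0"
proof
  assume n: "Cop u \<noteq> 0" and z: "rescaled \<tau> u s = 0"
  have "ap (Cop u) t = 0" for t
    using fun_cong[OF z, of "\<tau> * (t - s)"] \<tau> by (simp add: rescaled_def)
  then show False using n ap_eqI[of "Cop u" 0] by simp
qed

lemma linear_solution_Hammerstein:
  assumes "x \<in> linear_delay_solutions V0 V1 \<tau> lam"
  obtains u where "Ah lam u = u" "x = rescaled \<tau> u 0"
proof -
  define H where "H v = hessian V0 0 *v v + lam *\<^sub>R (hessian V1 0 *v v)" for v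
  have sum: "(\<Sum>j=1..2. x (t - real j * \<tau>)) = x (t - \<tau>) + x (t - 2 * \<tau>)" for t
    using sum_two[of "\<lambda>j. x (t - j * \<tau>)"] by simp
  have "x \<in> linear_delay_solutions V0 V1 \<tau> lam \<longleftrightarrow>
      (\<forall>t. (x has_vector_derivative H (x (t - \<tau>) + x (t - 2 * \<tau>))) (at t)) \<and> (\<forall>t. x (t + 3 * \<tau>) = - x t)"
    by (simp only: linear_delay_solutions_def mem_Collect_eq sum H_def)
  with assms have x: "(x has_vector_derivative H (x (t - \<tau>) + x (t - 2 * \<tau>))) (at t)" "x (t + 3 * \<tau>) = - x t" for t
    by blast+
  define y where "y t = x (\<tau> * t)" for t
  have dy: "(y has_vector_derivative \<tau> *\<^sub>R H (y (t - 1) + y (t - 2))) (at t)" for t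
  proof -
    have "((\<lambda>t. \<tau> * t) has_vector_derivative \<tau>) (at t)"
      by (auto intro!: derivative_eq_intros simp: has_real_derivative_iff_has_vector_derivative[symmetric])
    from vector_diff_chain_at[OF this x(1)] show ?thesis unfolding y_def[abs_def] by (simp add: o_def algebra_simps)
  qed
  have "continuous_on UNIV y"
    by (intro continuous_at_imp_continuous_on ballI has_vector_derivative_continuous[OF dy])
  moreover have "y (t + 3) = - y t" for t using x(2)[of "\<tau> * t"] by (simp add: y_def algebra_simps)
  ultimately have apy: "ap (of_fun y) = y" by (intro ap_of_fun)
  define u where "u = nemytskii (B lam) (of_fun y)"
  have apu: "ap u t = \<tau> *\<^sub>R H (y t)" for t
    by (simp add: u_def ap_nemytskii_linear bounded_linear_B apy B_def H1_def H_def algebra_simps)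
  have Hadd: "H (v + w) = H v + H w" for v w by (simp add: H_def matrix_vector_right_distrib algebra_simps)
  have C: "of_fun y = Cop u"
    by (rule antiperiodic_primitive_unique) (use dy in \<open>simp add: apy apu Hadd scaleR_add_right\<close>)
  have "Ah lam u = u" by (simp only: Ah_def C[symmetric] u_def[symmetric])
  moreover have "x = rescaled \<tau> u 0"
    using \<tau> by (simp add: fun_eq_iff rescaled_def C[symmetric] apy y_def)
  ultimately show thesis by (rule that)
qed

lemma rescaled_zero: "rescaled \<tau> 0 s = (0 :: real \<Rightarrow> real^'n)"
  by (simp add: fun_eq_iff rescaled_def linear_0[OF bounded_linear.linear[OF bounded_linear_Cop]])

lemma degenerate_Hammerstein:
  assumes "lam \<in> degenerate_params V0 V1 \<tau>"
  obtains u where "u \<noteq> 0" "Ah lam u = u"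
proof -
  have "\<exists>x\<in>linear_delay_solutions V0 V1 \<tau> lam. x \<noteq> 0"
  proof (rule ccontr)
    assume "\<not> ?thesis"
    then have "linear_delay_solutions V0 V1 \<tau> lam \<subseteq> span {}" by auto
    then have "dim (linear_delay_solutions V0 V1 \<tau> lam) \<le> card ({} :: (real \<Rightarrow> real^'n) set)"
      by (rule real_vector.dim_le_card) simp
    then show False using assms by (simp add: degenerate_params_def nullity_def)
  qed
  then obtain x where x: "x \<in> linear_delay_solutions V0 V1 \<tau> lam" "x \<noteq> 0" by blast
  then obtain u where u: "Ah lam u = u" "x = rescaled \<tau> u 0" using linear_solution_Hammerstein by blast
  then have "u \<noteq> 0" using x(2) rescaled_zero by auto
  then show thesis using u that by blast
qed

lemma bifurcating_pairs_zero: "bifurcating_pairs V0 V1 \<tau> \<mu> L 0"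
  by (simp add: bifurcating_pairs_def)

text \<open>
  One small nontrivial solution for each parameter is enough, as its translates provide any number of
  pairs. For convergence the solutions have to be chosen almost as small as possible: the norm exceeds
  the infimum over all nontrivial solutions by at most \<open>\<bar>lam - \<mu>\<bar>\<close>.
\<close>

lemma bifurcating_pairs_from_branch:
  assumes ex: "\<And>lam. lam \<in> L - {\<mu>} \<Longrightarrow> \<exists>u. u \<noteq> 0 \<and> Gh lam u = u"
    and small: "\<And>\<epsilon>. \<epsilon> > 0 \<Longrightarrow> \<exists>\<delta>>0. \<forall>lam\<in>L - {\<mu>}. \<bar>lam - \<mu>\<bar> < \<delta> \<longrightarrow> small_branch lam \<epsilon>"
  shows "bifurcating_pairs V0 V1 \<tau> \<mu> L n"
proof -
  have "\<exists>u. u \<noteq> 0 \<and> Gh lam u = u \<and> (\<forall>v. v \<noteq> 0 \<and> Gh lam v = v \<longrightarrow> norm u \<le> norm v + \<bar>lam - \<mu>\<bar>)"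
    if lam: "lam \<in> L - {\<mu>}" for lam
  proof -
    define N where "N = {norm u | u. u \<noteq> 0 \<and> Gh lam u = u}"
    have ne: "N \<noteq> {}" using ex[OF lam] by (auto simp: N_def)
    have bdd: "bdd_below N" by (auto simp: N_def intro!: bdd_belowI[of _ 0])
    have "Inf N < Inf N + \<bar>lam - \<mu>\<bar>" using lam by simp
    then obtain a where a: "a \<in> N" "a < Inf N + \<bar>lam - \<mu>\<bar>" using cInf_lessD[OF ne] by blast
    obtain u where u: "u \<noteq> 0" "Gh lam u = u" "a = norm u" using a(1) by (auto simp: N_def)
    have "norm u \<le> norm v + \<bar>lam - \<mu>\<bar>" if v: "v \<noteq> 0" "Gh lam v = v" for v
    proof -
      have "Inf N \<le> norm v" by (rule cInf_lower[OF _ bdd]) (use v in \<open>auto simp: N_def\<close>)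
      then show ?thesis using a(2) u(3) by simp
    qed
    then show ?thesis using u by blast
  qed
  then obtain U where U: "\<And>lam. lam \<in> L - {\<mu>} \<Longrightarrow> U lam \<noteq> 0" "\<And>lam. lam \<in> L - {\<mu>} \<Longrightarrow> Gh lam (U lam) = U lam"
    "\<And>lam v. lam \<in> L - {\<mu>} \<Longrightarrow> v \<noteq> 0 \<Longrightarrow> Gh lam v = v \<Longrightarrow> norm (U lam) \<le> norm v + \<bar>lam - \<mu>\<bar>"
    by metis
  have lim: "(U \<longlongrightarrow> 0) (at \<mu> within L)"
  proof (rule tendstoI)
    fix e :: real assume "e > 0"
    then have e2: "e / 2 > 0" by simp
    obtain \<delta> where \<delta>: "\<delta> > 0" "\<And>lam. lam \<in> L - {\<mu>} \<Longrightarrow> \<bar>lam - \<mu>\<bar> < \<delta> \<Longrightarrow> small_branch lam (e / 2)"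
      using small[OF e2] by blast
    have "norm (U lam) < e" if lam: "lam \<in> L" "lam \<noteq> \<mu>" "\<bar>lam - \<mu>\<bar> < min \<delta> (e / 2)" for lam
    proof -
      obtain v where "v \<noteq> 0" "norm v < e / 2" "Gh lam v = v" using \<delta>(2)[of lam] lam by (auto simp: small_branch_def)
      then show ?thesis using U(3)[of lam v] lam by auto
    qed
    then show "\<forall>\<^sub>F lam in at \<mu> within L. dist (U lam) 0 < e"
      unfolding eventually_at using \<delta>(1) e2 by (intro exI[of _ "min \<delta> (e / 2)"]) (auto simp: dist_real_def)
  qed
  define distinct_pairs where
    "distinct_pairs lam s \<longleftrightarrow> inj_on (\<lambda>i::nat. {rescaled \<tau> (U lam) (s i), - rescaled \<tau> (U lam) (s i)}) {1..n}" for lam s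
  have "\<exists>s. distinct_pairs lam s" if "lam \<in> L - {\<mu>}" for lam
    unfolding distinct_pairs_def
    by (rule rescaled_distinct_pairs[OF \<tau> Cop_nonzero[OF U(2)[OF that] U(1)[OF that]]]) (rule exI)
  then obtain S where S: "\<And>lam. lam \<in> L - {\<mu>} \<Longrightarrow> distinct_pairs lam (S lam)" by metis
  show ?thesis
    unfolding bifurcating_pairs_def
  proof (intro exI[of _ "\<lambda>i lam. rescaled \<tau> (U lam) (S lam i)"] conjI ballI)
    fix lam i assume lam: "lam \<in> L - {\<mu>}"
    show "rescaled \<tau> (U lam) (S lam i) \<in> delay_solutions V0 V1 \<tau> lam" "rescaled \<tau> (U lam) (S lam i) \<noteq> 0"
      using rescaled_solution[OF U(2)[OF lam]] rescaled_nonzero[OF Cop_nonzero[OF U(2,1)[OF lam]]] by simp_all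
  next
    fix lam assume "lam \<in> L - {\<mu>}"
    then show "inj_on (\<lambda>i. {rescaled \<tau> (U lam) (S lam i), - rescaled \<tau> (U lam) (S lam i)}) {1..n}"
      using S unfolding distinct_pairs_def by blast
  next
    fix i :: nat
    show "C1_loc_limit (\<lambda>lam. rescaled \<tau> (U lam) (S lam i)) 0 (at \<mu> within L)"
      by (rule rescaled_C1_limit[OF \<tau> lim, of _ "\<lambda>lam. S lam i"]) simp
  qed
qed

lemma solution_sequence:
  assumes small: "\<And>\<epsilon>. \<epsilon> > 0 \<Longrightarrow> small_branch \<mu> \<epsilon>"
  shows "\<exists>x :: nat \<Rightarrow> real \<Rightarrow> real^'n. inj x \<and> (\<forall>k. x k \<in> delay_solutions V0 V1 \<tau> \<mu> \<and> x k \<noteq> 0) \<and> C1_loc_limit x 0 sequentially"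
proof -
  have "\<exists>u. \<forall>k::nat. (u k \<noteq> 0 \<and> norm (u k) < inverse (real (Suc k)) \<and> Gh \<mu> (u k) = u k) \<and> norm (u (Suc k)) < norm (u k)"
  proof (rule dependent_nat_choice)
    show "\<exists>u. u \<noteq> 0 \<and> norm u < inverse (real (Suc 0)) \<and> Gh \<mu> u = u" using small[of 1] by (simp add: small_branch_def)
    fix u k assume u: "u \<noteq> 0 \<and> norm u < inverse (real (Suc k)) \<and> Gh \<mu> u = u"
    have "min (norm u) (inverse (real (Suc (Suc k)))) > 0" using u by simp
    from small[OF this] show "\<exists>v. (v \<noteq> 0 \<and> norm v < inverse (real (Suc (Suc k))) \<and> Gh \<mu> v = v) \<and> norm v < norm u"
      unfolding small_branch_def by auto
  qed
  then obtain u where *: "\<forall>k::nat. (u k \<noteq> 0 \<and> norm (u k) < inverse (real (Suc k)) \<and> Gh \<mu> (u k) = u k) \<and> norm (u (Suc k)) < norm (u k)"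
    by (rule exE)
  have u: "u k \<noteq> 0" "norm (u k) < inverse (real (Suc k))" "Gh \<mu> (u k) = u k" "norm (u (Suc k)) < norm (u k)" for k
    by (rule spec[OF *, THEN conjunct1, THEN conjunct1] spec[OF *, THEN conjunct1, THEN conjunct2, THEN conjunct1]
        spec[OF *, THEN conjunct1, THEN conjunct2, THEN conjunct2] spec[OF *, THEN conjunct2])+
  have dec: "norm (u n) < norm (u m)" if "m < n" for m n
    using lift_Suc_mono_less[of "\<lambda>k. - norm (u k)" m n] u(4) that by simp
  have lim: "u \<longlonglongrightarrow> 0"
    by (rule Lim_null_comparison[OF _ LIMSEQ_inverse_real_of_nat]) (use u(2) in \<open>auto intro!: always_eventually less_imp_le\<close>)
  have "inj (\<lambda>k. rescaled \<tau> (u k) 0)"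
  proof (rule injI)
    fix m n assume eq: "rescaled \<tau> (u m) 0 = rescaled \<tau> (u n) 0"
    have "ap (Cop (u m)) t = ap (Cop (u n)) t" for t
      using fun_cong[OF eq, of "\<tau> * t"] \<tau> by (simp add: rescaled_def)
    then have "ap (Gh \<mu> (u m)) t = ap (Gh \<mu> (u n)) t" for t by (simp add: ap_Gh)
    then have "Gh \<mu> (u m) = Gh \<mu> (u n)" by (rule ap_eqI)
    then have "u m = u n" by (simp only: u(3))
    then show "m = n" using dec[of m n] dec[of n m] by (metis less_irrefl linorder_neqE_nat)
  qed
  moreover have "rescaled \<tau> (u k) 0 \<in> delay_solutions V0 V1 \<tau> \<mu> \<and> rescaled \<tau> (u k) 0 \<noteq> 0" for k
    using rescaled_solution[OF u(3)] rescaled_nonzero[OF Cop_nonzero[OF u(3,1)]] by simp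
  moreover have "C1_loc_limit (\<lambda>k. rescaled \<tau> (u k) 0) 0 sequentially"
    by (rule rescaled_C1_limit[OF \<tau> lim, of _ "\<lambda>k. 0"]) simp
  ultimately show ?thesis by blast
qed

end

context definite_C2_family
begin

lemma degenerate_params_isolated:
  obtains \<delta> where "\<delta> > 0" "\<And>lam. lam \<noteq> \<mu> \<Longrightarrow> \<bar>lam - \<mu>\<bar> < \<delta> \<Longrightarrow> lam \<notin> degenerate_params V0 V1 \<tau>"
proof -
  obtain \<delta> where "\<delta> > 0" "\<And>lam u. lam \<noteq> \<mu> \<Longrightarrow> \<bar>lam - \<mu>\<bar> < \<delta> \<Longrightarrow> Ah lam u = u \<Longrightarrow> u = 0"
    using linear_solutions_isolated by blast
  then show thesis using degenerate_Hammerstein that by metis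
qed

lemma degenerate_params_discrete_closed:
  "discrete (degenerate_params V0 V1 \<tau>) \<and> closed (degenerate_params V0 V1 \<tau>)"
proof -
  have "\<not> \<mu> islimpt degenerate_params V0 V1 \<tau>" for \<mu>
  proof -
    obtain \<delta> where "\<delta> > 0" "\<And>lam. lam \<noteq> \<mu> \<Longrightarrow> \<bar>lam - \<mu>\<bar> < \<delta> \<Longrightarrow> lam \<notin> degenerate_params V0 V1 \<tau>"
      using degenerate_params_isolated by blast
    then show ?thesis unfolding islimpt_approachable dist_real_def by blast
  qed
  then show ?thesis by (auto simp: discrete_def isolated_in_islimpt_iff closed_limpt)
qed

text \<open>
  In the one-sided alternatives all pairs are taken on the side where the branch exists, and none on the
  other side.
\<close>

theorem bifurcation_at_degenerate_params:
  assumes \<mu>: "\<mu> \<in> degenerate_params V0 V1 \<tau>"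
  shows "(\<exists>x :: nat \<Rightarrow> real \<Rightarrow> real^'n. inj x \<and> (\<forall>k. x k \<in> delay_solutions V0 V1 \<tau> \<mu> \<and> x k \<noteq> 0) \<and>
        C1_loc_limit x 0 sequentially)
    \<or> (\<exists>L\<^sub>m L\<^sub>p n\<^sub>m n\<^sub>p. left_nbhd \<mu> L\<^sub>m \<and> right_nbhd \<mu> L\<^sub>p \<and> n\<^sub>p + n\<^sub>m \<ge> nullity V0 V1 \<tau> \<mu> \<and>
        bifurcating_pairs V0 V1 \<tau> \<mu> L\<^sub>m n\<^sub>m \<and> bifurcating_pairs V0 V1 \<tau> \<mu> L\<^sub>p n\<^sub>p)"
proof -
  let ?n = "nullity V0 V1 \<tau> \<mu>"
  obtain w where w: "w \<noteq> 0" "Ah \<mu> w = w" using degenerate_Hammerstein[OF \<mu>] by blast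
  consider (seq) "\<forall>\<epsilon>>0. small_branch \<mu> \<epsilon>"
    | (right) "\<forall>\<epsilon>>0. \<exists>\<delta>>0. \<forall>lam. \<mu> < lam \<and> lam < \<mu> + \<delta> \<longrightarrow> small_branch lam \<epsilon>"
    | (left) "\<forall>\<epsilon>>0. \<exists>\<delta>>0. \<forall>lam. \<mu> - \<delta> < lam \<and> lam < \<mu> \<longrightarrow> small_branch lam \<epsilon>"
    using hammerstein_bifurcation[OF w] by blast
  then show ?thesis
  proof cases
    case seq
    then show ?thesis by (intro disjI1 solution_sequence) simp
  next
    case right
    obtain d where d: "d > 0" "\<And>lam. \<mu> < lam \<Longrightarrow> lam < \<mu> + d \<Longrightarrow> small_branch lam 1"
      using right[rule_format, of 1] by auto
    have "bifurcating_pairs V0 V1 \<tau> \<mu> {\<mu>..<\<mu> + d} ?n"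
    proof (rule bifurcating_pairs_from_branch)
      fix lam assume "lam \<in> {\<mu>..<\<mu> + d} - {\<mu>}"
      then show "\<exists>u. u \<noteq> 0 \<and> Gh lam u = u" using d(2)[of lam] by (auto simp: small_branch_def)
    next
      fix \<epsilon> :: real assume "\<epsilon> > 0"
      then obtain \<delta> where "\<delta> > 0" "\<And>lam. \<mu> < lam \<Longrightarrow> lam < \<mu> + \<delta> \<Longrightarrow> small_branch lam \<epsilon>" using right by blast
      then show "\<exists>\<delta>>0. \<forall>lam\<in>{\<mu>..<\<mu> + d} - {\<mu>}. \<bar>lam - \<mu>\<bar> < \<delta> \<longrightarrow> small_branch lam \<epsilon>"
        by (intro exI[of _ \<delta>]) auto
    qed
    moreover have "left_nbhd \<mu> {..\<mu>}" by (auto simp: left_nbhd_def intro!: exI[of _ 1])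
    moreover have "right_nbhd \<mu> {\<mu>..<\<mu> + d}" using d(1) by (auto simp: right_nbhd_def)
    ultimately show ?thesis using bifurcating_pairs_zero[of \<mu> "{..\<mu>}"]
      by (intro disjI2 exI[of _ "{..\<mu>}"] exI[of _ "{\<mu>..<\<mu> + d}"] exI[of _ "0::nat"] exI[of _ ?n]) simp
  next
    case left
    obtain d where d: "d > 0" "\<And>lam. \<mu> - d < lam \<Longrightarrow> lam < \<mu> \<Longrightarrow> small_branch lam 1"
      using left[rule_format, of 1] by auto
    have "bifurcating_pairs V0 V1 \<tau> \<mu> {\<mu> - d<..\<mu>} ?n"
    proof (rule bifurcating_pairs_from_branch)
      fix lam assume "lam \<in> {\<mu> - d<..\<mu>} - {\<mu>}"
      then show "\<exists>u. u \<noteq> 0 \<and> Gh lam u = u" using d(2)[of lam] by (auto simp: small_branch_def)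
    next
      fix \<epsilon> :: real assume "\<epsilon> > 0"
      then obtain \<delta> where "\<delta> > 0" "\<And>lam. \<mu> - \<delta> < lam \<Longrightarrow> lam < \<mu> \<Longrightarrow> small_branch lam \<epsilon>" using left by blast
      then show "\<exists>\<delta>>0. \<forall>lam\<in>{\<mu> - d<..\<mu>} - {\<mu>}. \<bar>lam - \<mu>\<bar> < \<delta> \<longrightarrow> small_branch lam \<epsilon>"
        by (intro exI[of _ \<delta>]) auto
    qed
    moreover have "right_nbhd \<mu> {\<mu>..}" by (auto simp: right_nbhd_def intro!: exI[of _ 1])
    moreover have "left_nbhd \<mu> {\<mu> - d<..\<mu>}" using d(1) by (auto simp: left_nbhd_def)
    ultimately show ?thesis using bifurcating_pairs_zero[of \<mu> "{\<mu>..}"]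
      by (intro disjI2 exI[of _ "{\<mu> - d<..\<mu>}"] exI[of _ "{\<mu>..}"] exI[of _ ?n] exI[of _ "0::nat"]) simp
  qed
qed

end

theorem theorem3p4:
  fixes V0 V1 :: "real^'n \<Rightarrow> real" and \<tau> :: real
  assumes "\<tau> > 0"
    and "C2 V0" and "C2 V1"
    and "even_function V0" and "even_function V1"
    and "pos_definite (hessian V1 0) \<or> neg_definite (hessian V1 0)"
  shows "discrete (degenerate_params V0 V1 \<tau>) \<and> closed (degenerate_params V0 V1 \<tau>) \<and>
    (\<forall>\<mu>\<in>degenerate_params V0 V1 \<tau>.
       (\<exists>x :: nat \<Rightarrow> real \<Rightarrow> real^'n.
          inj x \<and>
          (\<forall>k. x k \<in> delay_solutions V0 V1 \<tau> \<mu> \<and> x k \<noteq> 0) \<and>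
          C1_loc_limit x 0 sequentially)
       \<or>
       (\<exists>L\<^sub>m L\<^sub>p n\<^sub>m n\<^sub>p.
          left_nbhd \<mu> L\<^sub>m \<and> right_nbhd \<mu> L\<^sub>p \<and>
          n\<^sub>p + n\<^sub>m \<ge> nullity V0 V1 \<tau> \<mu> \<and>
          bifurcating_pairs V0 V1 \<tau> \<mu> L\<^sub>m n\<^sub>m \<and>
          bifurcating_pairs V0 V1 \<tau> \<mu> L\<^sub>p n\<^sub>p))"
proof -
  have family: "even_C2_family V0 V1 \<tau>" using assms(1-5) by (rule even_C2_family.intro)
  obtain \<sigma> :: real where \<sigma>: "\<And>v. v \<noteq> 0 \<Longrightarrow> \<sigma> * (v \<bullet> (hessian V1 0 *v v)) > 0"
    using assms(6)
  proof
    assume "pos_definite (hessian V1 0)"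
    then show thesis by (intro that[of 1]) (simp add: pos_definite_def)
  next
    assume "neg_definite (hessian V1 0)"
    then show thesis by (intro that[of "-1"]) (simp add: neg_definite_def)
  qed
  interpret definite_C2_family V0 V1 \<tau> \<sigma>
    by (intro definite_C2_family.intro family definite_C2_family_axioms.intro \<sigma>)
  show ?thesis using degenerate_params_discrete_closed bifurcation_at_degenerate_params by blast
qed

end
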